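(* Let $\mathcal{A}$ be a unital $C^*$-algebra and let $N\in\mathbb{N}$. The following are equivalent: (i) $\mathcal{A}$ is $N$-subhomogeneous, i.e. every irreducible representation of $\mathcal{A}$ is finite dimensional of dimension at most $N$; (ii) every matrix extreme point of the matrix state space of $\mathcal{A}$ lies in one of the first $N$ levels, i.e. $\partial\,\mathrm{UCP}(\mathcal{A})\subset\bigcup_{n=1}^N \mathrm{UCP}(\mathcal{A},\mathbb{M}_n)$.
   Context: $\mathbb{M}_n$ denotes the complex $n\times n$ matrices and $\mathbb{M}_{m,n}$ the complex $m\times n$ matrices. $\mathrm{UCP}(\mathcal{A},\mathbb{M}_n)$ is the set of unital completely positive maps $\mathcal{A}\to\mathbb{M}_n$, and the matrix state space is $\mathrm{UCP}(\mathcal{A})=(\mathrm{UCP}(\mathcal{A},\mathbb{M}_n))_{n\in\mathbb{N}}$. A point $\phi\in \mathrm{UCP}(\mathcal{A},\mathbb{M}_n)$ is a matrix extreme point if whenever $\phi=\sum_{i=1}^k\gamma_i^*\phi_i\gamma_i$ with $\phi_i\in \mathrm{UCP}(\mathcal{A},\mathbb{M}_{n_i})$, each $\gamma_i\in\mathbb{M}_{n_i,n}$ surjective (as a linear map $\mathbb{C}^n\to\mathbb{C}^{n_i}$), and $\sum_i\gamma_i^*\gamma_i=1_n$, then for all $i$ one has $n_i=n$ and $\phi=u_i^*\phi_iu_i$ for some unitary $u_i\in\mathbb{M}_n$. $\partial\,\mathrm{UCP}(\mathcal{A})$ denotes the set of all matrix extreme points, over all levels. *)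

theory Defs
  imports "Jordan_Normal_Form.VS_Connect" "Jordan_Normal_Form.Schur_Decomposition"
begin

section \<open>Unital C*-algebras\<close>

class unital_cstar_algebra = real_normed_algebra_1 + banach +
  fixes scaleC :: "complex \<Rightarrow> 'a \<Rightarrow> 'a"
    and star :: "'a \<Rightarrow> 'a"
  assumes scaleC_add_right: "scaleC c (x + y) = scaleC c x + scaleC c y"
    and scaleC_add_left: "scaleC (c + d) x = scaleC c x + scaleC d x"
    and scaleC_scaleC: "scaleC c (scaleC d x) = scaleC (c * d) x"
    and scaleC_of_real: "scaleC (complex_of_real r) x = scaleR r x"
    and mult_scaleC_left: "scaleC c x * y = scaleC c (x * y)"
    and mult_scaleC_right: "x * scaleC c y = scaleC c (x * y)"
    and norm_scaleC: "norm (scaleC c x) = cmod c * norm x"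
    and star_star: "star (star x) = x"
    and star_add: "star (x + y) = star x + star y"
    and star_scaleC: "star (scaleC c x) = scaleC (cnj c) (star x)"
    and star_mult: "star (x * y) = star y * star x"
    and cstar_identity: "norm (star x * x) = (norm x)\<^sup>2"


section \<open>Hilbert spaces\<close>

text \<open>
  A Hilbert space is a HOL-Algebra vector space over the complex numbers, with an arbitrary
  carrier set, together with a complete inner product that is linear in its first argument.
  As usual for module records, the inherited multiplication and unit fields play no role.
\<close>

record 'h inner_space = "(complex, 'h) module" +
  cinner :: "'h \<Rightarrow> 'h \<Rightarrow> complex"

definition hnorm :: "'h inner_space \<Rightarrow> 'h \<Rightarrow> real" where
  "hnorm H x = sqrt (Re (cinner H x x))"

definition hlim :: "'h inner_space \<Rightarrow> (nat \<Rightarrow> 'h) \<Rightarrow> 'h \<Rightarrow> bool" where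
  "hlim H s l \<longleftrightarrow> (\<lambda>n. hnorm H (s n \<ominus>\<^bsub>H\<^esub> l)) \<longlonglongrightarrow> 0"

locale hilbert_space = vectorspace "class_ring :: complex ring" H
  for H :: "'h inner_space" (structure) +
  assumes cinner_add_left:
      "\<lbrakk>x \<in> carrier H; y \<in> carrier H; z \<in> carrier H\<rbrakk>
        \<Longrightarrow> cinner H (x \<oplus> y) z = cinner H x z + cinner H y z"
    and cinner_smult_left:
      "\<lbrakk>x \<in> carrier H; y \<in> carrier H\<rbrakk> \<Longrightarrow> cinner H (c \<odot> x) y = c * cinner H x y"
    and cinner_commute:
      "\<lbrakk>x \<in> carrier H; y \<in> carrier H\<rbrakk> \<Longrightarrow> cinner H y x = cnj (cinner H x y)"
    and cinner_pos:
      "\<lbrakk>x \<in> carrier H; x \<noteq> \<zero>\<rbrakk> \<Longrightarrow> 0 < Re (cinner H x x)"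
    and complete:
      "\<lbrakk>\<And>n. s n \<in> carrier H;
        \<And>e. 0 < e \<Longrightarrow> \<exists>M. \<forall>m\<ge>M. \<forall>n\<ge>M. hnorm H (s m \<ominus> s n) < e\<rbrakk>
        \<Longrightarrow> \<exists>l\<in>carrier H. hlim H s l"

definition bounded_operators :: "'h inner_space \<Rightarrow> ('h \<Rightarrow> 'h) set" where
  "bounded_operators H =
    {T \<in> LinearCombinations.module_hom (class_ring :: complex ring) H H.
      \<exists>K. \<forall>x\<in>carrier H. hnorm H (T x) \<le> K * hnorm H x}"

definition closed_subspace :: "'h inner_space \<Rightarrow> 'h set \<Rightarrow> bool" where
  "closed_subspace H W \<longleftrightarrow>
    VectorSpace.subspace (class_ring :: complex ring) W H \<and>
    (\<forall>s l. (\<forall>n. s n \<in> W) \<and> l \<in> carrier H \<and> hlim H s l \<longrightarrow> l \<in> W)"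


section \<open>Representations and subhomogeneity\<close>

locale representation = hilbert_space H
  for H :: "'h inner_space" (structure) +
  fixes \<pi> :: "'a::unital_cstar_algebra \<Rightarrow> 'h \<Rightarrow> 'h"
  assumes bounded: "\<pi> a \<in> bounded_operators H"
    and rep_add: "x \<in> carrier H \<Longrightarrow> \<pi> (a + b) x = \<pi> a x \<oplus> \<pi> b x"
    and rep_scaleC: "x \<in> carrier H \<Longrightarrow> \<pi> (scaleC c a) x = c \<odot> \<pi> a x"
    and rep_mult: "x \<in> carrier H \<Longrightarrow> \<pi> (a * b) x = \<pi> a (\<pi> b x)"
    and rep_one: "x \<in> carrier H \<Longrightarrow> \<pi> 1 x = x"
    and rep_star: "\<lbrakk>x \<in> carrier H; y \<in> carrier H\<rbrakk>
        \<Longrightarrow> cinner H (\<pi> (star a) x) y = cinner H x (\<pi> a y)"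

definition irreducible_representation ::
    "'h inner_space \<Rightarrow> ('a::unital_cstar_algebra \<Rightarrow> 'h \<Rightarrow> 'h) \<Rightarrow> bool" where
  "irreducible_representation H \<pi> \<longleftrightarrow>
    representation H \<pi> \<and> carrier H \<noteq> {\<zero>\<^bsub>H\<^esub>} \<and>
    (\<forall>W. closed_subspace H W \<and> (\<forall>a. \<pi> a ` W \<subseteq> W) \<longrightarrow> W = {\<zero>\<^bsub>H\<^esub>} \<or> W = carrier H)"

text \<open>
  A formula cannot quantify over types, so the underlying sets of the Hilbert spaces range over
  the subsets of a type of the form \<^typ>\<open>('a \<Rightarrow> complex) + 'h\<close>, with \<^typ>\<open>'h\<close> arbitrary.
  Through the right summand this includes Hilbert spaces over any type \<^typ>\<open>'h\<close>.  The left
  summand makes the range exhaustive up to unitary equivalence: if \<open>\<pi>\<close> is irreducible on \<open>H\<close>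
  and \<open>\<xi> \<noteq> 0\<close>, then \<open>\<xi>\<close> is cyclic, so \<open>x \<mapsto> (a \<mapsto> \<langle>x, \<pi>(a)\<xi>\<rangle>)\<close> embeds \<open>H\<close>
  into \<^typ>\<open>'a \<Rightarrow> complex\<close>.
\<close>

definition subhomogeneous ::
    "'a::unital_cstar_algebra itself \<Rightarrow> 'h itself \<Rightarrow> nat \<Rightarrow> bool" where
  "subhomogeneous _ _ N \<longleftrightarrow>
    (\<forall>(H :: (('a \<Rightarrow> complex) + 'h) inner_space) (\<pi> :: 'a \<Rightarrow> _).
      irreducible_representation H \<pi> \<longrightarrow>
        vectorspace.fin_dim (class_ring :: complex ring) H \<and>
        vectorspace.dim (class_ring :: complex ring) H \<le> N)"


section \<open>The matrix state space\<close>

definition star_mat :: "'a::unital_cstar_algebra mat \<Rightarrow> 'a mat" where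
  "star_mat X = mat (dim_col X) (dim_row X) (\<lambda>(i, j). star (X $$ (j, i)))"

text \<open>A positive element of the C*-algebra of \<open>m \<times> m\<close> matrices over \<open>'a\<close>.\<close>

definition positive_mat :: "nat \<Rightarrow> 'a::unital_cstar_algebra mat \<Rightarrow> bool" where
  "positive_mat m X \<longleftrightarrow> (\<exists>Y\<in>carrier_mat m m. X = star_mat Y * Y)"

definition psd_mat :: "nat \<Rightarrow> complex mat \<Rightarrow> bool" where
  "psd_mat n M \<longleftrightarrow> M \<in> carrier_mat n n \<and> (\<forall>v\<in>carrier_vec n. 0 \<le> (M *\<^sub>v v) \<bullet>c v)"

text \<open>
  Entrywise application of \<open>\<phi>\<close> to an \<open>m \<times> m\<close> matrix; the resulting \<open>m \<times> m\<close> block matrix with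
  blocks of size \<open>n\<close> is read as a complex matrix of size \<open>m * n\<close>.
\<close>

definition ampliation ::
    "nat \<Rightarrow> nat \<Rightarrow> ('a \<Rightarrow> complex mat) \<Rightarrow> 'a mat \<Rightarrow> complex mat" where
  "ampliation m n \<phi> X =
    mat (m * n) (m * n) (\<lambda>(i, j). \<phi> (X $$ (i div n, j div n)) $$ (i mod n, j mod n))"

definition completely_positive ::
    "nat \<Rightarrow> ('a::unital_cstar_algebra \<Rightarrow> complex mat) \<Rightarrow> bool" where
  "completely_positive n \<phi> \<longleftrightarrow>
    (\<forall>m X. positive_mat m X \<longrightarrow> psd_mat (m * n) (ampliation m n \<phi> X))"

definition UCP :: "nat \<Rightarrow> ('a::unital_cstar_algebra \<Rightarrow> complex mat) set" where
  "UCP n = {\<phi>.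
    (\<forall>a. \<phi> a \<in> carrier_mat n n) \<and>
    (\<forall>a b. \<phi> (a + b) = \<phi> a + \<phi> b) \<and>
    (\<forall>c a. \<phi> (scaleC c a) = c \<cdot>\<^sub>m \<phi> a) \<and>
    \<phi> 1 = 1\<^sub>m n \<and>
    completely_positive n \<phi>}"


section \<open>Matrix extreme points\<close>

definition mat_sum :: "nat \<Rightarrow> nat \<Rightarrow> (nat \<Rightarrow> complex mat) \<Rightarrow> complex mat" where
  "mat_sum n k F = mat n n (\<lambda>(i, j). \<Sum>l<k. F l $$ (i, j))"

definition surjective_mat :: "complex mat \<Rightarrow> bool" where
  "surjective_mat \<gamma> \<longleftrightarrow> (\<lambda>v. \<gamma> *\<^sub>v v) ` carrier_vec (dim_col \<gamma>) = carrier_vec (dim_row \<gamma>)"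

definition unitary_mat :: "nat \<Rightarrow> complex mat \<Rightarrow> bool" where
  "unitary_mat n u \<longleftrightarrow>
    u \<in> carrier_mat n n \<and> mat_adjoint u * u = 1\<^sub>m n \<and> u * mat_adjoint u = 1\<^sub>m n"

text \<open>
  Levels are indexed by positive integers.  The summands of a matrix convex combination are
  indexed by \<open>0, \<dots>, k - 1\<close>.
\<close>

definition matrix_extreme_point ::
    "nat \<Rightarrow> ('a::unital_cstar_algebra \<Rightarrow> complex mat) \<Rightarrow> bool" where
  "matrix_extreme_point n \<phi> \<longleftrightarrow>
    0 < n \<and> \<phi> \<in> UCP n \<and>
    (\<forall>k (d :: nat \<Rightarrow> nat) (\<psi> :: nat \<Rightarrow> 'a \<Rightarrow> complex mat) (\<gamma> :: nat \<Rightarrow> complex mat).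
      (\<forall>i<k. 0 < d i \<and> \<psi> i \<in> UCP (d i) \<and>
             \<gamma> i \<in> carrier_mat (d i) n \<and> surjective_mat (\<gamma> i)) \<and>
      mat_sum n k (\<lambda>i. mat_adjoint (\<gamma> i) * \<gamma> i) = 1\<^sub>m n \<and>
      (\<forall>a. \<phi> a = mat_sum n k (\<lambda>i. mat_adjoint (\<gamma> i) * \<psi> i a * \<gamma> i))
      \<longrightarrow> (\<forall>i<k. d i = n \<and>
            (\<exists>u. unitary_mat n u \<and> (\<forall>a. \<phi> a = mat_adjoint u * \<psi> i a * u))))"

definition matrix_extreme_points :: "('a::unital_cstar_algebra \<Rightarrow> complex mat) set" where
  "matrix_extreme_points = {\<phi>. \<exists>n. matrix_extreme_point n \<phi>}"

end

theory Submission
  imports Defs "Jordan_Normal_Form.Spectral_Radius" "HOL-Library.Function_Algebras"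
begin

text \<open>
  Let \<open>\<phi> = V\<^sup>* \<pi> V\<close> be the Stinespring dilation of a matrix extreme point of level \<open>n\<close>.  A projection \<open>P\<close>
  onto a nontrivial closed invariant subspace splits \<open>\<phi>\<close> into \<open>V\<^sup>* P \<pi> V\<close> and \<open>V\<^sup>* (1 - P) \<pi> V\<close>.  By
  extremality \<open>P V\<close> and \<open>(1 - P) V\<close> are injective and \<open>V\<^sup>* P \<pi> V = \<delta>\<^sup>* \<phi> \<delta>\<close> for some matrix \<open>\<delta>\<close>; an
  eigenvector \<open>v\<close> of \<open>\<delta>\<close> yields \<open>P V v \<in> {0, V v}\<close>, a contradiction.  So \<open>\<pi>\<close> is irreducible, and its
  dimension is at least \<open>n\<close>.

  Conversely, if \<open>\<pi>\<close> is irreducible of dimension greater than \<open>N\<close>, compress it to \<open>N + 1\<close> orthonormal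
  vectors.  Each summand of a matrix convex combination representing this compression has the form
  \<open>V\<^sup>* T \<pi> V\<close> with \<open>T\<close> in the commutant of \<open>\<pi>\<close>, so \<open>T\<close> is a scalar and the compression is matrix
  extreme.

  Square roots, in the algebra and for operators commuting with \<open>\<pi>\<close>, come from the iteration
  \<open>Y \<leftarrow> (X + Y\<^sup>2) / 2\<close>; no spectral theory is needed.
\<close>

section \<open>Inner product spaces on carrier sets\<close>

text \<open>Extremality compares \<open>P V\<close> with \<open>V\<close> only up to the matrix
  \<open>\<delta>\<close>, which need not be a scalar. An eigenvector \<open>v\<close> with
  eigenvalue \<open>\<mu>\<close> removes this freedom: for \<open>\<xi> = V v\<close>, the vectors
  \<open>P \<xi>\<close> and \<open>\<mu> \<xi>\<close> induce the same functional on the algebra,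
  so \<open>P \<xi> - t \<xi>\<close> with \<open>t = |\<mu>|^2\<close> is orthogonal to every
  \<open>\<pi> a \<xi>\<close>. To conclude \<open>P \<xi> = t \<xi>\<close> the vector must be
  cyclic, and this comes from extremality applied a second time, to the cyclic subspace of
  \<open>\<xi>\<close>. As \<open>P\<close> is a projection, \<open>t\<close> is 0 or 1.

  The operator \<open>T\<close> of the converse is not given: a summand is only a positive form
  dominated by the form of \<open>\<pi>\<close>, and the Riesz theorem turns it into an operator.

  The Hilbert spaces of the definitions bring their own addition as a record field. The argument
  runs instead on a subset \<open>S\<close> of an additive group type, with the sums of that type;
  completions are sets of complex functions, and injections carry representations between the two
  settings.\<close>

lemma null_comparison:
  fixes f :: "'x \<Rightarrow> 'y::real_normed_vector"
  assumes "\<forall>\<^sub>F n in F. norm (f n) \<le> g n" "(g \<longlongrightarrow> 0) F"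
  shows "(f \<longlongrightarrow> 0) F"
  by (rule tendsto_0_le[OF assms(2), where K = 1]) (use assms(1) in \<open>auto elim: eventually_mono\<close>)

text \<open>The space is a subset \<open>S\<close> of a type with its own addition, so that
  completions can be carved out of function types. Positivity is only semidefinite: the forms coming
  from completely positive maps may have null vectors, which the completion sends to 0.\<close>

locale semi_inner = vector_space sc
  for sc :: "complex \<Rightarrow> 'v::ab_group_add \<Rightarrow> 'v" +
  fixes S :: "'v set" and ip :: "'v \<Rightarrow> 'v \<Rightarrow> complex"
  assumes S_zero [simp]: "0 \<in> S"
    and S_add [simp]: "x \<in> S \<Longrightarrow> y \<in> S \<Longrightarrow> x + y \<in> S"
    and S_sc [simp]: "x \<in> S \<Longrightarrow> sc c x \<in> S"
    and ip_add_left: "x \<in> S \<Longrightarrow> y \<in> S \<Longrightarrow> z \<in> S \<Longrightarrow> ip (x + y) z = ip x z + ip y z"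
    and ip_sc_left: "x \<in> S \<Longrightarrow> y \<in> S \<Longrightarrow> ip (sc c x) y = c * ip x y"
    and ip_cnj: "x \<in> S \<Longrightarrow> y \<in> S \<Longrightarrow> ip y x = cnj (ip x y)"
    and ip_nonneg: "x \<in> S \<Longrightarrow> 0 \<le> Re (ip x x)"
begin

definition nrm :: "'v \<Rightarrow> real" where "nrm x = sqrt (Re (ip x x))"

definition converges :: "(nat \<Rightarrow> 'v) \<Rightarrow> 'v \<Rightarrow> bool" where
  "converges s l \<longleftrightarrow> (\<lambda>n. nrm (s n - l)) \<longlonglongrightarrow> 0"

definition cauchy :: "(nat \<Rightarrow> 'v) \<Rightarrow> bool" where
  "cauchy s \<longleftrightarrow> (\<forall>e>0. \<exists>M. \<forall>m\<ge>M. \<forall>n\<ge>M. nrm (s m - s n) < e)"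

definition linear_subspace :: "'v set \<Rightarrow> bool" where
  "linear_subspace D \<longleftrightarrow> D \<subseteq> S \<and> 0 \<in> D \<and> (\<forall>x\<in>D. \<forall>y\<in>D. x + y \<in> D) \<and> (\<forall>c. \<forall>x\<in>D. sc c x \<in> D)"

definition closed_subsp :: "'v set \<Rightarrow> bool" where
  "closed_subsp W \<longleftrightarrow> linear_subspace W \<and>
    (\<forall>s l. (\<forall>n. s n \<in> W) \<and> l \<in> S \<and> converges s l \<longrightarrow> l \<in> W)"

lemma S_minus [simp]: "x \<in> S \<Longrightarrow> - x \<in> S"
  using S_sc[of x "-1"] by simp

lemma S_diff [simp]: "x \<in> S \<Longrightarrow> y \<in> S \<Longrightarrow> x - y \<in> S"
  using S_add[of x "- y"] by simp

lemma S_sum: "(\<And>i. i \<in> I \<Longrightarrow> f i \<in> S) \<Longrightarrow> (\<Sum>i\<in>I. f i) \<in> S"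
  by (induction I rule: infinite_finite_induct) auto

lemma ip_add_right: "x \<in> S \<Longrightarrow> y \<in> S \<Longrightarrow> z \<in> S \<Longrightarrow> ip x (y + z) = ip x y + ip x z"
  by (metis S_add complex_cnj_add ip_add_left ip_cnj)

lemma ip_sc_right: "x \<in> S \<Longrightarrow> y \<in> S \<Longrightarrow> ip x (sc c y) = cnj c * ip x y"
  by (metis S_sc complex_cnj_mult ip_cnj ip_sc_left)

lemma ip_minus_left: "x \<in> S \<Longrightarrow> y \<in> S \<Longrightarrow> ip (- x) y = - ip x y"
  using ip_sc_left[of x y "-1"] by simp

lemma ip_minus_right: "x \<in> S \<Longrightarrow> y \<in> S \<Longrightarrow> ip x (- y) = - ip x y"
  using ip_sc_right[of x y "-1"] by simp

lemma ip_diff_left: "x \<in> S \<Longrightarrow> y \<in> S \<Longrightarrow> z \<in> S \<Longrightarrow> ip (x - y) z = ip x z - ip y z"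
  using ip_add_left[of x "- y" z] by (simp add: ip_minus_left)

lemma ip_diff_right: "x \<in> S \<Longrightarrow> y \<in> S \<Longrightarrow> z \<in> S \<Longrightarrow> ip x (y - z) = ip x y - ip x z"
  using ip_add_right[of x y "- z"] by (simp add: ip_minus_right)

lemma ip_zero_left [simp]: "x \<in> S \<Longrightarrow> ip 0 x = 0"
  using ip_sc_left[of x x 0] by simp

lemma ip_zero_right [simp]: "x \<in> S \<Longrightarrow> ip x 0 = 0"
  using ip_sc_right[of x x 0] by simp

lemmas ip_simps = ip_add_left ip_add_right ip_diff_left ip_diff_right ip_sc_left ip_sc_right
  ip_minus_left ip_minus_right

lemma ip_sum_left: "(\<And>i. i \<in> I \<Longrightarrow> f i \<in> S) \<Longrightarrow> y \<in> S \<Longrightarrow> ip (\<Sum>i\<in>I. f i) y = (\<Sum>i\<in>I. ip (f i) y)"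
  by (induction I rule: infinite_finite_induct) (auto simp: ip_add_left S_sum)

lemma ip_sum_right: "(\<And>i. i \<in> I \<Longrightarrow> f i \<in> S) \<Longrightarrow> y \<in> S \<Longrightarrow> ip y (\<Sum>i\<in>I. f i) = (\<Sum>i\<in>I. ip y (f i))"
  by (induction I rule: infinite_finite_induct) (auto simp: ip_add_right S_sum)

lemma ip_self: "x \<in> S \<Longrightarrow> ip x x = complex_of_real ((nrm x)\<^sup>2)"
  using ip_cnj[of x x] ip_nonneg[of x] by (auto simp: nrm_def complex_eq_iff)

lemma nrm_ge_0 [simp]: "x \<in> S \<Longrightarrow> 0 \<le> nrm x"
  by (simp add: nrm_def ip_nonneg)

lemma nrm_sq: "x \<in> S \<Longrightarrow> (nrm x)\<^sup>2 = Re (ip x x)"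
  by (simp add: nrm_def ip_nonneg)

lemma nrm_zero [simp]: "nrm 0 = 0"
  by (simp add: nrm_def)

lemma nrm_sc: "x \<in> S \<Longrightarrow> nrm (sc c x) = cmod c * nrm x"
proof -
  assume x: "x \<in> S"
  have "ip (sc c x) (sc c x) = of_real ((cmod c)\<^sup>2) * ip x x"
    using x by (simp add: ip_simps complex_norm_square mult_ac del: of_real_power)
  then have "Re (ip (sc c x) (sc c x)) = (cmod c)\<^sup>2 * Re (ip x x)"
    by (simp del: of_real_power)
  then have "(nrm (sc c x))\<^sup>2 = (cmod c * nrm x)\<^sup>2"
    using x by (simp add: nrm_sq power_mult_distrib)
  then show ?thesis
    using x by (simp add: power2_eq_iff_nonneg)
qed

lemma nrm_minus: "x \<in> S \<Longrightarrow> nrm (- x) = nrm x"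
  using nrm_sc[of x "-1"] by simp

lemma nrm_minus_commute: "x \<in> S \<Longrightarrow> y \<in> S \<Longrightarrow> nrm (x - y) = nrm (y - x)"
  using nrm_minus[of "x - y"] by simp

lemma cauchy_schwarz:
  assumes x: "x \<in> S" and y: "y \<in> S"
  shows "cmod (ip x y) \<le> nrm x * nrm y"
proof -
  define c where "c = ip x y"
  \<comment> \<open>The squared norm of \<open>x - t c y\<close> for real \<open>t\<close>; away
    from null vectors \<open>y\<close> the minimiser is \<open>t = 1 / (nrm y)^2\<close>.\<close>
  have key: "0 \<le> (nrm x)\<^sup>2 - 2 * t * (cmod c)\<^sup>2 + t\<^sup>2 * (cmod c)\<^sup>2 * (nrm y)\<^sup>2" for t :: real
  proof -
    have "ip (x - sc (of_real t * c) y) (x - sc (of_real t * c) y)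
      = ip x x - 2 * of_real t * (c * cnj c) + of_real (t\<^sup>2) * (c * cnj c) * ip y y"
      using x y ip_cnj[OF x y] by (simp add: ip_simps c_def[symmetric] algebra_simps power2_eq_square)
    also have "\<dots> = of_real ((nrm x)\<^sup>2 - 2 * t * (cmod c)\<^sup>2 + t\<^sup>2 * (cmod c)\<^sup>2 * (nrm y)\<^sup>2)"
      using x y by (simp add: ip_self complex_norm_square[symmetric])
    finally have "Re (ip (x - sc (of_real t * c) y) (x - sc (of_real t * c) y))
      = (nrm x)\<^sup>2 - 2 * t * (cmod c)\<^sup>2 + t\<^sup>2 * (cmod c)\<^sup>2 * (nrm y)\<^sup>2"
      by (simp only: Re_complex_of_real)
    then show ?thesis using ip_nonneg[of "x - sc (of_real t * c) y"] x y by simp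
  qed
  have "(cmod c)\<^sup>2 \<le> (nrm x)\<^sup>2 * (nrm y)\<^sup>2"
  proof (cases "nrm y = 0")
    case True
    \<comment> \<open>A null vector \<open>y\<close> makes the quadratic in \<open>t\<close> linear;
      at the chosen \<open>t\<close> it would equal -1.\<close>
    have "cmod c = 0"
    proof (rule ccontr)
      assume "cmod c \<noteq> 0"
      then have "(cmod c)\<^sup>2 > 0" by simp
      then show False
        using key[of "((nrm x)\<^sup>2 + 1) / (2 * (cmod c)\<^sup>2)"] True by (simp add: field_simps)
    qed
    then show ?thesis by simp
  next
    case False
    then have p: "(nrm y)\<^sup>2 > 0" by simp
    show ?thesis
    proof -
      have "(1 / (nrm y)\<^sup>2)\<^sup>2 * (cmod c)\<^sup>2 * (nrm y)\<^sup>2 = (cmod c)\<^sup>2 / (nrm y)\<^sup>2"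
        using p by (simp add: power2_eq_square)
      then have "0 \<le> (nrm x)\<^sup>2 - (cmod c)\<^sup>2 / (nrm y)\<^sup>2"
        using key[of "1 / (nrm y)\<^sup>2"] by simp
      then show ?thesis using p by (simp add: field_simps)
    qed
  qed
  then show ?thesis
    using x y by (simp add: c_def power_mult_distrib[symmetric] power2_le_iff_abs_le)
qed

lemma nrm_add_sq:
  assumes "x \<in> S" "y \<in> S"
  shows "(nrm (x + y))\<^sup>2 = (nrm x)\<^sup>2 + 2 * Re (ip x y) + (nrm y)\<^sup>2"
  using assms ip_cnj[of x y] by (simp add: nrm_sq ip_simps)

lemma nrm_diff_sq:
  assumes "x \<in> S" "y \<in> S"
  shows "(nrm (x - y))\<^sup>2 = (nrm x)\<^sup>2 - 2 * Re (ip x y) + (nrm y)\<^sup>2"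
  using assms ip_cnj[of x y] by (simp add: nrm_sq ip_simps)

lemma nrm_triangle:
  assumes x: "x \<in> S" and y: "y \<in> S"
  shows "nrm (x + y) \<le> nrm x + nrm y"
proof -
  have "Re (ip x y) \<le> nrm x * nrm y"
    using cauchy_schwarz[OF x y] complex_Re_le_cmod[of "ip x y"] by linarith
  then have "(nrm (x + y))\<^sup>2 \<le> (nrm x + nrm y)\<^sup>2"
    using nrm_add_sq[OF x y] by (simp add: power2_sum)
  then show ?thesis using x y by (simp add: power2_le_iff_abs_le)
qed

lemma nrm_triangle_diff: "x \<in> S \<Longrightarrow> y \<in> S \<Longrightarrow> nrm (x - y) \<le> nrm x + nrm y"
  using nrm_triangle[of x "- y"] by (simp add: nrm_minus)

lemma nrm_triangle3:
  "x \<in> S \<Longrightarrow> y \<in> S \<Longrightarrow> z \<in> S \<Longrightarrow> nrm (x - z) \<le> nrm (x - y) + nrm (y - z)"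
  using nrm_triangle[of "x - y" "y - z"] by simp

lemma nrm_reverse_triangle:
  assumes "x \<in> S" "y \<in> S"
  shows "\<bar>nrm x - nrm y\<bar> \<le> nrm (x - y)"
  using nrm_triangle[of "x - y" y] nrm_triangle[of "y - x" x] assms
  by (simp add: nrm_minus_commute[of y x])

lemma converges_const: "converges (\<lambda>n. x) x"
  by (simp add: converges_def)

lemma converges_add:
  assumes "converges s l" "converges t m" "\<And>n. s n \<in> S" "\<And>n. t n \<in> S" "l \<in> S" "m \<in> S"
  shows "converges (\<lambda>n. s n + t n) (l + m)"
  unfolding converges_def
proof (rule tendsto_sandwich[OF _ _ tendsto_const])
  show "(\<lambda>n. nrm (s n - l) + nrm (t n - m)) \<longlonglongrightarrow> 0"
    using tendsto_add[OF assms(1,2)[unfolded converges_def]] by simp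
  show "\<forall>\<^sub>F n in sequentially. nrm (s n + t n - (l + m)) \<le> nrm (s n - l) + nrm (t n - m)"
  proof (intro always_eventually allI)
    fix n
    have e: "s n + t n - (l + m) = (s n - l) + (t n - m)" by simp
    show "nrm (s n + t n - (l + m)) \<le> nrm (s n - l) + nrm (t n - m)"
      unfolding e using assms by (intro nrm_triangle) auto
  qed
qed (use assms in \<open>auto intro!: always_eventually\<close>)

lemma converges_sc:
  assumes "converges s l" "\<And>n. s n \<in> S" "l \<in> S"
  shows "converges (\<lambda>n. sc c (s n)) (sc c l)"
proof -
  have "nrm (sc c (s n) - sc c l) = cmod c * nrm (s n - l)" for n
    using nrm_sc[of "s n - l" c] assms by (simp add: scale_right_diff_distrib)
  then show ?thesis
    using tendsto_mult_left[OF assms(1)[unfolded converges_def], of "cmod c"]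
    by (simp add: converges_def)
qed

lemma converges_diff:
  assumes "converges s l" "converges t m" "\<And>n. s n \<in> S" "\<And>n. t n \<in> S" "l \<in> S" "m \<in> S"
  shows "converges (\<lambda>n. s n - t n) (l - m)"
  using converges_add[OF assms(1) converges_sc[OF assms(2), of "-1"]] assms by simp

lemma converges_ip:
  assumes "converges s l" "\<And>n. s n \<in> S" "l \<in> S" "x \<in> S"
  shows "(\<lambda>n. ip (s n) x) \<longlonglongrightarrow> ip l x"
proof -
  have "(\<lambda>n. ip (s n) x - ip l x) \<longlonglongrightarrow> 0"
  proof (rule null_comparison)
    show "\<forall>\<^sub>F n in sequentially. norm (ip (s n) x - ip l x) \<le> nrm (s n - l) * nrm x"
      using cauchy_schwarz[of "s n - l" x for n] assms by (auto simp: ip_simps intro!: always_eventually)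
    show "(\<lambda>n. nrm (s n - l) * nrm x) \<longlonglongrightarrow> 0"
      using tendsto_mult_right[OF assms(1)[unfolded converges_def], of "nrm x"] by simp
  qed
  then show ?thesis by (rule LIM_zero_cancel)
qed

lemma converges_ip_right:
  assumes "converges s l" "\<And>n. s n \<in> S" "l \<in> S" "x \<in> S"
  shows "(\<lambda>n. ip x (s n)) \<longlonglongrightarrow> ip x l"
  using tendsto_cnj[OF converges_ip[OF assms]] assms by (simp add: ip_cnj[symmetric])

lemma converges_nrm:
  assumes "converges s l" "\<And>n. s n \<in> S" "l \<in> S"
  shows "(\<lambda>n. nrm (s n)) \<longlonglongrightarrow> nrm l"
proof -
  have "(\<lambda>n. nrm (s n) - nrm l) \<longlonglongrightarrow> 0"
  proof (rule null_comparison)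
    show "\<forall>\<^sub>F n in sequentially. norm (nrm (s n) - nrm l) \<le> nrm (s n - l)"
      using nrm_reverse_triangle assms by (auto intro!: always_eventually)
  qed (use assms in \<open>simp add: converges_def\<close>)
  then show ?thesis by (rule LIM_zero_cancel)
qed

lemma converges_cauchy:
  assumes "converges s l" "\<And>n. s n \<in> S" "l \<in> S"
  shows "cauchy s"
  unfolding cauchy_def
proof (intro allI impI)
  fix e :: real assume "e > 0"
  then have "\<forall>\<^sub>F n in sequentially. nrm (s n - l) < e / 2"
    using assms(1) unfolding converges_def by (intro order_tendstoD) auto
  then obtain M where M: "\<And>n. n \<ge> M \<Longrightarrow> nrm (s n - l) < e / 2"
    by (auto simp: eventually_sequentially)
  have "nrm (s m - s n) < e" if "m \<ge> M" "n \<ge> M" for m n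
    using nrm_triangle3[of "s m" l "s n"] M[OF that(1)] M[OF that(2)]
      nrm_minus_commute[of l "s n"] assms by auto
  then show "\<exists>M. \<forall>m\<ge>M. \<forall>n\<ge>M. nrm (s m - s n) < e" by blast
qed

lemma linear_subspaceD:
  assumes "linear_subspace D"
  shows "x \<in> D \<Longrightarrow> x \<in> S" "0 \<in> D" "x \<in> D \<Longrightarrow> y \<in> D \<Longrightarrow> x + y \<in> D" "x \<in> D \<Longrightarrow> sc c x \<in> D"
    "x \<in> D \<Longrightarrow> - x \<in> D" "x \<in> D \<Longrightarrow> y \<in> D \<Longrightarrow> x - y \<in> D"
proof -
  have b: "sc c x \<in> D" if "x \<in> D" for x c
    using assms that unfolding linear_subspace_def by auto
  have a: "x + y \<in> D" if "x \<in> D" "y \<in> D" for x y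
    using assms that unfolding linear_subspace_def by auto
  have c: "- x \<in> D" if "x \<in> D" for x using b[OF that, of "-1"] by simp
  show "x \<in> D \<Longrightarrow> x \<in> S" "0 \<in> D" using assms unfolding linear_subspace_def by auto
  show "x \<in> D \<Longrightarrow> y \<in> D \<Longrightarrow> x + y \<in> D" "x \<in> D \<Longrightarrow> sc c x \<in> D" "x \<in> D \<Longrightarrow> - x \<in> D"
    "x \<in> D \<Longrightarrow> y \<in> D \<Longrightarrow> x - y \<in> D" using a b c a[of x "- y"] by auto
qed

lemma linear_subspace_sum:
  "linear_subspace D \<Longrightarrow> (\<And>i. i \<in> I \<Longrightarrow> f i \<in> D) \<Longrightarrow> (\<Sum>i\<in>I. f i) \<in> D"
  by (induction I rule: infinite_finite_induct) (auto simp: linear_subspaceD)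

end

section \<open>Hilbert spaces on carrier sets\<close>

locale hilbert = semi_inner sc S ip
  for sc :: "complex \<Rightarrow> 'v::ab_group_add \<Rightarrow> 'v" and S ip +
  assumes ip_pos: "x \<in> S \<Longrightarrow> x \<noteq> 0 \<Longrightarrow> 0 < Re (ip x x)"
    and complete: "(\<And>n. s n \<in> S) \<Longrightarrow> cauchy s \<Longrightarrow> \<exists>l\<in>S. converges s l"
begin

lemma nrm_eq_0 [simp]: "x \<in> S \<Longrightarrow> nrm x = 0 \<longleftrightarrow> x = 0"
  using ip_pos[of x] by (cases "x = 0") (auto simp: nrm_def)

lemma ip_self_eq_0: "x \<in> S \<Longrightarrow> ip x x = 0 \<longleftrightarrow> x = 0"
  by (auto simp: ip_self)

lemma converges_unique:
  assumes "converges s l" "converges s m" "\<And>n. s n \<in> S" "l \<in> S" "m \<in> S"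
  shows "l = m"
proof -
  have "(\<lambda>n. nrm (0::'v)) \<longlonglongrightarrow> nrm (m - l)"
    using converges_nrm[OF converges_diff[OF assms(2,1)]] assms by auto
  then show ?thesis using assms by (simp add: LIMSEQ_const_iff)
qed

text \<open>Minimise \<open>\<parallel>x\<parallel>\<^sup>2 - 2 Re (f x)\<close> over \<open>D\<close>; the parallelogram law makes minimising sequences Cauchy.\<close>

lemma riesz:
  assumes D: "linear_subspace D" and K: "0 \<le> K"
    and f_add: "\<And>x y. x \<in> D \<Longrightarrow> y \<in> D \<Longrightarrow> f (x + y) = f x + f y"
    and f_sc: "\<And>c x. x \<in> D \<Longrightarrow> f (sc c x) = c * f x"
    and f_bound: "\<And>x. x \<in> D \<Longrightarrow> cmod (f x) \<le> K * nrm x"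
  obtains y s where "y \<in> S" "\<And>x. x \<in> D \<Longrightarrow> f x = ip x y" "nrm y \<le> K"
    "\<And>n. s n \<in> D" "converges s y"
proof -
  note DD = linear_subspaceD[OF D]
  define q where "q x = (nrm x)\<^sup>2 - 2 * Re (f x)" for x
  \<comment> \<open>Completing the square: \<open>q x\<close> is at least
    \<open>(nrm x - K)^2 - K^2\<close>.\<close>
  have q_ge: "- K\<^sup>2 \<le> q x" if "x \<in> D" for x
  proof -
    have "Re (f x) \<le> K * nrm x" using f_bound[OF that] complex_Re_le_cmod[of "f x"] by linarith
    moreover have "0 \<le> (nrm x - K)\<^sup>2" by simp
    ultimately show ?thesis unfolding q_def by (simp add: power2_diff algebra_simps)
  qed
  define I where "I = Inf (q ` D)"
  have bdd: "bdd_below (q ` D)" using q_ge by (auto intro!: bdd_belowI)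
  have I_le: "I \<le> q x" if "x \<in> D" for x
    unfolding I_def using that bdd by (intro cInf_lower) auto
  have "\<exists>x\<in>D. q x < I + 1 / real (Suc n)" for n
  proof -
    have "Inf (q ` D) < I + 1 / real (Suc n)" unfolding I_def by simp
    then show ?thesis using cInf_lessD[of "q ` D"] DD(2) by auto
  qed
  then obtain s where sD: "\<And>n. s n \<in> D" and s_lt: "\<And>n. q (s n) < I + 1 / real (Suc n)"
    by metis
  have sS: "\<And>n. s n \<in> S" using sD DD(1) by blast
  have diff: "(nrm (x - y))\<^sup>2 \<le> 2 * (q x - I) + 2 * (q y - I)" if "x \<in> D" "y \<in> D" for x y
  proof -
    have m: "sc (1/2) (x + y) \<in> D" using that by (simp add: DD)
    have S: "x \<in> S" "y \<in> S" using that DD(1) by auto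
    have fm: "f (sc (1/2) (x + y)) = (f x + f y) / 2"
      using that by (simp add: f_sc f_add DD)
    have "(nrm (sc (1/2) (x + y)))\<^sup>2 = (nrm (x + y))\<^sup>2 / 4"
      using S by (simp add: nrm_sc power_divide)
    moreover have "(nrm (x + y))\<^sup>2 + (nrm (x - y))\<^sup>2 = 2 * (nrm x)\<^sup>2 + 2 * (nrm y)\<^sup>2"
      using S by (simp add: nrm_add_sq nrm_diff_sq)
    ultimately have "(nrm (x - y))\<^sup>2 = 2 * q x + 2 * q y - 4 * q (sc (1/2) (x + y))"
      unfolding q_def fm by (simp add: algebra_simps)
    then show ?thesis using I_le[OF m] by simp
  qed
  have "cauchy s"
    unfolding cauchy_def
  proof (intro allI impI)
    fix e :: real assume e: "0 < e"
    obtain M where M: "1 / real (Suc M) < e\<^sup>2 / 4"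
      using reals_Archimedean[of "e\<^sup>2 / 4"] e by (auto simp: inverse_eq_divide)
    have "nrm (s m - s n) < e" if mn: "m \<ge> M" "n \<ge> M" for m n
    proof -
      have "q (s k) - I < e\<^sup>2 / 4" if "k \<ge> M" for k
      proof -
        have "1 / real (Suc k) \<le> 1 / real (Suc M)" using that by (intro frac_le) auto
        then show ?thesis using s_lt[of k] M by argo
      qed
      from this[OF mn(1)] this[OF mn(2)] have "(nrm (s m - s n))\<^sup>2 < e\<^sup>2"
        using diff[OF sD sD, of m n] by argo
      then show ?thesis using e by (simp add: power2_less_imp_less)
    qed
    then show "\<exists>M. \<forall>m\<ge>M. \<forall>n\<ge>M. nrm (s m - s n) < e" by blast
  qed
  then obtain y where y: "y \<in> S" "converges s y" using complete sS by blast
  \<comment> \<open>The limit \<open>y\<close> need not lie in \<open>D\<close>, so the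
    first-variation inequality is obtained along \<open>s n\<close>, which misses the infimum by
    less than \<open>1 / (n + 1)\<close>.\<close>
  have var: "0 \<le> (nrm h)\<^sup>2 + 2 * Re (ip h y - f h)" if h: "h \<in> D" for h
  proof -
    have hS: "h \<in> S" using h DD(1) by blast
    have "- (1 / real (Suc n)) \<le> (nrm h)\<^sup>2 + 2 * Re (ip h (s n) - f h)" for n
    proof -
      have "q (s n + h) = q (s n) + (nrm h)\<^sup>2 + 2 * Re (ip h (s n) - f h)"
        using sD h hS sS ip_cnj[of h "s n"] by (simp add: q_def nrm_add_sq f_add)
      then show ?thesis using I_le[of "s n + h"] s_lt[of n] DD(3)[OF sD h] by simp
    qed
    moreover have "(\<lambda>n. (nrm h)\<^sup>2 + 2 * Re (ip h (s n) - f h)) \<longlonglongrightarrow> (nrm h)\<^sup>2 + 2 * Re (ip h y - f h)"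
      by (intro tendsto_intros converges_ip_right y sS hS)
    moreover have "(\<lambda>n. - (1 / real (Suc n))) \<longlonglongrightarrow> 0"
      using tendsto_minus[OF LIMSEQ_inverse_real_of_nat] by (simp add: inverse_eq_divide)
    ultimately show ?thesis by (intro LIMSEQ_le) auto
  qed
  have rep: "f d = ip d y" if d: "d \<in> D" for d
  proof (rule ccontr)
    assume "f d \<noteq> ip d y"
    define g where "g = ip d y - f d"
    have dS: "d \<in> S" using d DD(1) by blast
    have g: "cmod g > 0" using \<open>f d \<noteq> ip d y\<close> by (simp add: g_def)
    \<comment> \<open>Since \<open>e * (nrm d)^2 <= 1\<close>, the quadratic term for
      \<open>h\<close> is at most half of the linear one; the added 1 avoids a division by
      0.\<close>
    define e where "e = 1 / ((nrm d)\<^sup>2 + 1)"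
    have pos: "(nrm d)\<^sup>2 + 1 > 0" by (simp add: add_nonneg_pos)
    then have e0: "0 < e" by (simp add: e_def)
    have e1: "e * (nrm d)\<^sup>2 \<le> 1" using pos by (simp add: e_def)
    define h where "h = sc (- of_real e * cnj g) d"
    have hD: "h \<in> D" unfolding h_def using d by (rule DD(4))
    have "ip h y - f h = - of_real e * (cnj g * g)"
      unfolding h_def f_sc[OF d] ip_sc_left[OF dS y(1)] g_def by (simp add: algebra_simps)
    also have "cnj g * g = of_real ((cmod g)\<^sup>2)" by (metis complex_norm_square mult.commute)
    finally have 1: "Re (ip h y - f h) = - e * (cmod g)\<^sup>2" by simp
    have 2: "(nrm h)\<^sup>2 = e\<^sup>2 * (cmod g)\<^sup>2 * (nrm d)\<^sup>2"
      unfolding h_def nrm_sc[OF dS] by (simp add: norm_mult power_mult_distrib)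
    have "0 \<le> e * (cmod g)\<^sup>2 * (e * (nrm d)\<^sup>2 - 2)"
      using var[OF hD] unfolding 1 2 by (simp add: power2_eq_square algebra_simps)
    moreover have "e * (cmod g)\<^sup>2 > 0" using e0 g by simp
    ultimately show False using e1 by (simp add: zero_le_mult_iff)
  qed
  have "nrm y \<le> K"
  proof -
    have "(\<lambda>n. cmod (f (s n))) \<longlonglongrightarrow> cmod (ip y y)"
      using tendsto_norm[OF converges_ip[OF y(2) sS y(1) y(1)]] rep[OF sD] by simp
    moreover have "(\<lambda>n. K * nrm (s n)) \<longlonglongrightarrow> K * nrm y"
      by (intro tendsto_intros converges_nrm y sS)
    ultimately have "cmod (ip y y) \<le> K * nrm y"
      using f_bound[OF sD] by (intro LIMSEQ_le) auto
    then have "nrm y * nrm y \<le> K * nrm y" using y(1) by (simp add: ip_self norm_mult power2_eq_square)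
    then show ?thesis using K y(1) nrm_ge_0[OF y(1)]
      by (metis mult_right_le_imp_le order_le_less)
  qed
  then show ?thesis using that y sD rep by blast
qed

text \<open>Apply \<open>riesz\<close> to the functional of \<open>x\<close> itself: the
  representing vector is a limit of vectors of \<open>D\<close> and differs from \<open>x\<close> by
  a vector orthogonal to \<open>D\<close>.\<close>

lemma dense_sequence:
  assumes D: "linear_subspace D" and dense: "\<And>y. y \<in> S \<Longrightarrow> (\<And>d. d \<in> D \<Longrightarrow> ip d y = 0) \<Longrightarrow> y = 0"
    and x: "x \<in> S"
  obtains s where "\<And>n. s n \<in> D" "converges s x"
proof -
  note DD = linear_subspaceD[OF D]
  obtain y s where y: "y \<in> S" "\<And>d. d \<in> D \<Longrightarrow> ip d x = ip d y" "\<And>n. s n \<in> D" "converges s y"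
  proof (rule riesz[OF D, of "nrm x" "\<lambda>d. ip d x"])
  qed (use x in \<open>auto simp: ip_simps DD mult.commute intro: order_trans[OF cauchy_schwarz]\<close>)
  have "ip d (x - y) = 0" if "d \<in> D" for d using that x y(1,2) by (simp add: ip_simps DD(1))
  then have "x - y = 0" using x y(1) by (intro dense) auto
  then show ?thesis using that y by auto
qed

text \<open>Again \<open>riesz\<close> for the functional of \<open>x\<close>; closedness puts the
  representing vector, a limit of vectors of \<open>W\<close>, into \<open>W\<close>.\<close>

lemma projection:
  assumes W: "closed_subsp W" and x: "x \<in> S"
  obtains y where "y \<in> W" "\<And>d. d \<in> W \<Longrightarrow> ip d (x - y) = 0"
proof -
  have L: "linear_subspace W" using W by (simp add: closed_subsp_def)
  note DD = linear_subspaceD[OF L]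
  obtain y s where y: "y \<in> S" "\<And>d. d \<in> W \<Longrightarrow> ip d x = ip d y" "\<And>n. s n \<in> W" "converges s y"
  proof (rule riesz[OF L, of "nrm x" "\<lambda>d. ip d x"])
  qed (use x in \<open>auto simp: ip_simps DD mult.commute intro: order_trans[OF cauchy_schwarz]\<close>)
  have "y \<in> W" using W y unfolding closed_subsp_def by blast
  moreover have "ip d (x - y) = 0" if "d \<in> W" for d using that x y(1,2) by (simp add: ip_simps DD(1))
  ultimately show ?thesis using that by blast
qed

definition perp :: "'v set \<Rightarrow> 'v set" where
  "perp X = {y\<in>S. \<forall>x\<in>X. ip y x = 0}"

lemma closed_perp:
  assumes "X \<subseteq> S"
  shows "closed_subsp (perp X)"
proof -
  have "l \<in> perp X" if "\<And>n. s n \<in> perp X" "l \<in> S" "converges s l" for s l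
  proof -
    have "ip l x = 0" if x: "x \<in> X" for x
    proof -
      have "(\<lambda>n. ip (s n) x) \<longlonglongrightarrow> ip l x"
        using that \<open>\<And>n. s n \<in> perp X\<close> \<open>l \<in> S\<close> \<open>converges s l\<close> assms
        by (intro converges_ip) (auto simp: perp_def)
      moreover have "ip (s n) x = 0" for n using \<open>\<And>n. s n \<in> perp X\<close> x by (auto simp: perp_def)
      ultimately show ?thesis by (simp add: LIMSEQ_const_iff)
    qed
    then show ?thesis using that by (simp add: perp_def)
  qed
  moreover have "linear_subspace (perp X)"
    using assms unfolding linear_subspace_def perp_def by (auto simp: ip_simps subset_iff)
  ultimately show ?thesis unfolding closed_subsp_def by blast
qed

end

section \<open>Square roots by iteration\<close>

text \<open>The scalar version of the iteration \<open>Y \<leftarrow> (X + Y\<^sup>2) / 2\<close>, whose limit \<open>Y\<close> solves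
  \<open>(1 - Y)\<^sup>2 = 1 - X\<close>; it dominates the increments of the operator iteration.\<close>

fun sqrt_seq :: "nat \<Rightarrow> real" where
  "sqrt_seq 0 = 0"
| "sqrt_seq (Suc n) = (1 + (sqrt_seq n)\<^sup>2) / 2"

lemma sqrt_seq_bounds: "0 \<le> sqrt_seq n \<and> sqrt_seq n \<le> 1"
proof (induction n)
  case (Suc n)
  then have "(sqrt_seq n)\<^sup>2 \<le> 1" by (simp add: power_le_one)
  then show ?case by simp
qed simp

lemma sqrt_seq_mono: "sqrt_seq n \<le> sqrt_seq (Suc n)"
proof -
  have "0 \<le> (1 - sqrt_seq n)\<^sup>2" by simp
  then show ?thesis by (simp add: power2_diff)
qed

lemma incseq_sqrt_seq: "incseq sqrt_seq"
  using sqrt_seq_mono by (rule incseq_SucI)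

lemma Cauchy_sqrt_seq: "Cauchy sqrt_seq"
proof (rule LIMSEQ_imp_Cauchy)
  show "sqrt_seq \<longlonglongrightarrow> lim sqrt_seq"
    using incseq_convergent[OF incseq_sqrt_seq, of 1] sqrt_seq_bounds by (metis limI)
qed

lemma sqrt_seq_cauchy_bound:
  assumes "0 < (e::real)"
  shows "\<exists>M. \<forall>m\<ge>M. \<forall>n\<ge>m. sqrt_seq n - sqrt_seq m < e"
proof -
  obtain M where M: "\<And>m n. m \<ge> M \<Longrightarrow> n \<ge> M \<Longrightarrow> \<bar>sqrt_seq n - sqrt_seq m\<bar> < e"
    using Cauchy_sqrt_seq assms unfolding Cauchy_def dist_real_def by blast
  have "sqrt_seq n - sqrt_seq m < e" if "m \<ge> M" "n \<ge> m" for m n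
    using M[of m n] that by linarith
  then show ?thesis by blast
qed

context hilbert
begin

definition bounded_op :: "('v \<Rightarrow> 'v) \<Rightarrow> real \<Rightarrow> bool" where
  "bounded_op T K \<longleftrightarrow> 0 \<le> K \<and> (\<forall>x\<in>S. T x \<in> S \<and> nrm (T x) \<le> K * nrm x) \<and>
    (\<forall>x\<in>S. \<forall>y\<in>S. T (x + y) = T x + T y) \<and> (\<forall>c. \<forall>x\<in>S. T (sc c x) = sc c (T x))"

definition selfadjoint :: "('v \<Rightarrow> 'v) \<Rightarrow> bool" where
  "selfadjoint T \<longleftrightarrow> (\<forall>x\<in>S. \<forall>y\<in>S. ip (T x) y = ip x (T y))"

definition commutes :: "('v \<Rightarrow> 'v) \<Rightarrow> ('v \<Rightarrow> 'v) \<Rightarrow> bool" where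
  "commutes T U \<longleftrightarrow> (\<forall>x\<in>S. T (U x) = U (T x))"

lemma bounded_opD:
  assumes "bounded_op T K"
  shows "x \<in> S \<Longrightarrow> T x \<in> S" "x \<in> S \<Longrightarrow> nrm (T x) \<le> K * nrm x" "0 \<le> K"
    "x \<in> S \<Longrightarrow> y \<in> S \<Longrightarrow> T (x + y) = T x + T y" "x \<in> S \<Longrightarrow> T (sc c x) = sc c (T x)"
    "x \<in> S \<Longrightarrow> y \<in> S \<Longrightarrow> T (x - y) = T x - T y"
proof -
  show *: "x \<in> S \<Longrightarrow> T x \<in> S" "x \<in> S \<Longrightarrow> nrm (T x) \<le> K * nrm x" "0 \<le> K"
    "x \<in> S \<Longrightarrow> y \<in> S \<Longrightarrow> T (x + y) = T x + T y" "x \<in> S \<Longrightarrow> T (sc c x) = sc c (T x)"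
    using assms by (auto simp: bounded_op_def)
  have "T (x + sc (-1) y) = T x + sc (-1) (T y)" if "x \<in> S" "y \<in> S"
    using assms that unfolding bounded_op_def by (metis S_sc)
  then show "x \<in> S \<Longrightarrow> y \<in> S \<Longrightarrow> T (x - y) = T x - T y" by simp
qed

lemma bounded_op_converges:
  assumes T: "bounded_op T K" and s: "converges s l" "\<And>n. s n \<in> S" "l \<in> S"
  shows "converges (\<lambda>n. T (s n)) (T l)"
  unfolding converges_def
proof (rule null_comparison)
  show "\<forall>\<^sub>F n in sequentially. norm (nrm (T (s n) - T l)) \<le> K * nrm (s n - l)"
    using bounded_opD(2)[OF T, of "s n - l" for n] bounded_opD[OF T] s
    by (auto intro!: always_eventually)
  show "(\<lambda>n. K * nrm (s n - l)) \<longlonglongrightarrow> 0"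
    using tendsto_mult_left[OF s(1)[unfolded converges_def], of K] by simp
qed

text \<open>Supplies the closed subspace to which irreducibility is applied on the way to Schur's
  lemma.\<close>

lemma bounded_op_kernel:
  assumes T: "bounded_op T K"
  shows "closed_subsp {x\<in>S. T x = 0}"
proof -
  have 0: "T 0 = 0" using bounded_opD(5)[OF T S_zero, of 0] by simp
  have "T l = 0" if "\<And>n. s n \<in> {x\<in>S. T x = 0}" "l \<in> S" "converges s l" for s l
    using converges_unique[OF bounded_op_converges[OF T that(3) _ that(2)], of 0] that bounded_opD(1)[OF T]
    by (simp add: converges_const)
  then show ?thesis
    unfolding closed_subsp_def linear_subspace_def using bounded_opD[OF T] 0 by auto
qed

text \<open>If \<open>1 - X\<close> is to be read as \<open>B\<^sup>2\<close>, then \<open>1 - Y\<close> is its positive square root \<open>\<bar>B\<bar>\<close>.\<close>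

lemma operator_sqrt:
  assumes X: "bounded_op X 1" and Xsa: "selfadjoint X"
  obtains Y where "bounded_op Y 1" "selfadjoint Y"
    "\<And>x. x \<in> S \<Longrightarrow> sc 2 (Y x) = X x + Y (Y x)"
    "\<And>U K. bounded_op U K \<Longrightarrow> commutes U X \<Longrightarrow> commutes U Y"
proof -
  define Z where "Z = rec_nat (\<lambda>x. 0) (\<lambda>_ T x. sc (1/2) (X x + T (T x)))"
  have Z0: "Z 0 = (\<lambda>x. 0)" and ZS: "Z (Suc n) = (\<lambda>x. sc (1/2) (X x + Z n (Z n x)))" for n
    by (simp_all add: Z_def)
  \<comment> \<open>The bound obeys the recursion of the operators with \<open>X\<close> replaced by
    its norm bound 1.\<close>
  have Zb: "bounded_op (Z n) (sqrt_seq n)" for n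
  proof (induction n)
    case 0 then show ?case by (simp add: Z0 bounded_op_def)
  next
    case (Suc n)
    note D = bounded_opD[OF Suc] and DX = bounded_opD[OF X]
    have "nrm (sc (1/2) (X x + Z n (Z n x))) \<le> (1 + (sqrt_seq n)\<^sup>2) / 2 * nrm x" if x: "x \<in> S" for x
    proof -
      have "nrm (Z n (Z n x)) \<le> sqrt_seq n * (sqrt_seq n * nrm x)"
        using D(2)[of "Z n x"] D(1)[OF x] mult_left_mono[OF D(2)[OF x] D(3)] by linarith
      then have "nrm (X x + Z n (Z n x)) \<le> nrm x + (sqrt_seq n)\<^sup>2 * nrm x"
        using nrm_triangle[of "X x" "Z n (Z n x)"] x D DX(1,2)[OF x] by (simp add: power2_eq_square)
      moreover have "X x + Z n (Z n x) \<in> S" using x D DX by simp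
      ultimately show ?thesis by (simp only: nrm_sc) (simp add: field_simps)
    qed
    then show ?case
      unfolding bounded_op_def ZS
      using D DX by (simp add: scale_right_distrib scale_scale mult.commute add_nonneg_nonneg)
  qed
  note DZ = bounded_opD[OF Zb]
  have Zsa: "selfadjoint (Z n)" for n
  proof (induction n)
    case 0 then show ?case by (simp add: Z0 selfadjoint_def)
  next
    case (Suc n)
    then show ?case using DZ bounded_opD[OF X] Xsa
      by (simp add: ZS selfadjoint_def ip_simps)
  qed
  \<comment> \<open>Each \<open>Z n\<close> is a polynomial in \<open>X\<close>, so it commutes with
    every bounded operator that commutes with \<open>X\<close>; in particular the iterates commute
    with each other.\<close>
  have Zcom: "commutes U (Z n)" if U: "bounded_op U K" and "commutes U X" for U K n
  proof (induction n)
    case 0 then show ?case using bounded_opD(5)[OF U S_zero, of 0] by (simp add: Z0 commutes_def)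
  next
    case (Suc n)
    then show ?case using DZ bounded_opD[OF X] that bounded_opD[OF U]
      by (simp add: ZS commutes_def)
  qed
  have XX: "commutes (Z n) X" for n
    using Zcom[OF X, of n] by (simp add: commutes_def)
  have ZZ: "commutes (Z m) (Z n)" for m n
    using Zcom[OF Zb XX] .
  have inc: "nrm (Z (Suc n) x - Z n x) \<le> (sqrt_seq (Suc n) - sqrt_seq n) * nrm x" if "x \<in> S" for n x
    using that
  proof (induction n arbitrary: x)
    case 0
    then show ?case using bounded_opD[OF X] by (simp add: Z0 ZS nrm_sc)
  next
    case (Suc n)
    let ?w = "Z (Suc n) x - Z n x"
    have w: "?w \<in> S" using Suc.prems DZ by simp
    \<comment> \<open>A difference of two squares, which factors because the iterates commute. The
      scalar sequence satisfies the same identity, so the estimates match term by term.\<close>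
    have "Z (Suc n) ?w + Z n ?w = Z (Suc n) (Z (Suc n) x) - Z n (Z n x)"
      using ZZ[of "Suc n" n] Suc.prems DZ by (simp add: commutes_def)
    then have "Z (Suc (Suc n)) x - Z (Suc n) x = sc (1/2) (Z (Suc n) ?w + Z n ?w)"
      unfolding ZS[of "Suc n"] ZS[of n, THEN fun_cong] by (simp flip: scale_right_diff_distrib)
    then have "nrm (Z (Suc (Suc n)) x - Z (Suc n) x) = nrm (Z (Suc n) ?w + Z n ?w) / 2"
      using w DZ by (simp add: nrm_sc)
    also have "\<dots> \<le> (sqrt_seq (Suc n) + sqrt_seq n) * nrm ?w / 2"
      using nrm_triangle[of "Z (Suc n) ?w" "Z n ?w"] w DZ(1,2)[OF w] add_mono[OF DZ(2)[OF w] DZ(2)[OF w]]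
      by (smt (verit) distrib_right divide_right_mono)
    also have "\<dots> \<le> (sqrt_seq (Suc n) + sqrt_seq n) * ((sqrt_seq (Suc n) - sqrt_seq n) * nrm x) / 2"
      using Suc.IH[OF Suc.prems] sqrt_seq_bounds by (intro divide_right_mono mult_left_mono) (auto simp del: sqrt_seq.simps)
    also have "\<dots> = ((sqrt_seq (Suc n))\<^sup>2 - (sqrt_seq n)\<^sup>2) / 2 * nrm x"
      by (simp add: power2_eq_square algebra_simps del: sqrt_seq.simps)
    also have "\<dots> = (sqrt_seq (Suc (Suc n)) - sqrt_seq (Suc n)) * nrm x"
      unfolding sqrt_seq.simps(2)[of "Suc n"] sqrt_seq.simps(2)[of n, symmetric] by (simp add: field_simps)
    finally show ?case .
  qed
  have diff: "nrm (Z (m + k) x - Z m x) \<le> (sqrt_seq (m + k) - sqrt_seq m) * nrm x" if x: "x \<in> S" for m k x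
  proof (induction k)
    case (Suc k)
    have "nrm (Z (m + Suc k) x - Z m x) \<le> nrm (Z (Suc (m + k)) x - Z (m + k) x) + nrm (Z (m + k) x - Z m x)"
      using nrm_triangle3[OF DZ(1)[OF x] DZ(1)[OF x] DZ(1)[OF x]] by simp
    also have "\<dots> \<le> (sqrt_seq (Suc (m + k)) - sqrt_seq (m + k)) * nrm x + (sqrt_seq (m + k) - sqrt_seq m) * nrm x"
      using inc[OF x, of "m + k"] Suc by (intro add_mono)
    also have "\<dots> = (sqrt_seq (m + Suc k) - sqrt_seq m) * nrm x" by (simp add: algebra_simps del: sqrt_seq.simps)
    finally show ?case .
  qed simp
  have "cauchy (\<lambda>n. Z n x)" if x: "x \<in> S" for x
    unfolding cauchy_def
  proof (intro allI impI)
    fix e :: real assume e: "e > 0"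
    then have e': "e / (nrm x + 1) > 0" using x by (simp add: add_nonneg_pos)
    obtain M where M: "\<And>m n. m \<ge> M \<Longrightarrow> n \<ge> m \<Longrightarrow> sqrt_seq n - sqrt_seq m < e / (nrm x + 1)"
      using sqrt_seq_cauchy_bound[OF e'] by blast
    have le: "nrm (Z n x - Z m x) < e" if "m \<ge> M" "n \<ge> m" for m n
    proof -
      have "nrm (Z n x - Z m x) \<le> (sqrt_seq n - sqrt_seq m) * nrm x"
        using diff[OF x, of m "n - m"] that by simp
      also have "\<dots> \<le> e / (nrm x + 1) * nrm x"
        using M[OF that] x by (intro mult_right_mono) auto
      also have "\<dots> < e"
      proof -
        have "0 < nrm x + 1" using x by (simp add: add_nonneg_pos)
        then have "e / (nrm x + 1) * (nrm x + 1) = e" by simp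
        then show ?thesis using e' by (simp add: distrib_left)
      qed
      finally show ?thesis .
    qed
    have "nrm (Z m x - Z n x) < e" if "m \<ge> M" "n \<ge> M" for m n
      using le[of m n] le[of n m] nrm_minus_commute[of "Z m x" "Z n x"] DZ(1)[OF x] that
      by (cases "m \<le> n") auto
    then show "\<exists>M. \<forall>m\<ge>M. \<forall>n\<ge>M. nrm (Z m x - Z n x) < e" by blast
  qed
  then have "\<exists>y. x \<in> S \<longrightarrow> y \<in> S \<and> converges (\<lambda>n. Z n x) y" for x
    using complete[of "\<lambda>n. Z n x"] DZ(1) by blast
  then obtain Y where Y: "\<And>x. x \<in> S \<Longrightarrow> Y x \<in> S" "\<And>x. x \<in> S \<Longrightarrow> converges (\<lambda>n. Z n x) (Y x)"
    by metis
  have Yn: "nrm (Y x) \<le> nrm x" if x: "x \<in> S" for x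
  proof (rule LIMSEQ_le_const2[OF converges_nrm[OF Y(2)[OF x]]])
    have "nrm (Z n x) \<le> nrm x" for n
      using DZ(2)[OF x, of n] mult_right_mono[of "sqrt_seq n" 1 "nrm x"] sqrt_seq_bounds[of n] x by simp
    then show "\<exists>N. \<forall>n\<ge>N. nrm (Z n x) \<le> nrm x" by blast
  qed (use x Y DZ in auto)
  have Yadd: "Y (x + y) = Y x + Y y" if "x \<in> S" "y \<in> S" for x y
    using converges_add[OF Y(2) Y(2), of x y] that DZ Y
    by (intro converges_unique[OF Y(2)]) simp_all
  have Ysc: "Y (sc c x) = sc c (Y x)" if "x \<in> S" for x c
    using converges_sc[OF Y(2), of x c] that DZ Y
    by (intro converges_unique[OF Y(2)]) simp_all
  have Yb: "bounded_op Y 1" using Yn Yadd Ysc Y by (simp add: bounded_op_def)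
  moreover have "selfadjoint Y"
    unfolding selfadjoint_def
  proof (intro ballI)
    fix x y assume xy: "x \<in> S" "y \<in> S"
    show "ip (Y x) y = ip x (Y y)"
    proof (rule LIMSEQ_unique)
      show "(\<lambda>n. ip (Z n x) y) \<longlonglongrightarrow> ip (Y x) y"
        using xy DZ Y by (intro converges_ip) auto
      have "(\<lambda>n. ip x (Z n y)) \<longlonglongrightarrow> ip x (Y y)"
        using xy DZ Y by (intro converges_ip_right) auto
      then show "(\<lambda>n. ip (Z n x) y) \<longlonglongrightarrow> ip x (Y y)"
        using Zsa xy by (simp add: selfadjoint_def)
    qed
  qed
  moreover have "commutes U Y" if U: "bounded_op U K" "commutes U X" for U K
    unfolding commutes_def
  proof
    fix x assume x: "x \<in> S"
    have "converges (\<lambda>n. Z n (U x)) (U (Y x))"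
      using bounded_op_converges[OF U(1) Y(2)[OF x]] x Y DZ Zcom[OF U] by (simp add: commutes_def)
    then show "U (Y x) = Y (U x)"
      using x bounded_opD(1)[OF U(1)] Y DZ
      by (intro converges_unique[where s = "\<lambda>n. Z n (U x)"]) auto
  qed
  moreover have "sc 2 (Y x) = X x + Y (Y x)" if x: "x \<in> S" for x
  proof (rule converges_unique)
    have a: "converges (\<lambda>n. Z (Suc n) x) (Y x)"
      using LIMSEQ_Suc[OF Y(2)[OF x, unfolded converges_def]] by (simp add: converges_def)
    show "converges (\<lambda>n. sc 2 (Z (Suc n) x)) (sc 2 (Y x))"
      using x Y DZ by (intro converges_sc a) auto
    \<comment> \<open>The iterates are only known to converge pointwise, so the composite is
      compared through \<open>Z n (Y x)\<close>, using that every \<open>Z n\<close> is a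
      contraction.\<close>
    have b: "converges (\<lambda>n. Z n (Z n x)) (Y (Y x))"
      unfolding converges_def
    proof (rule null_comparison)
      show "\<forall>\<^sub>F n in sequentially. norm (nrm (Z n (Z n x) - Y (Y x))) \<le>
        nrm (Z n x - Y x) + nrm (Z n (Y x) - Y (Y x))"
      proof (intro always_eventually allI)
        fix n
        have S: "Z n x \<in> S" "Y x \<in> S" "Z n (Z n x) \<in> S" "Z n (Y x) \<in> S" "Y (Y x) \<in> S"
          using x DZ Y by auto
        have "nrm (Z n (Z n x) - Z n (Y x)) \<le> sqrt_seq n * nrm (Z n x - Y x)"
          using DZ(2)[of "Z n x - Y x" n] DZ(6)[of "Z n x" "Y x" n] S by simp
        also have "\<dots> \<le> 1 * nrm (Z n x - Y x)"
          using sqrt_seq_bounds[of n] S by (intro mult_right_mono) auto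
        finally show "norm (nrm (Z n (Z n x) - Y (Y x))) \<le> nrm (Z n x - Y x) + nrm (Z n (Y x) - Y (Y x))"
          using nrm_triangle3[OF S(3,4,5)] S by simp
      qed
      show "(\<lambda>n. nrm (Z n x - Y x) + nrm (Z n (Y x) - Y (Y x))) \<longlonglongrightarrow> 0"
        using tendsto_add[OF Y(2)[OF x, unfolded converges_def] Y(2)[OF Y(1)[OF x], unfolded converges_def]]
        by simp
    qed
    have "converges (\<lambda>n. X x + Z n (Z n x)) (X x + Y (Y x))"
      using x Y DZ bounded_opD(1)[OF X] by (intro converges_add converges_const b) auto
    then show "converges (\<lambda>n. sc 2 (Z (Suc n) x)) (X x + Y (Y x))"
      by (simp add: ZS)
  qed (use x Y DZ bounded_opD(1)[OF X] in auto)
  ultimately show ?thesis using that by blast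
qed

end

section \<open>Representations and Schur's lemma\<close>

locale star_rep = hilbert sc S ip
  for sc :: "complex \<Rightarrow> 'v::ab_group_add \<Rightarrow> 'v" and S ip +
  fixes \<pi> :: "'a::unital_cstar_algebra \<Rightarrow> 'v \<Rightarrow> 'v"
  assumes rep_bounded: "\<exists>K. bounded_op (\<pi> a) K"
    and rep_add: "x \<in> S \<Longrightarrow> \<pi> (a + b) x = \<pi> a x + \<pi> b x"
    and rep_scaleC: "x \<in> S \<Longrightarrow> \<pi> (scaleC c a) x = sc c (\<pi> a x)"
    and rep_mult: "x \<in> S \<Longrightarrow> \<pi> (a * b) x = \<pi> a (\<pi> b x)"
    and rep_one: "x \<in> S \<Longrightarrow> \<pi> 1 x = x"
    and rep_star: "x \<in> S \<Longrightarrow> y \<in> S \<Longrightarrow> ip (\<pi> (star a) x) y = ip x (\<pi> a y)"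
begin

definition irreducible :: bool where
  "irreducible \<longleftrightarrow> S \<noteq> {0} \<and>
    (\<forall>W. closed_subsp W \<and> (\<forall>a. \<pi> a ` W \<subseteq> W) \<longrightarrow> W = {0} \<or> W = S)"

lemma rep_S [simp]: "x \<in> S \<Longrightarrow> \<pi> a x \<in> S"
  using rep_bounded[of a] bounded_opD(1) by blast

lemma rep_lin:
  "x \<in> S \<Longrightarrow> y \<in> S \<Longrightarrow> \<pi> a (x + y) = \<pi> a x + \<pi> a y"
  "x \<in> S \<Longrightarrow> \<pi> a (sc c x) = sc c (\<pi> a x)"
  "x \<in> S \<Longrightarrow> y \<in> S \<Longrightarrow> \<pi> a (x - y) = \<pi> a x - \<pi> a y"
  using rep_bounded[of a] bounded_opD by blast+

lemma rep_zero: "\<pi> a 0 = 0"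
  using rep_lin(2)[of 0 a 0] by simp

lemma rep_sum: "(\<And>i. i \<in> I \<Longrightarrow> f i \<in> S) \<Longrightarrow> \<pi> a (\<Sum>i\<in>I. f i) = (\<Sum>i\<in>I. \<pi> a (f i))"
  by (induction I rule: infinite_finite_induct) (auto simp: rep_zero rep_lin S_sum)

lemma rep_star': "x \<in> S \<Longrightarrow> y \<in> S \<Longrightarrow> ip x (\<pi> (star a) y) = ip (\<pi> a x) y"
  using rep_star[of x y "star a"] by (simp add: star_star)

text \<open>Holds because \<open>\<pi> (star a)\<close> is the adjoint of \<open>\<pi> a\<close> and
  preserves \<open>X\<close> as well.\<close>

lemma invariant_perp:
  assumes "X \<subseteq> S" "\<And>a. \<pi> a ` X \<subseteq> X"
  shows "\<pi> a ` perp X \<subseteq> perp X"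
proof safe
  fix y assume y: "y \<in> perp X"
  have "ip (\<pi> a y) x = 0" if "x \<in> X" for x
  proof -
    have "\<pi> (star a) x \<in> X" using assms(2) that by blast
    then show ?thesis using y that assms(1) rep_star'[of y x a] by (auto simp: perp_def)
  qed
  then show "\<pi> a y \<in> perp X" using y by (simp add: perp_def)
qed

text \<open>The closure of the orbit of \<open>x\<close>, encoded as a double orthogonal complement
  so that closedness and invariance follow from the two lemmas on \<open>perp\<close>.\<close>

definition cyclic_space :: "'v \<Rightarrow> 'v set" where
  "cyclic_space x = perp (perp (range (\<lambda>a. \<pi> a x)))"

lemma cyclic_space:
  assumes x: "x \<in> S"
  shows "closed_subsp (cyclic_space x)" "\<pi> a ` cyclic_space x \<subseteq> cyclic_space x" "x \<in> cyclic_space x"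
proof -
  let ?R = "range (\<lambda>a. \<pi> a x)"
  have R: "?R \<subseteq> S" using x by auto
  have P: "perp ?R \<subseteq> S" by (auto simp: perp_def)
  show "closed_subsp (cyclic_space x)" unfolding cyclic_space_def by (rule closed_perp[OF P])
  have "\<pi> b ` ?R \<subseteq> ?R" for b using x by (auto simp flip: rep_mult)
  then have "\<pi> b ` perp ?R \<subseteq> perp ?R" for b by (rule invariant_perp[OF R])
  then show "\<pi> a ` cyclic_space x \<subseteq> cyclic_space x" unfolding cyclic_space_def by (rule invariant_perp[OF P])
  have "ip x y = 0" if y: "y \<in> perp ?R" for y
  proof -
    have "ip y (\<pi> 1 x) = 0" using y by (auto simp: perp_def)
    then show ?thesis using x y ip_cnj[of y x] by (auto simp: perp_def rep_one)
  qed
  then show "x \<in> cyclic_space x" using x unfolding cyclic_space_def perp_def by blast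
qed

text \<open>\<open>D\<close> need not be closed, so irreducibility is applied to
  \<open>perp D\<close>, which is closed and invariant; it cannot be all of \<open>S\<close>,
  because \<open>d\<close> would be orthogonal to itself.\<close>

lemma irreducible_dense:
  assumes irr: irreducible and D: "linear_subspace D" "\<And>a. \<pi> a ` D \<subseteq> D" "d \<in> D" "d \<noteq> 0"
    and y: "y \<in> S" "\<And>d. d \<in> D \<Longrightarrow> ip d y = 0"
  shows "y = 0"
proof -
  have DS: "D \<subseteq> S" using D(1) by (simp add: linear_subspace_def)
  have "closed_subsp (perp D)" "\<And>a. \<pi> a ` perp D \<subseteq> perp D"
    using closed_perp[OF DS] invariant_perp[OF DS D(2)] by auto
  then consider "perp D = {0}" | "perp D = S" using irr unfolding irreducible_def by blast
  then show ?thesis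
  proof cases
    case 1
    have "y \<in> perp D" using y DS ip_cnj[of _ y] by (auto simp: perp_def subset_iff)
    then show ?thesis using 1 by simp
  next
    case 2
    then have "ip d d = 0" using D(3) DS by (auto simp: perp_def)
    then show ?thesis using D(3,4) DS ip_self_eq_0[of d] by blast
  qed
qed

text \<open>\<open>cyclic_space x\<close> contains the nonzero vector \<open>x\<close>, so it is all
  of \<open>S\<close>; then \<open>y\<close> lies both in the complement of the orbit and in the
  complement of that complement.\<close>

lemma cyclic_dense:
  assumes irreducible "x \<in> S" "x \<noteq> 0" "y \<in> S" "\<And>a. ip y (\<pi> a x) = 0"
  shows "y = 0"
proof -
  have "cyclic_space x = {0} \<or> cyclic_space x = S"
    using assms(1) cyclic_space[OF assms(2)] unfolding irreducible_def by blast
  then have "y \<in> cyclic_space x" using cyclic_space(3)[OF assms(2)] assms(3,4) by auto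
  moreover have "y \<in> perp (range (\<lambda>a. \<pi> a x))" using assms(4,5) by (auto simp: perp_def)
  ultimately have "ip y y = 0" by (auto simp: cyclic_space_def perp_def)
  then show ?thesis using assms(4) ip_self_eq_0 by simp
qed

text \<open>With \<open>B = (T - c) / 2\<close> and \<open>P = \<bar>B\<bar>\<close>, one has \<open>(P - B) (P + B) = 0\<close>, and \<open>ker (P - B)\<close> is
  invariant.  Either it is everything and \<open>B = P \<ge> 0\<close>, or it is trivial and \<open>B = - P \<le> 0\<close>.\<close>

lemma schur_dichotomy:
  assumes irr: irreducible and T: "bounded_op T 1" and Tsa: "selfadjoint T"
    and com: "\<And>a. commutes (\<pi> a) T" and c: "\<bar>c\<bar> \<le> (1::real)"
  shows "(\<forall>x\<in>S. c * (nrm x)\<^sup>2 \<le> Re (ip (T x) x)) \<or> (\<forall>x\<in>S. Re (ip (T x) x) \<le> c * (nrm x)\<^sup>2)"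
proof -
  note DT = bounded_opD[OF T]
  \<comment> \<open>The factor 1/2 makes \<open>B\<close> a contraction, since \<open>T\<close> and
    \<open>c\<close> are both bounded by 1.\<close>
  define B where "B x = sc (1/2) (T x - sc (of_real c) x)" for x
  have B: "bounded_op B 1"
  proof -
    have "nrm (sc (1/2) (T x - sc (of_real c) x)) \<le> nrm x" if x: "x \<in> S" for x
    proof -
      have "nrm (T x - sc (of_real c) x) \<le> nrm x + \<bar>c\<bar> * nrm x"
        using nrm_triangle_diff[of "T x" "sc (of_real c) x"] x DT(1,2)[OF x] by (simp add: nrm_sc)
      also have "\<dots> \<le> 2 * nrm x" using c x mult_right_mono[of "\<bar>c\<bar>" 1 "nrm x"] by simp
      finally show ?thesis using x DT(1)[OF x] by (simp only: nrm_sc S_diff S_sc) simp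
    qed
    then show ?thesis
      unfolding bounded_op_def B_def using DT
      by (simp add: scale_right_distrib scale_right_diff_distrib scale_scale mult.commute)
  qed
  note DB = bounded_opD[OF B]
  have Bsa: "selfadjoint B"
    using Tsa DT unfolding selfadjoint_def B_def by (simp add: ip_simps)
  have Bcom: "commutes (\<pi> a) B" for a
    using com DT unfolding commutes_def B_def by (simp add: rep_lin)
  \<comment> \<open>Chosen so that the square root \<open>1 - Y\<close> of \<open>1 - X\<close>
    squares to \<open>B^2\<close>. It is a contraction because the cross term
    \<open>-2 (nrm (B x))^2\<close> outweighs \<open>(nrm (B (B x)))^2\<close>.\<close>
  define X where "X x = x - B (B x)" for x
  have X: "bounded_op X 1"
  proof -
    have "nrm (x - B (B x)) \<le> nrm x" if x: "x \<in> S" for x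
    proof -
      have "ip x (B (B x)) = ip (B x) (B x)" using Bsa x DB by (simp add: selfadjoint_def)
      then have "(nrm (x - B (B x)))\<^sup>2 = (nrm x)\<^sup>2 - 2 * (nrm (B x))\<^sup>2 + (nrm (B (B x)))\<^sup>2"
        using nrm_diff_sq[of x "B (B x)"] x DB by (simp add: nrm_sq)
      also have "\<dots> \<le> (nrm x)\<^sup>2"
      proof -
        have "(nrm (B (B x)))\<^sup>2 \<le> (nrm (B x))\<^sup>2"
          using DB(2)[of "B x"] DB(1) x by (simp add: power_mono)
        then show ?thesis using zero_le_power2[of "nrm (B x)"] by linarith
      qed
      finally show ?thesis using x DB by (simp add: power2_le_iff_abs_le)
    qed
    then show ?thesis unfolding bounded_op_def X_def using DB by (simp add: scale_right_diff_distrib)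
  qed
  have Xsa: "selfadjoint X"
    using Bsa DB unfolding selfadjoint_def X_def by (simp add: ip_simps)
  obtain Y where Y: "bounded_op Y 1" "selfadjoint Y"
    "\<And>x. x \<in> S \<Longrightarrow> sc 2 (Y x) = X x + Y (Y x)"
    "\<And>U K. bounded_op U K \<Longrightarrow> commutes U X \<Longrightarrow> commutes U Y"
    using operator_sqrt[OF X Xsa] by blast
  note DY = bounded_opD[OF Y(1)]
  have BY: "commutes B Y"
    by (rule Y(4)[OF B]) (use DB in \<open>simp add: commutes_def X_def\<close>)
  have piY: "commutes (\<pi> a) Y" for a
  proof -
    obtain K where K: "bounded_op (\<pi> a) K" using rep_bounded by blast
    show ?thesis
      by (rule Y(4)[OF K]) (use Bcom[of a] DB in \<open>simp add: commutes_def X_def rep_lin\<close>)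
  qed
  define P where "P x = x - Y x" for x
  have P_S: "P x \<in> S" if "x \<in> S" for x using that DY by (simp add: P_def)
  have P_lin: "P (x + y) = P x + P y" "P (x - y) = P x - P y" if "x \<in> S" "y \<in> S" for x y
    using that DY by (simp_all add: P_def)
  have PP: "P (P x) = B (B x)" if x: "x \<in> S" for x
  proof -
    have "P (P x) = x - (Y x + Y x) + Y (Y x)" using x DY by (simp add: P_def algebra_simps)
    also have "Y x + Y x = sc 2 (Y x)" using scale_left_distrib[of 1 1 "Y x"] by simp
    finally show ?thesis using Y(3)[OF x] by (simp add: X_def)
  qed
  \<comment> \<open>As \<open>Y\<close> is a contraction, \<open>1 - Y\<close> is
    nonnegative.\<close>
  have P_ge: "0 \<le> Re (ip (P x) x)" if x: "x \<in> S" for x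
  proof -
    have "Re (ip (Y x) x) \<le> nrm (Y x) * nrm x"
      using cauchy_schwarz[of "Y x" x] complex_Re_le_cmod[of "ip (Y x) x"] x DY by simp
    also have "\<dots> \<le> nrm x * nrm x" using DY(2)[OF x] x by (intro mult_right_mono) auto
    finally show ?thesis using x DY by (simp add: P_def ip_simps flip: nrm_sq power2_eq_square)
  qed
  have TB: "Re (ip (T x) x) = c * (nrm x)\<^sup>2 + 2 * Re (ip (B x) x)" if "x \<in> S" for x
    using that DT by (simp add: B_def ip_simps nrm_sq field_simps)
  let ?Q = "\<lambda>x. P x - B x"
  have Q: "bounded_op ?Q 3"
  proof -
    have "nrm (?Q x) \<le> 3 * nrm x" if x: "x \<in> S" for x
      using nrm_triangle_diff[of "P x" "B x"] nrm_triangle_diff[of x "Y x"] DY(1,2)[OF x] DB(1,2)[OF x] x P_S[OF x]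
      unfolding P_def by simp
    then show ?thesis
      using DY DB P_S unfolding bounded_op_def by (simp add: P_def scale_right_diff_distrib)
  qed
  have com': "P (B x) = B (P x)" if "x \<in> S" for x
    using BY that DB DY unfolding commutes_def by (simp add: P_def)
  define W where "W = {x\<in>S. ?Q x = 0}"
  have "closed_subsp W" unfolding W_def by (rule bounded_op_kernel[OF Q])
  moreover have "\<pi> a ` W \<subseteq> W" for a
  proof safe
    fix x assume "x \<in> W"
    then have x: "x \<in> S" "P x = B x" by (auto simp: W_def)
    have "P (\<pi> a x) = \<pi> a (P x)" using piY[of a] x(1) DY by (simp add: commutes_def P_def rep_lin)
    moreover have "B (\<pi> a x) = \<pi> a (B x)" using Bcom[of a] x(1) by (simp add: commutes_def)
    ultimately show "\<pi> a x \<in> W" using x by (simp add: W_def)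
  qed
  ultimately consider "W = S" | "W = {0}" using irr unfolding irreducible_def by blast
  then show ?thesis
  proof cases
    case 1
    have "B x = P x" if "x \<in> S" for x
    proof -
      have "x \<in> W" using 1 that by simp
      then show ?thesis by (simp add: W_def)
    qed
    then have "c * (nrm x)\<^sup>2 \<le> Re (ip (T x) x)" if "x \<in> S" for x
      using P_ge[OF that] TB[OF that] that by simp
    then show ?thesis by blast
  next
    case 2
    have "B x = - P x" if x: "x \<in> S" for x
    proof -
      have "P (P x + B x) - B (P x + B x) = 0"
        using x P_S DB PP com' by (simp add: P_lin)
      then have "P x + B x \<in> W" using x P_S DB by (simp add: W_def)
      then have "P x + B x = 0" using 2 by blast
      then show ?thesis by (metis add.commute eq_neg_iff_add_eq_0)
    qed
    then have "Re (ip (T x) x) \<le> c * (nrm x)\<^sup>2" if "x \<in> S" for x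
      using P_ge[OF that] TB[OF that] that P_S[OF that] by (simp add: ip_minus_left)
    then show ?thesis by blast
  qed
qed

text \<open>By the dichotomy no real number lies strictly between two values of the Rayleigh
  quotient \<open>r\<close>, so \<open>r\<close> is constant, and a self-adjoint operator is
  determined by its quadratic form.\<close>

lemma schur:
  assumes irr: irreducible and T: "bounded_op T 1" and Tsa: "selfadjoint T"
    and com: "\<And>a. commutes (\<pi> a) T"
  obtains t :: real where "\<And>x. x \<in> S \<Longrightarrow> T x = sc (of_real t) x"
proof -
  note DT = bounded_opD[OF T]
  obtain z where z: "z \<in> S" "z \<noteq> 0" using irr S_zero unfolding irreducible_def by blast
  define r where "r x = Re (ip (T x) x) / (nrm x)\<^sup>2" for x
  have sq: "(nrm x)\<^sup>2 > 0" if "x \<in> S" "x \<noteq> 0" for x using that by simp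
  have r1: "\<bar>r x\<bar> \<le> 1" if x: "x \<in> S" "x \<noteq> 0" for x
  proof -
    have "\<bar>Re (ip (T x) x)\<bar> \<le> nrm (T x) * nrm x"
      using cauchy_schwarz[of "T x" x] abs_Re_le_cmod[of "ip (T x) x"] x DT by simp
    also have "\<dots> \<le> nrm x * nrm x" using DT(2)[OF x(1)] x by (intro mult_right_mono) auto
    finally show ?thesis using sq[OF x] by (simp add: r_def power2_eq_square)
  qed
  have le: "r x \<le> r y" if x: "x \<in> S" "x \<noteq> 0" and y: "y \<in> S" "y \<noteq> 0" for x y
  proof (rule ccontr)
    assume "\<not> r x \<le> r y"
    define c where "c = (r x + r y) / 2"
    have c: "r y < c" "c < r x" using \<open>\<not> r x \<le> r y\<close> by (auto simp: c_def)
    have "\<bar>c\<bar> \<le> 1" using r1[OF x] r1[OF y] by (simp add: c_def)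
    from schur_dichotomy[OF irr T Tsa com this] show False
    proof
      assume "\<forall>x\<in>S. c * (nrm x)\<^sup>2 \<le> Re (ip (T x) x)"
      then have "c \<le> r y" using y sq[OF y] by (simp add: r_def pos_le_divide_eq)
      then show False using c by simp
    next
      assume "\<forall>x\<in>S. Re (ip (T x) x) \<le> c * (nrm x)\<^sup>2"
      then have "r x \<le> c" using x sq[OF x] by (simp add: r_def pos_divide_le_eq)
      then show False using c by simp
    qed
  qed
  define t where "t = r z"
  have form: "Re (ip (T x) x) = t * (nrm x)\<^sup>2" if x: "x \<in> S" for x
  proof (cases "x = 0")
    case False
    have "r x = t" unfolding t_def using le[OF x False z] le[OF z x False] by simp
    then show ?thesis using sq[OF x False] by (auto simp: r_def)
  qed (use DT(1)[of 0] in simp)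
  define R where "R x = T x - sc (of_real t) x" for x
  have RS: "R x \<in> S" if "x \<in> S" for x using that DT by (simp add: R_def)
  have R0: "Re (ip (R x) x) = 0" if "x \<in> S" for x
    using form[OF that] that DT by (simp add: R_def ip_simps nrm_sq)
  have Rsa: "ip (R x) y = ip x (R y)" if "x \<in> S" "y \<in> S" for x y
    using Tsa that DT by (simp add: R_def selfadjoint_def ip_simps)
  have "R x = 0" if x: "x \<in> S" for x
  proof -
    have y: "R x \<in> S" by (rule RS[OF x])
    \<comment> \<open>Polarisation at \<open>x + R x\<close>: both cross terms have real part
      \<open>(nrm (R x))^2\<close> and their sum is 0.\<close>
    have "R (x + R x) = R x + R (R x)" using x y DT by (simp add: R_def scale_right_distrib)
    then have "Re (ip (R x + R (R x)) (x + R x)) = 0" using R0[of "x + R x"] x y by simp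
    then have "Re (ip (R x) (R x)) + Re (ip (R (R x)) x) = 0"
      using x y RS R0[OF x] R0[OF y] by (simp add: ip_simps)
    then have "Re (ip (R x) (R x)) = 0" using Rsa[OF y x] by simp
    then show ?thesis using y nrm_sq[OF y] nrm_eq_0[OF y] by simp
  qed
  then show ?thesis using that[of t] by (simp add: R_def)
qed

text \<open>A Radon-Nikodym argument: a form dominated by that of \<open>\<pi>\<close> and
  compatible with the action is \<open>ip (\<iota> e) (T (\<iota> f))\<close> for a self-adjoint
  contraction \<open>T\<close> in the commutant, and Schur's lemma makes \<open>T\<close> a scalar.
  The domain of \<open>\<iota>\<close> is kept abstract; the application takes tuples over the
  algebra.\<close>

lemma bounded_form_is_scalar:
  fixes sE :: "complex \<Rightarrow> 'e::ab_group_add \<Rightarrow> 'e"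
  assumes irr: irreducible and B: "semi_inner sE UNIV B"
    and i_S: "\<And>e. \<iota> e \<in> S" and i_add: "\<And>e f. \<iota> (e + f) = \<iota> e + \<iota> f" and i_sc: "\<And>c e. \<iota> (sE c e) = sc c (\<iota> e)"
    and i_act: "\<And>a e. \<iota> (\<alpha> a e) = \<pi> a (\<iota> e)" and B_act: "\<And>a e f. B (\<alpha> (star a) e) f = B e (\<alpha> a f)"
    and B_le: "\<And>e. Re (B e e) \<le> (nrm (\<iota> e))\<^sup>2" and nonzero: "\<exists>e. \<iota> e \<noteq> 0"
  obtains t :: real where "\<And>e f. B e f = of_real t * ip (\<iota> e) (\<iota> f)"
proof -
  interpret E: semi_inner sE UNIV B by (rule B)
  define D where "D = range \<iota>"
  have i_zero: "\<iota> 0 = 0" using i_sc[of 0 0] by simp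
  have D: "linear_subspace D"
    unfolding linear_subspace_def D_def
  proof (intro conjI ballI allI)
    show "range \<iota> \<subseteq> S" using i_S by blast
    show "0 \<in> range \<iota>" using i_zero by (metis rangeI)
    show "x + y \<in> range \<iota>" if "x \<in> range \<iota>" "y \<in> range \<iota>" for x y
      using that by (auto simp flip: i_add)
    show "sc c x \<in> range \<iota>" if "x \<in> range \<iota>" for c x
      using that by (auto simp flip: i_sc)
  qed
  have inv: "\<pi> a ` D \<subseteq> D" for a by (auto simp: D_def simp flip: i_act)
  obtain d where d: "d \<in> D" "d \<noteq> 0" using nonzero unfolding D_def by blast
  have dense: "y = 0" if "y \<in> S" "\<And>d. d \<in> D \<Longrightarrow> ip d y = 0" for y
    by (rule irreducible_dense[OF irr D inv d that])
  have dense2: "y = z" if "y \<in> S" "z \<in> S" "\<And>e. ip (\<iota> e) y = ip (\<iota> e) z" for y z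
  proof -
    have "y - z = 0" using that i_S by (intro dense) (auto simp: D_def ip_simps)
    then show ?thesis by simp
  qed
  have i_diff: "\<iota> (e - f) = \<iota> e - \<iota> f" for e f
  proof -
    have "\<iota> e = \<iota> (e - f) + \<iota> f" by (subst i_add[symmetric]) simp
    then show ?thesis by simp
  qed
  have E_le: "E.nrm e \<le> nrm (\<iota> e)" for e
  proof (rule power2_le_imp_le)
    show "(E.nrm e)\<^sup>2 \<le> (nrm (\<iota> e))\<^sup>2" using B_le[of e] E.nrm_sq[of e] by simp
    show "0 \<le> nrm (\<iota> e)" using i_S by (rule nrm_ge_0)
  qed
  have B_bound: "cmod (B e f) \<le> nrm (\<iota> e) * nrm (\<iota> f)" for e f
  proof -
    have "cmod (B e f) \<le> E.nrm e * E.nrm f" by (rule E.cauchy_schwarz) auto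
    also have "\<dots> \<le> nrm (\<iota> e) * nrm (\<iota> f)"
      by (intro mult_mono E_le nrm_ge_0 i_S E.nrm_ge_0 UNIV_I)
    finally show ?thesis .
  qed
  \<comment> \<open>A functional bounded by the norm of \<open>\<iota> b\<close> descends to the
    range of \<open>\<iota>\<close>, where \<open>riesz\<close> applies; \<open>wd\<close> is
    independence of the chosen preimage.\<close>
  have riesz_range: "\<exists>y\<in>S. (\<forall>b. F b = ip (\<iota> b) y) \<and> nrm y \<le> K"
    if F_add: "\<And>b c. F (b + c) = F b + F c" and F_sc: "\<And>c b. F (sE c b) = c * F b"
      and F_le: "\<And>b. cmod (F b) \<le> K * nrm (\<iota> b)" and K: "0 \<le> K" for F K
  proof -
    have F_diff: "F (b - c) = F b - F c" for b c
    proof -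
      have "F b = F (b - c) + F c" by (subst F_add[symmetric]) simp
      then show ?thesis by simp
    qed
    have wd: "F b = F c" if "\<iota> b = \<iota> c" for b c
      using F_le[of "b - c"] that by (simp add: i_diff F_diff)
    define f where "f d = F (SOME b. \<iota> b = d)" for d
    have f: "f (\<iota> b) = F b" for b
      unfolding f_def by (rule wd) (rule someI[of _ b], simp)
    obtain y s where y: "y \<in> S" "\<And>x. x \<in> D \<Longrightarrow> f x = ip x y" "nrm y \<le> K"
      "\<And>n. s n \<in> D" "converges s y"
    proof (rule riesz[OF D K, of f])
      show "f (x + y) = f x + f y" if "x \<in> D" "y \<in> D" for x y
        using that unfolding D_def by (auto simp: f F_add simp flip: i_add)
      show "f (sc c x) = c * f x" if "x \<in> D" for c x
        using that unfolding D_def by (auto simp: f F_sc simp flip: i_sc)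
      show "cmod (f x) \<le> K * nrm x" if "x \<in> D" for x
        using that F_le unfolding D_def by (auto simp: f)
    qed blast
    have "F b = ip (\<iota> b) y" for b using y(2)[of "\<iota> b"] f[of b] by (simp add: D_def)
    then show ?thesis using y(1,3) by blast
  qed
  have "\<exists>y\<in>S. (\<forall>b. B b e = ip (\<iota> b) y) \<and> nrm y \<le> nrm (\<iota> e)" for e
    using B_bound[of _ e] i_S[of e] by (intro riesz_range) (auto simp: E.ip_simps mult.commute)
  then obtain y where y: "\<And>e. y e \<in> S" "\<And>b e. B b e = ip (\<iota> b) (y e)" "\<And>e. nrm (y e) \<le> nrm (\<iota> e)"
    by metis
  have y_add: "y (e + f) = y e + y f" for e f
    by (rule dense2) (auto simp: y(1) i_S ip_simps E.ip_simps simp flip: y(2))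
  have y_sc: "y (sE c e) = sc c (y e)" for c e
    by (rule dense2) (auto simp: y(1) i_S ip_simps E.ip_simps simp flip: y(2))
  have y_act: "y (\<alpha> a e) = \<pi> a (y e)" for a e
  proof (rule dense2)
    fix f
    have "ip (\<iota> f) (y (\<alpha> a e)) = B (\<alpha> (star a) f) e" by (simp add: B_act flip: y(2))
    also have "\<dots> = ip (\<pi> (star a) (\<iota> f)) (y e)" by (simp add: y(2) i_act)
    also have "\<dots> = ip (\<iota> f) (\<pi> a (y e))" using i_S y(1) by (simp add: rep_star)
    finally show "ip (\<iota> f) (y (\<alpha> a e)) = ip (\<iota> f) (\<pi> a (y e))" .
  qed (use y in auto)
  \<comment> \<open>So far only the vectors \<open>y e\<close>, the intended values
    \<open>T (\<iota> e)\<close>, are known. A second use of Riesz defines \<open>T\<close> on all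
    of \<open>S\<close> as the adjoint of the map taking \<open>\<iota> b\<close> to
    \<open>y b\<close>, in place of an extension by continuity.\<close>
  have "x \<in> S \<Longrightarrow> \<exists>z\<in>S. (\<forall>b. ip (y b) x = ip (\<iota> b) z) \<and> nrm z \<le> nrm x" for x
  proof (rule riesz_range)
    fix b assume x: "x \<in> S"
    have "cmod (ip (y b) x) \<le> nrm (y b) * nrm x" by (rule cauchy_schwarz[OF y(1) x])
    also have "\<dots> \<le> nrm x * nrm (\<iota> b)"
      using mult_right_mono[OF y(3)[of b], of "nrm x"] x by (simp add: mult.commute)
    finally show "cmod (ip (y b) x) \<le> nrm x * nrm (\<iota> b)" .
  qed (auto simp: y_add y_sc y(1) ip_simps)
  then obtain T where T: "\<And>x. x \<in> S \<Longrightarrow> T x \<in> S" "\<And>x b. x \<in> S \<Longrightarrow> ip (y b) x = ip (\<iota> b) (T x)"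
    "\<And>x. x \<in> S \<Longrightarrow> nrm (T x) \<le> nrm x"
    by metis
  have Tb: "bounded_op T 1"
    unfolding bounded_op_def
  proof (intro conjI ballI allI)
    show "T (x + z) = T x + T z" if "x \<in> S" "z \<in> S" for x z
      using that by (intro dense2) (auto simp: T(1) i_S y(1) ip_simps simp flip: T(2))
    show "T (sc c x) = sc c (T x)" if "x \<in> S" for c x
      using that by (intro dense2) (auto simp: T(1) i_S y(1) ip_simps simp flip: T(2))
  qed (use T in auto)
  \<comment> \<open>Hermitian symmetry of \<open>B\<close> identifies the adjoint with the original
    map on the range of \<open>\<iota>\<close>.\<close>
  have Ti: "T (\<iota> e) = y e" for e
  proof (rule dense2)
    fix b
    have "ip (\<iota> b) (T (\<iota> e)) = cnj (ip (\<iota> e) (y b))"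
      using T(2)[OF i_S, of b e] ip_cnj[OF i_S[of e] y(1)[of b]] by simp
    also have "\<dots> = ip (\<iota> b) (y e)" using E.ip_cnj[of e b] by (simp flip: y(2))
    finally show "ip (\<iota> b) (T (\<iota> e)) = ip (\<iota> b) (y e)" .
  qed (use T i_S y in auto)
  have "selfadjoint T"
    unfolding selfadjoint_def
  proof (intro ballI)
    fix x z assume x: "x \<in> S" and z: "z \<in> S"
    \<comment> \<open>Symmetry is immediate when the first argument lies in \<open>D\<close>;
      density carries it to all of \<open>S\<close>.\<close>
    obtain s where s: "\<And>n. s n \<in> D" "converges s x" using dense_sequence[OF D dense x] by blast
    have sS: "\<And>n. s n \<in> S" using s(1) linear_subspaceD(1)[OF D] by blast
    have eq: "ip (T (s n)) z = ip (s n) (T z)" for n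
      using s(1)[of n] z by (auto simp: D_def Ti T(2))
    show "ip (T x) z = ip x (T z)"
    proof (rule LIMSEQ_unique)
      show "(\<lambda>n. ip (T (s n)) z) \<longlonglongrightarrow> ip (T x) z"
        using bounded_op_converges[OF Tb s(2) sS x] by (rule converges_ip) (use sS x z T in auto)
      show "(\<lambda>n. ip (T (s n)) z) \<longlonglongrightarrow> ip x (T z)"
        unfolding eq by (rule converges_ip[OF s(2) sS x]) (use z T in auto)
    qed
  qed
  moreover have "commutes (\<pi> a) T" for a
    unfolding commutes_def
  proof
    fix x assume x: "x \<in> S"
    show "\<pi> a (T x) = T (\<pi> a x)"
    proof (rule dense2)
      fix b
      have "ip (\<iota> b) (\<pi> a (T x)) = ip (\<iota> (\<alpha> (star a) b)) (T x)"
        using i_S T(1)[OF x] by (simp add: i_act rep_star)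
      also have "\<dots> = ip (\<pi> (star a) (y b)) x" by (simp add: y_act flip: T(2)[OF x])
      also have "\<dots> = ip (\<iota> b) (T (\<pi> a x))" using x y(1) by (simp add: rep_star T(2))
      finally show "ip (\<iota> b) (\<pi> a (T x)) = ip (\<iota> b) (T (\<pi> a x))" .
    qed (use x T in auto)
  qed
  ultimately obtain t where t: "\<And>x. x \<in> S \<Longrightarrow> T x = sc (of_real t) x"
    using schur[OF irr Tb] by blast
  have "B e f = of_real t * ip (\<iota> e) (\<iota> f)" for e f
    using y(2)[of e f] Ti[of f] t[OF i_S, of f] i_S ip_sc_right[of "\<iota> e" "\<iota> f" "of_real t"] by simp
  then show ?thesis using that by blast
qed

end

section \<open>Completions\<close>

context semi_inner
begin

lemma cauchy_bounded:
  assumes "cauchy s" "\<And>n. s n \<in> S"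
  obtains K where "0 < K" "\<And>n. nrm (s n) \<le> K"
proof -
  obtain M where M: "\<And>m n. m \<ge> M \<Longrightarrow> n \<ge> M \<Longrightarrow> nrm (s m - s n) < 1"
    using assms(1)[unfolded cauchy_def, rule_format, of 1] by auto
  have 1: "nrm (s n) \<le> nrm (s M) + 1" if "n \<ge> M" for n
    using M[OF that order_refl] nrm_reverse_triangle[OF assms(2,2), of n M] by linarith
  define K where "K = Max ((\<lambda>n. nrm (s n)) ` {..M}) + 1"
  have 2: "nrm (s n) \<le> K - 1" if "n \<le> M" for n
    unfolding K_def using that by simp
  have "nrm (s n) \<le> K" for n
  proof (cases "n \<le> M")
    case True
    show ?thesis using 2[OF True] by linarith
  next
    case False
    then have "n \<ge> M" by simp
    from 1[OF this] 2[OF order_refl] show ?thesis by linarith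
  qed
  moreover have "0 < K" using 2[of M] nrm_ge_0[OF assms(2)[of M]] by linarith
  ultimately show ?thesis using that by blast
qed

lemma cauchy_map:
  assumes s: "cauchy s" and K: "\<And>m n. nrm (t m - t n) \<le> K * nrm (s m - s n)" "0 \<le> K" and "\<And>n. s n \<in> S"
  shows "cauchy t"
  unfolding cauchy_def
proof (intro allI impI)
  fix e :: real assume e: "0 < e"
  \<comment> \<open>\<open>K + 1\<close> rather than \<open>K\<close>, which may be 0.\<close>
  then have "0 < e / (K + 1)" using K by (simp add: add_nonneg_pos)
  then obtain M where M: "\<And>m n. m \<ge> M \<Longrightarrow> n \<ge> M \<Longrightarrow> nrm (s m - s n) < e / (K + 1)"
    using s unfolding cauchy_def by blast
  have "nrm (t m - t n) < e" if "m \<ge> M" "n \<ge> M" for m n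
  proof -
    have "nrm (t m - t n) \<le> K * (e / (K + 1))"
      using K(1)[of m n] mult_left_mono[OF less_imp_le[OF M[OF that]] K(2)] by linarith
    also have "\<dots> < (K + 1) * (e / (K + 1))"
      using \<open>0 < e / (K + 1)\<close> by (intro mult_strict_right_mono) auto
    also have "\<dots> = e" using K(2) by simp
    finally show ?thesis .
  qed
  then show "\<exists>M. \<forall>m\<ge>M. \<forall>n\<ge>M. nrm (t m - t n) < e" by blast
qed

lemma cauchy_const: "cauchy (\<lambda>n. x)"
  by (simp add: cauchy_def)

lemma cauchy_add:
  assumes "cauchy s" "cauchy t" "\<And>n. s n \<in> S" "\<And>n. t n \<in> S"
  shows "cauchy (\<lambda>n. s n + t n)"
  unfolding cauchy_def
proof (intro allI impI)
  fix e :: real assume "0 < e"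
  then have "0 < e / 2" by simp
  obtain M where M: "\<And>m n. m \<ge> M \<Longrightarrow> n \<ge> M \<Longrightarrow> nrm (s m - s n) < e / 2"
    using assms(1) \<open>0 < e / 2\<close> unfolding cauchy_def by blast
  obtain N where N: "\<And>m n. m \<ge> N \<Longrightarrow> n \<ge> N \<Longrightarrow> nrm (t m - t n) < e / 2"
    using assms(2) \<open>0 < e / 2\<close> unfolding cauchy_def by blast
  have "nrm (s m + t m - (s n + t n)) < e" if "m \<ge> max M N" "n \<ge> max M N" for m n
  proof -
    have "nrm (s m + t m - (s n + t n)) \<le> nrm (s m - s n) + nrm (t m - t n)"
      using nrm_triangle[of "s m - s n" "t m - t n"] assms(3,4) by (simp add: algebra_simps)
    then show ?thesis using M[of m n] N[of m n] that by simp
  qed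
  then show "\<exists>M. \<forall>m\<ge>M. \<forall>n\<ge>M. nrm (s m + t m - (s n + t n)) < e" by blast
qed

lemma cauchy_ip_convergent:
  assumes s: "cauchy s" "\<And>n. s n \<in> S" and t: "cauchy t" "\<And>n. t n \<in> S"
  shows "convergent (\<lambda>n. ip (s n) (t n))"
proof (rule Cauchy_convergent, rule CauchyI)
  fix e :: real assume e: "0 < e"
  obtain K where K: "0 < K" "\<And>n. nrm (s n) \<le> K" using cauchy_bounded[OF s] by blast
  obtain L where L: "0 < L" "\<And>n. nrm (t n) \<le> L" using cauchy_bounded[OF t] by blast
  have "0 < e / (2 * L)" "0 < e / (2 * K)" using e K L by auto
  obtain M where M: "\<And>m n. m \<ge> M \<Longrightarrow> n \<ge> M \<Longrightarrow> nrm (s m - s n) < e / (2 * L)"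
    using s(1) \<open>0 < e / (2 * L)\<close> unfolding cauchy_def by blast
  obtain N where N: "\<And>m n. m \<ge> N \<Longrightarrow> n \<ge> N \<Longrightarrow> nrm (t m - t n) < e / (2 * K)"
    using t(1) \<open>0 < e / (2 * K)\<close> unfolding cauchy_def by blast
  have "norm (ip (s m) (t m) - ip (s n) (t n)) < e" if "m \<ge> max M N" "n \<ge> max M N" for m n
  proof -
    have "ip (s m) (t m) - ip (s n) (t n) = ip (s m - s n) (t m) + ip (s n) (t m - t n)"
      using s t by (simp add: ip_simps)
    then have "norm (ip (s m) (t m) - ip (s n) (t n)) \<le> norm (ip (s m - s n) (t m)) + norm (ip (s n) (t m - t n))"
      by (simp only: norm_triangle_ineq)
    also have "\<dots> \<le> nrm (s m - s n) * nrm (t m) + nrm (s n) * nrm (t m - t n)"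
      using s(2) t(2) by (intro add_mono cauchy_schwarz S_diff)
    also have "nrm (s m - s n) * nrm (t m) \<le> nrm (s m - s n) * L"
      using L(2) s(2) by (intro mult_left_mono nrm_ge_0) auto
    also have "nrm (s m - s n) * L < e / (2 * L) * L"
      using M[of m n] that L by (intro mult_strict_right_mono) auto
    also have "nrm (s n) * nrm (t m - t n) \<le> K * nrm (t m - t n)"
      using K(2) t(2) by (intro mult_right_mono nrm_ge_0) auto
    also have "K * nrm (t m - t n) < K * (e / (2 * K))"
      using N[of m n] that K by (intro mult_strict_left_mono) auto
    also have "e / (2 * L) * L + K * (e / (2 * K)) = e" using K L by simp
    finally show ?thesis by simp
  qed
  then show "\<exists>M. \<forall>m\<ge>M. \<forall>n\<ge>M. norm (ip (s m) (t m) - ip (s n) (t n)) < e" by blast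
qed

end

definition scaleF :: "complex \<Rightarrow> ('e \<Rightarrow> complex) \<Rightarrow> 'e \<Rightarrow> complex" where
  "scaleF c f = (\<lambda>e. c * f e)"

lemma vector_space_scaleF: "vector_space scaleF"
  by unfold_locales (auto simp: scaleF_def fun_eq_iff algebra_simps)

text \<open>A semi-inner product space \<open>E\<close> is completed inside the functions on \<open>E\<close>: the class of a Cauchy
  sequence \<open>s\<close> is represented by the antilinear functional \<open>e \<mapsto> lim \<langle>s\<^sub>n, e\<rangle>\<close>.\<close>

locale semi_inner_type = semi_inner sc UNIV ip
  for sc :: "complex \<Rightarrow> 'v::ab_group_add \<Rightarrow> 'v" and ip
begin

definition represents :: "(nat \<Rightarrow> 'v) \<Rightarrow> ('v \<Rightarrow> complex) \<Rightarrow> bool" where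
  "represents s f \<longleftrightarrow> cauchy s \<and> (\<forall>e. (\<lambda>n. ip (s n) e) \<longlonglongrightarrow> f e)"

definition completion :: "('v \<Rightarrow> complex) set" where
  "completion = {f. \<exists>s. represents s f}"

text \<open>Arbitrary representing sequences are chosen; \<open>represents_ip\<close> shows that
  every other choice gives the same limit.\<close>

definition ip_completion :: "('v \<Rightarrow> complex) \<Rightarrow> ('v \<Rightarrow> complex) \<Rightarrow> complex" where
  "ip_completion f g = lim (\<lambda>n. ip ((SOME s. represents s f) n) ((SOME s. represents s g) n))"

definition embed :: "'v \<Rightarrow> 'v \<Rightarrow> complex" where
  "embed x = ip x"

text \<open>Since \<open>s\<close> is Cauchy, the functionals \<open>ip (s n)\<close> converge to
  \<open>f\<close> uniformly on bounded sets, and \<open>t\<close> is bounded. Hence the limit of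
  \<open>ip (s n) (t n)\<close> depends on \<open>s\<close> only through \<open>f\<close>.\<close>

lemma represents_ip_diff:
  assumes s: "represents s f" and t: "cauchy t"
  shows "(\<lambda>n. ip (s n) (t n) - f (t n)) \<longlonglongrightarrow> 0"
proof (rule LIMSEQ_I)
  fix r :: real assume r: "0 < r"
  obtain K where K: "0 < K" "\<And>n. nrm (t n) \<le> K" using cauchy_bounded[OF t] by auto
  have "0 < r / (2 * K)" using r K by simp
  then obtain M where M: "\<And>m n. m \<ge> M \<Longrightarrow> n \<ge> M \<Longrightarrow> nrm (s m - s n) < r / (2 * K)"
    using s unfolding represents_def cauchy_def by blast
  have "norm (ip (s n) (t n) - f (t n)) \<le> r / 2" if n: "n \<ge> M" for n
  proof (rule LIMSEQ_le_const2)
    show "(\<lambda>k. norm (ip (s n) (t n) - ip (s k) (t n))) \<longlonglongrightarrow> norm (ip (s n) (t n) - f (t n))"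
      using s unfolding represents_def by (intro tendsto_intros) auto
    have "norm (ip (s n) (t n) - ip (s k) (t n)) \<le> r / 2" if k: "k \<ge> M" for k
    proof -
      have "norm (ip (s n) (t n) - ip (s k) (t n)) \<le> nrm (s n - s k) * nrm (t n)"
        using cauchy_schwarz[of "s n - s k" "t n"] by (simp add: ip_simps)
      also have "\<dots> \<le> r / (2 * K) * K"
        using M[OF n k] K r by (intro mult_mono) auto
      finally show ?thesis using K by simp
    qed
    then show "\<exists>N. \<forall>k\<ge>N. norm (ip (s n) (t n) - ip (s k) (t n)) \<le> r / 2" by blast
  qed
  then show "\<exists>no. \<forall>n\<ge>no. norm (ip (s n) (t n) - f (t n) - 0) < r"
    using r by (metis diff_zero field_sum_of_halves less_add_same_cancel1 half_gt_zero order_le_less_trans)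
qed

lemma represents_ip:
  assumes s: "represents s f" and t: "represents t g"
  shows "(\<lambda>n. ip (s n) (t n)) \<longlonglongrightarrow> ip_completion f g"
proof -
  have indep: "(\<lambda>n. ip (s' n) (t n)) \<longlonglongrightarrow> L"
    if "represents s f" "represents s' f" "cauchy t" "(\<lambda>n. ip (s n) (t n)) \<longlonglongrightarrow> L" for s s' t f L
    using tendsto_add[OF tendsto_diff[OF represents_ip_diff[OF that(2,3)] represents_ip_diff[OF that(1,3)]] that(4)]
    by simp
  have flip: "(\<lambda>n. ip (t n) (s n)) \<longlonglongrightarrow> cnj L" if "(\<lambda>n. ip (s n) (t n)) \<longlonglongrightarrow> L" for s t L
    using tendsto_cnj[OF that] by (simp flip: ip_cnj)
  define s' where "s' = (SOME s. represents s f)"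
  define t' where "t' = (SOME s. represents s g)"
  have s': "represents s' f" unfolding s'_def by (rule someI[where P = "\<lambda>s. represents s f", OF s])
  have t': "represents t' g" unfolding t'_def by (rule someI[where P = "\<lambda>s. represents s g", OF t])
  note C = s[unfolded represents_def, THEN conjunct1] t[unfolded represents_def, THEN conjunct1]
    s'[unfolded represents_def, THEN conjunct1] t'[unfolded represents_def, THEN conjunct1]
  have "(\<lambda>n. ip (s' n) (t' n)) \<longlonglongrightarrow> ip_completion f g"
    using cauchy_ip_convergent[OF C(3) _ C(4)] unfolding ip_completion_def s'_def[symmetric] t'_def[symmetric]
    by (simp add: convergent_LIMSEQ_iff)
  then have "(\<lambda>n. ip (s n) (t' n)) \<longlonglongrightarrow> ip_completion f g"
    by (rule indep[OF s' s C(4)])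
  then show ?thesis
    using flip[OF indep[OF t' t C(1) flip]] by simp
qed

lemma represents_add: "represents s f \<Longrightarrow> represents t g \<Longrightarrow> represents (\<lambda>n. s n + t n) (f + g)"
  unfolding represents_def by (auto intro!: cauchy_add tendsto_add simp: ip_simps)

lemma represents_sc: "represents s f \<Longrightarrow> represents (\<lambda>n. sc c (s n)) (scaleF c f)"
  unfolding represents_def scaleF_def
  by (auto intro!: tendsto_mult_left cauchy_map[of s "\<lambda>n. sc c (s n)" "cmod c"]
      simp: ip_simps nrm_sc simp flip: scale_right_diff_distrib)

lemma represents_embed: "represents (\<lambda>n. x) (embed x)"
  unfolding represents_def embed_def by (auto intro: cauchy_const)

lemma represents_antilinear:
  assumes "represents s f"
  shows "f (x + y) = f x + f y" "f (sc c x) = cnj c * f x"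
proof -
  have lim: "(\<lambda>n. ip (s n) e) \<longlonglongrightarrow> f e" for e using assms by (simp add: represents_def)
  show "f (x + y) = f x + f y"
    using tendsto_add[OF lim[of x] lim[of y]]
    by (intro LIMSEQ_unique[OF lim]) (simp add: ip_simps)
  show "f (sc c x) = cnj c * f x"
    using tendsto_mult_left[OF lim[of x], of "cnj c"]
    by (intro LIMSEQ_unique[OF lim]) (simp add: ip_simps)
qed

text \<open>The source of definiteness: a class of norm 0 is the zero function, so null vectors
  disappear without forming a quotient.\<close>

lemma represents_zero_if:
  assumes "represents s f" "(\<lambda>n. nrm (s n)) \<longlonglongrightarrow> 0"
  shows "f = 0"
proof
  fix e
  have "(\<lambda>n. ip (s n) e) \<longlonglongrightarrow> 0"
  proof (rule null_comparison)
    show "\<forall>\<^sub>F n in sequentially. norm (ip (s n) e) \<le> nrm (s n) * nrm e"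
      by (auto intro!: always_eventually cauchy_schwarz)
    show "(\<lambda>n. nrm (s n) * nrm e) \<longlonglongrightarrow> 0"
      using tendsto_mult_right[OF assms(2), of "nrm e"] by simp
  qed
  moreover have "(\<lambda>n. ip (s n) e) \<longlonglongrightarrow> f e" using assms by (simp add: represents_def)
  ultimately show "f e = 0 e" using LIMSEQ_unique by fastforce
qed

sublocale completion: semi_inner scaleF completion ip_completion
proof -
  show "semi_inner scaleF completion ip_completion"
  proof (intro semi_inner.intro vector_space_scaleF semi_inner_axioms.intro)
    show "0 \<in> completion"
    proof -
      have "embed 0 = 0" by (simp add: embed_def fun_eq_iff)
      then show ?thesis using represents_embed[of 0] unfolding completion_def by auto
    qed
    show "x + y \<in> completion" if "x \<in> completion" "y \<in> completion" for x y
      using that represents_add unfolding completion_def by blast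
    show "scaleF c x \<in> completion" if "x \<in> completion" for c x
      using that represents_sc unfolding completion_def by blast
  next
    fix f g h assume "f \<in> completion" "g \<in> completion" "h \<in> completion"
    then obtain s t u where r: "represents s f" "represents t g" "represents u h"
      unfolding completion_def by blast
    show "ip_completion (f + g) h = ip_completion f h + ip_completion g h"
      using represents_ip[OF represents_add[OF r(1,2)] r(3)]
        tendsto_add[OF represents_ip[OF r(1,3)] represents_ip[OF r(2,3)]]
      by (intro LIMSEQ_unique) (auto simp: ip_simps)
  next
    fix f g c assume "f \<in> completion" "g \<in> completion"
    then obtain s t where r: "represents s f" "represents t g"
      unfolding completion_def by blast
    show "ip_completion (scaleF c f) g = c * ip_completion f g"
      using represents_ip[OF represents_sc[OF r(1), of c] r(2)]
        LIMSEQ_unique[OF _ tendsto_mult_left[OF represents_ip[OF r], of c]] by (simp add: ip_simps)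
    show "ip_completion g f = cnj (ip_completion f g)"
      using represents_ip[OF r(2,1)] tendsto_cnj[OF represents_ip[OF r]]
      by (intro LIMSEQ_unique) (auto simp flip: ip_cnj)
  next
    fix f assume "f \<in> completion"
    then obtain s where r: "represents s f" unfolding completion_def by blast
    show "0 \<le> Re (ip_completion f f)"
      by (rule LIMSEQ_le_const[OF tendsto_Re[OF represents_ip[OF r r]]]) (auto simp: ip_nonneg)
  qed
qed

lemma represents_nrm:
  assumes "represents s f"
  shows "(\<lambda>n. nrm (s n)) \<longlonglongrightarrow> completion.nrm f"
  unfolding nrm_def completion.nrm_def
  by (intro tendsto_real_sqrt tendsto_Re represents_ip assms)

lemma ip_completion_embed: "ip_completion (embed x) (embed y) = ip x y"
  using represents_ip[OF represents_embed[of x] represents_embed[of y]] by (simp add: LIMSEQ_const_iff)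

lemma embed_in_completion [simp]: "embed x \<in> completion"
  using represents_embed unfolding completion_def by blast

lemma represents_diff_embed: "represents s f \<Longrightarrow> represents (\<lambda>k. s k - x) (f - embed x)"
  using represents_add[OF _ represents_embed[of "- x"], of s f]
  by (simp add: embed_def fun_diff_def fun_Compl_def plus_fun_def ip_simps)

lemma represents_converges:
  assumes "represents s f"
  shows "completion.converges (\<lambda>n. embed (s n)) f"
  unfolding completion.converges_def
proof (rule LIMSEQ_I)
  fix r :: real assume "0 < r"
  then have "0 < r / 2" by simp
  then obtain M where M: "\<And>m n. m \<ge> M \<Longrightarrow> n \<ge> M \<Longrightarrow> nrm (s m - s n) < r / 2"
    using assms unfolding represents_def cauchy_def by blast
  have f: "f \<in> completion" using assms by (auto simp: completion_def)
  have "completion.nrm (f - embed (s n)) \<le> r / 2" if "n \<ge> M" for n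
  proof (rule LIMSEQ_le_const2[OF represents_nrm[OF represents_diff_embed[OF assms]]])
    show "\<exists>N. \<forall>k\<ge>N. nrm (s k - s n) \<le> r / 2" using M that by (meson less_imp_le)
  qed
  then have "norm (completion.nrm (embed (s n) - f) - 0) < r" if "n \<ge> M" for n
    using that f \<open>0 < r\<close> completion.nrm_minus_commute[of f "embed (s n)"] by fastforce
  then show "\<exists>no. \<forall>n\<ge>no. norm (completion.nrm (embed (s n) - f) - 0) < r" by blast
qed

lemma embed_diff: "embed x - embed y = embed (x - y)"
  by (simp add: embed_def fun_eq_iff ip_simps)

lemma nrm_embed: "completion.nrm (embed x) = nrm x"
  by (simp add: completion.nrm_def nrm_def ip_completion_embed)

lemma completion_dense:
  assumes "f \<in> completion"
  obtains s where "represents s f" "completion.converges (\<lambda>n. embed (s n)) f"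
  using assms represents_converges unfolding completion_def by blast

sublocale completion: hilbert scaleF completion ip_completion
proof unfold_locales
  fix f assume f: "f \<in> completion" "f \<noteq> 0"
  then obtain s where r: "represents s f" unfolding completion_def by blast
  have "completion.nrm f \<noteq> 0"
    using represents_nrm[OF r] represents_zero_if[OF r] f(2) by auto
  then show "0 < Re (ip_completion f f)"
    using completion.ip_nonneg[OF f(1)] by (simp add: completion.nrm_def less_le)
next
  fix F assume F: "\<And>n. F n \<in> completion" and cF: "completion.cauchy F"
  \<comment> \<open>Diagonal argument: each \<open>F k\<close> is replaced by an embedded vector at
    distance less than \<open>1 / (k + 1)\<close>, and the class of the resulting Cauchy sequence is
    the limit.\<close>
  have "\<exists>x. completion.nrm (F k - embed x) < 1 / real (Suc k)" for k
  proof -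
    obtain s where "completion.converges (\<lambda>n. embed (s n)) (F k)" using completion_dense[OF F] by blast
    then have "\<forall>\<^sub>F n in sequentially. completion.nrm (embed (s n) - F k) < 1 / real (Suc k)"
      unfolding completion.converges_def by (rule order_tendstoD) simp
    then obtain n where "completion.nrm (embed (s n) - F k) < 1 / real (Suc k)"
      by (auto dest: eventually_happens)
    then show ?thesis using completion.nrm_minus_commute[OF F embed_in_completion] by (metis)
  qed
  then obtain x where x: "\<And>k. completion.nrm (F k - embed (x k)) < 1 / real (Suc k)" by metis
  have Fx: "completion.converges (\<lambda>k. F k - embed (x k)) 0"
    unfolding completion.converges_def
  proof (rule null_comparison)
    show "\<forall>\<^sub>F k in sequentially. norm (completion.nrm (F k - embed (x k) - 0)) \<le> 1 / real (Suc k)"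
      using x F by (auto intro!: always_eventually less_imp_le)
    show "(\<lambda>k. 1 / real (Suc k)) \<longlonglongrightarrow> 0"
      using LIMSEQ_inverse_real_of_nat by (simp add: inverse_eq_divide)
  qed
  have "completion.cauchy (\<lambda>k. embed (x k) - F k)"
    using completion.converges_cauchy[OF completion.converges_diff[OF completion.converges_const[of 0] Fx]] F by simp
  from completion.cauchy_add[OF cF this] have "completion.cauchy (\<lambda>k. embed (x k))"
    using F by simp
  then have cx: "cauchy x"
    unfolding cauchy_def completion.cauchy_def by (simp add: embed_diff nrm_embed)
  define f where "f e = lim (\<lambda>k. ip (x k) e)" for e
  have "represents x f"
    unfolding represents_def f_def
    using cx cauchy_ip_convergent[OF cx _ cauchy_const] by (simp add: convergent_LIMSEQ_iff)
  then have f: "f \<in> completion" "completion.converges (\<lambda>k. embed (x k)) f"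
    using represents_converges by (auto simp: completion_def)
  have "completion.converges F f"
    using completion.converges_add[OF Fx f(2)] F f(1) by simp
  then show "\<exists>l\<in>completion. completion.converges F l" using f(1) by blast
qed

text \<open>If \<open>s\<close> represents \<open>f\<close>, then by the adjoint relation the
  vectors \<open>\<alpha> a (s n)\<close> represent
  \<open>e \<mapsto> f (\<alpha> (star a) e)\<close>. The action on the completion is therefore
  precomposition, and its algebraic laws follow from those of \<open>\<alpha>\<close> and
  \<open>star\<close>.\<close>

lemma completion_star_rep:
  fixes \<alpha> :: "'a::unital_cstar_algebra \<Rightarrow> 'v \<Rightarrow> 'v"
  assumes lin: "\<And>a x y. \<alpha> a (x + y) = \<alpha> a x + \<alpha> a y" "\<And>a c x. \<alpha> a (sc c x) = sc c (\<alpha> a x)"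
    and bounded: "\<And>a x. nrm (\<alpha> a x) \<le> K a * nrm x"
    and adj: "\<And>a x y. ip (\<alpha> (star a) x) y = ip x (\<alpha> a y)"
    and hom: "\<And>a b x. \<alpha> (a + b) x = \<alpha> a x + \<alpha> b x" "\<And>c a x. \<alpha> (scaleC c a) x = sc c (\<alpha> a x)"
      "\<And>a b x. \<alpha> (a * b) x = \<alpha> a (\<alpha> b x)" "\<And>x. \<alpha> 1 x = x"
  shows "star_rep scaleF completion ip_completion (\<lambda>a f e. f (\<alpha> (star a) e))"
    and "(\<lambda>e. embed x (\<alpha> (star a) e)) = embed (\<alpha> a x)"
proof -
  have adj': "ip x (\<alpha> (star a) y) = ip (\<alpha> a x) y" for a x y
    using adj[of "star a" x y] by (simp add: star_star)
  show "(\<lambda>e. embed x (\<alpha> (star a) e)) = embed (\<alpha> a x)"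
    by (simp add: embed_def adj' fun_eq_iff)
  have star_one: "star (1::'a) = 1"
    by (metis mult.left_neutral mult.right_neutral star_mult star_star)
  have K: "nrm (\<alpha> a x) \<le> \<bar>K a\<bar> * nrm x" for a x
    using bounded[of a x] mult_right_mono[OF abs_ge_self[of "K a"] nrm_ge_0[of x]] by auto
  have diff: "\<alpha> a x - \<alpha> a y = \<alpha> a (x - y)" for a x y
    using lin(1)[of a "x - y" y] by simp
  have rep: "represents (\<lambda>n. \<alpha> a (s n)) (\<lambda>e. f (\<alpha> (star a) e))" if "represents s f" for a s f
    using that cauchy_map[of s "\<lambda>n. \<alpha> a (s n)" "\<bar>K a\<bar>"] K
    unfolding represents_def by (auto simp: diff simp flip: adj')
  show "star_rep scaleF completion ip_completion (\<lambda>a f e. f (\<alpha> (star a) e))"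
  proof unfold_locales
    fix a
    show "\<exists>K. completion.bounded_op (\<lambda>f e. f (\<alpha> (star a) e)) K"
      unfolding completion.bounded_op_def
    proof (intro exI conjI ballI allI)
      show "0 \<le> \<bar>K a\<bar>" by simp
      fix f assume "f \<in> completion"
      then obtain s where s: "represents s f" unfolding completion_def by blast
      show "(\<lambda>e. f (\<alpha> (star a) e)) \<in> completion" using rep[OF s] unfolding completion_def by blast
      show "completion.nrm (\<lambda>e. f (\<alpha> (star a) e)) \<le> \<bar>K a\<bar> * completion.nrm f"
        by (rule LIMSEQ_le[OF represents_nrm[OF rep[OF s]] tendsto_mult_left[OF represents_nrm[OF s]]])
           (use K in auto)
    qed (auto simp: scaleF_def)
  next
    fix f a b c assume "f \<in> completion"
    then obtain s where s: "represents s f" unfolding completion_def by blast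
    note f = represents_antilinear[OF s]
    show "(\<lambda>e. f (\<alpha> (star (a + b)) e)) = (\<lambda>e. f (\<alpha> (star a) e)) + (\<lambda>e. f (\<alpha> (star b) e))"
      by (simp add: fun_eq_iff star_add hom f)
    show "(\<lambda>e. f (\<alpha> (star (scaleC c a)) e)) = scaleF c (\<lambda>e. f (\<alpha> (star a) e))"
      by (simp add: fun_eq_iff star_scaleC hom f scaleF_def)
    show "(\<lambda>e. f (\<alpha> (star (a * b)) e)) = (\<lambda>e. f (\<alpha> (star b) (\<alpha> (star a) e)))"
      by (simp add: fun_eq_iff star_mult hom)
    show "(\<lambda>e. f (\<alpha> (star 1) e)) = f" by (simp add: fun_eq_iff star_one hom)
  next
    fix f g a assume "f \<in> completion" "g \<in> completion"
    then obtain s t where r: "represents s f" "represents t g" unfolding completion_def by blast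
    show "ip_completion (\<lambda>e. f (\<alpha> (star (star a)) e)) g = ip_completion f (\<lambda>e. g (\<alpha> (star a) e))"
      using represents_ip[OF rep[OF r(1), of "star a"] r(2)] represents_ip[OF r(1) rep[OF r(2), of a]]
      by (intro LIMSEQ_unique) (auto simp: adj)
  qed
qed

end

section \<open>Elementary facts on C*-algebras\<close>

lemma star_one: "star (1::'a::unital_cstar_algebra) = 1"
  by (metis mult.left_neutral mult.right_neutral star_mult star_star)

lemma scaleC_one: "scaleC 1 (x::'a::unital_cstar_algebra) = x"
  using scaleC_of_real[of 1 x] by simp

lemma scaleC_zero_left: "scaleC 0 (x::'a::unital_cstar_algebra) = 0"
  using scaleC_of_real[of 0 x] by simp

lemma star_scaleR: "star (r *\<^sub>R x) = r *\<^sub>R star (x::'a::unital_cstar_algebra)"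
  by (metis complex_cnj_complex_of_real scaleC_of_real star_scaleC)

lemma star_minus: "star (- x) = - star (x::'a::unital_cstar_algebra)"
  using star_scaleR[of "-1" x] by simp

lemma star_diff: "star (x - y) = star x - star (y::'a::unital_cstar_algebra)"
  using star_add[of x "- y"] by (simp add: star_minus)

lemma star_zero: "star (0::'a::unital_cstar_algebra) = 0"
  using star_diff[of 0 0] by simp

lemma norm_star: "norm (star x) = norm (x::'a::unital_cstar_algebra)"
proof -
  have le: "norm y \<le> norm (star y)" for y :: 'a
  proof (cases "norm y = 0")
    case False
    have "norm y * norm y \<le> norm (star y) * norm y"
      using norm_mult_ineq[of "star y" y] cstar_identity[of y] by (simp add: power2_eq_square)
    then show ?thesis using False by simp
  qed simp
  show ?thesis using le[of x] le[of "star x"] by (simp add: star_star)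
qed

lemma bounded_linear_star: "bounded_linear (star :: 'a::unital_cstar_algebra \<Rightarrow> 'a)"
  by (rule bounded_linear_intro[where K = 1]) (auto simp: star_add star_scaleR norm_star)

text \<open>The iteration of \<open>operator_sqrt\<close> carried out inside the algebra, where it
  converges in norm; \<open>c = 1 - Y\<close> for the limit \<open>Y\<close>.\<close>

lemma cstar_sqrt:
  fixes x :: "'a::unital_cstar_algebra"
  assumes x: "norm x \<le> 1" "star x = x"
  obtains c where "star c = c" "c * c = 1 - x"
proof -
  define Z where "Z = rec_nat 0 (\<lambda>_ z. (1/2) *\<^sub>R (x + z * z))"
  have Z0: "Z 0 = 0" and ZS: "Z (Suc n) = (1/2) *\<^sub>R (x + Z n * Z n)" for n
    by (simp_all add: Z_def)
  have bound: "norm (Z n) \<le> sqrt_seq n" for n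
  proof (induction n)
    case (Suc n)
    have "norm (Z n * Z n) \<le> sqrt_seq n * sqrt_seq n"
      using norm_mult_ineq[of "Z n" "Z n"] mult_mono[OF Suc Suc] sqrt_seq_bounds[of n] by simp
    then have "norm (x + Z n * Z n) \<le> 1 + (sqrt_seq n)\<^sup>2"
      using norm_triangle_ineq[of x "Z n * Z n"] x by (simp add: power2_eq_square)
    then show ?case by (simp add: ZS)
  qed (simp add: Z0)
  have com: "u * Z n = Z n * u" if u: "u * x = x * u" for u n
  proof (induction n)
    case (Suc n)
    have "u * (Z n * Z n) = (Z n * Z n) * u"
      using Suc by (metis mult.assoc)
    then show ?case using u by (simp add: ZS distrib_left distrib_right)
  qed (simp add: Z0)
  have ZZ: "Z m * Z n = Z n * Z m" for m n
    using com[OF com[OF refl, of m, symmetric], of n] .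
  have sa: "star (Z n) = Z n" for n
    by (induction n) (simp_all add: Z0 ZS star_zero star_scaleR star_add star_mult x)
  have inc: "norm (Z (Suc n) - Z n) \<le> sqrt_seq (Suc n) - sqrt_seq n" for n
  proof (induction n)
    case 0
    then show ?case using x by (simp add: ZS Z0)
  next
    case (Suc n)
    have "Z (Suc (Suc n)) - Z (Suc n) = (1/2) *\<^sub>R (Z (Suc n) * Z (Suc n) - Z n * Z n)"
      unfolding ZS[of "Suc n"] ZS[of n] by (simp flip: scaleR_diff_right)
    also have "Z (Suc n) * Z (Suc n) - Z n * Z n = (Z (Suc n) + Z n) * (Z (Suc n) - Z n)"
      using ZZ[of "Suc n" n] by (simp add: algebra_simps)
    finally have "norm (Z (Suc (Suc n)) - Z (Suc n)) = norm ((Z (Suc n) + Z n) * (Z (Suc n) - Z n)) / 2"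
      by simp
    also have "\<dots> \<le> (sqrt_seq (Suc n) + sqrt_seq n) * (sqrt_seq (Suc n) - sqrt_seq n) / 2"
    proof -
      have "norm (Z (Suc n) + Z n) \<le> sqrt_seq (Suc n) + sqrt_seq n"
        using norm_triangle_ineq[of "Z (Suc n)" "Z n"] bound[of n] bound[of "Suc n"] by linarith
      then have "norm (Z (Suc n) + Z n) * norm (Z (Suc n) - Z n)
          \<le> (sqrt_seq (Suc n) + sqrt_seq n) * (sqrt_seq (Suc n) - sqrt_seq n)"
        using Suc.IH sqrt_seq_bounds[of n] sqrt_seq_bounds[of "Suc n"] by (intro mult_mono) (auto simp del: sqrt_seq.simps)
      then show ?thesis
        using norm_mult_ineq[of "Z (Suc n) + Z n" "Z (Suc n) - Z n"] by linarith
    qed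
    also have "\<dots> = ((sqrt_seq (Suc n))\<^sup>2 - (sqrt_seq n)\<^sup>2) / 2"
      by (simp add: power2_eq_square algebra_simps del: sqrt_seq.simps)
    also have "\<dots> = sqrt_seq (Suc (Suc n)) - sqrt_seq (Suc n)"
      unfolding sqrt_seq.simps(2)[of "Suc n"] sqrt_seq.simps(2)[of n, symmetric] by (simp add: field_simps)
    finally show ?case .
  qed
  have diff: "norm (Z (m + k) - Z m) \<le> sqrt_seq (m + k) - sqrt_seq m" for m k
  proof (induction k)
    case (Suc k)
    have "Z (m + Suc k) - Z m = (Z (Suc (m + k)) - Z (m + k)) + (Z (m + k) - Z m)" by simp
    then have "norm (Z (m + Suc k) - Z m) \<le> norm (Z (Suc (m + k)) - Z (m + k)) + norm (Z (m + k) - Z m)"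
      by (simp only: norm_triangle_ineq)
    then show ?case using Suc inc[of "m + k"] by simp
  qed simp
  have "Cauchy Z"
  proof (rule CauchyI')
    fix e :: real assume "0 < e"
    then obtain M where M: "\<forall>m\<ge>M. \<forall>n\<ge>m. sqrt_seq n - sqrt_seq m < e"
      using sqrt_seq_cauchy_bound by blast
    have "dist (Z m) (Z n) < e" if "m \<ge> M" "n > m" for m n
      using M[rule_format, of m n] diff[of m "n - m"] that by (simp add: dist_norm norm_minus_commute)
    then show "\<exists>M. \<forall>m\<ge>M. \<forall>n>m. dist (Z m) (Z n) < e" by blast
  qed
  then obtain Y where Y: "Z \<longlonglongrightarrow> Y" using Cauchy_convergent convergent_def by blast
  have "Y = (1/2) *\<^sub>R (x + Y * Y)"
  proof (rule LIMSEQ_unique[OF LIMSEQ_Suc[OF Y]])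
    show "(\<lambda>n. Z (Suc n)) \<longlonglongrightarrow> (1/2) *\<^sub>R (x + Y * Y)"
      unfolding ZS by (intro tendsto_intros Y)
  qed
  then have "2 *\<^sub>R Y = 2 *\<^sub>R ((1/2) *\<^sub>R (x + Y * Y))" by simp
  then have Y2: "Y + Y = x + Y * Y" by (simp add: scaleR_2)
  have "star Y = Y"
    using LIMSEQ_unique[OF bounded_linear.tendsto[OF bounded_linear_star Y]] Y by (simp add: sa)
  then have "star (1 - Y) = 1 - Y" by (simp add: star_diff star_one)
  moreover have "(1 - Y) * (1 - Y) = 1 - x" using Y2 by (simp add: algebra_simps)
  ultimately show ?thesis using that by blast
qed

text \<open>For nonzero \<open>a\<close>, \<open>star a * a\<close> divided by
  \<open>(norm a)^2\<close> is a self-adjoint contraction, so \<open>cstar_sqrt\<close> applies.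
  This positivity is what bounds left multiplication by \<open>a\<close> on the dilation
  space.\<close>

lemma norm_sq_minus_star_mult:
  fixes a :: "'a::unital_cstar_algebra"
  obtains c where "star c * c = scaleC (of_real ((norm a)\<^sup>2)) 1 - star a * a"
proof (cases "a = 0")
  case True
  then show ?thesis using that[of 0] by (simp add: star_zero scaleC_zero_left)
next
  case False
  define K where "K = (norm a)\<^sup>2"
  have K: "0 < K" using False by (simp add: K_def)
  define x where "x = (1 / K) *\<^sub>R (star a * a)"
  have "norm x \<le> 1" using K cstar_identity[of a] by (simp add: x_def K_def)
  moreover have "star x = x" by (simp add: x_def star_scaleR star_mult star_star)
  ultimately obtain c where c: "star c = c" "c * c = 1 - x" using cstar_sqrt by blast
  have "star (sqrt K *\<^sub>R c) * (sqrt K *\<^sub>R c) = K *\<^sub>R (1 - x)"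
    using c K by (simp add: star_scaleR)
  also have "\<dots> = scaleC (of_real K) 1 - star a * a"
    using K by (simp add: x_def scaleR_diff_right scaleC_of_real)
  finally show ?thesis using that unfolding K_def by blast
qed

section \<open>Positivity of forms and the Stinespring construction\<close>

lemma sum_lessThan_mult:
  fixes f :: "nat \<Rightarrow> 'b::comm_monoid_add"
  shows "(\<Sum>i<m * d. f i) = (\<Sum>p<m. \<Sum>s<d. f (p * d + s))"
proof -
  have "(\<Sum>i\<in>{p * d..<p * d + d}. f i) = (\<Sum>s<d. f (p * d + s))" for p
    using sum.shift_bounds_nat_ivl[of f 0 "p * d" d] by (simp add: lessThan_atLeast0 add.commute)
  then show ?thesis using sum.nat_group[of f d m] by simp
qed

text \<open>The index \<open>p * d + s\<close> is position \<open>s\<close> of block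
  \<open>p\<close>, which inverts the \<open>div\<close> and \<open>mod\<close> in
  \<open>ampliation\<close>.\<close>

lemma ampliation_form:
  assumes w: "w \<in> carrier_vec (m * d)"
  shows "(ampliation m d \<psi> X *\<^sub>v w) \<bullet>c w =
    (\<Sum>p<m. \<Sum>q<m. \<Sum>s<d. \<Sum>t<d. cnj (w $ (p * d + s)) * \<psi> (X $$ (p, q)) $$ (s, t) * w $ (q * d + t))"
proof -
  let ?M = "ampliation m d \<psi> X"
  have "(?M *\<^sub>v w) \<bullet>c w = (\<Sum>i<m*d. (\<Sum>j<m*d. ?M $$ (i, j) * w $ j) * cnj (w $ i))"
    using w by (simp add: scalar_prod_def ampliation_def lessThan_atLeast0)
  also have "\<dots> = (\<Sum>i<m*d. \<Sum>j<m*d. cnj (w $ i) * ?M $$ (i, j) * w $ j)"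
    by (simp add: sum_distrib_right sum_distrib_left mult_ac)
  also have "\<dots> = (\<Sum>p<m. \<Sum>s<d. \<Sum>q<m. \<Sum>t<d.
      cnj (w $ (p * d + s)) * \<psi> (X $$ (p, q)) $$ (s, t) * w $ (q * d + t))"
    unfolding sum_lessThan_mult
  proof (intro sum.cong refl)
    fix p s q t assume "p \<in> {..<m}" "s \<in> {..<d}" "q \<in> {..<m}" "t \<in> {..<d}"
    then have *: "p < m" "s < d" "q < m" "t < d" by auto
    have less: "p * d + s < m * d" if "p < m" "s < d" for p s
    proof -
      have "Suc p * d \<le> m * d" using that by (intro mult_le_mono1) simp
      then show ?thesis using that by simp
    qed
    show "cnj (w $ (p * d + s)) * ?M $$ (p * d + s, q * d + t) * w $ (q * d + t) =
      cnj (w $ (p * d + s)) * \<psi> (X $$ (p, q)) $$ (s, t) * w $ (q * d + t)"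
      using * less[OF *(1,2)] less[OF *(3,4)] by (simp add: ampliation_def)
  qed
  also have "\<dots> = (\<Sum>p<m. \<Sum>q<m. \<Sum>s<d. \<Sum>t<d.
      cnj (w $ (p * d + s)) * \<psi> (X $$ (p, q)) $$ (s, t) * w $ (q * d + t))"
  proof (rule sum.cong[OF refl])
    show "(\<Sum>s<d. \<Sum>q<m. \<Sum>t<d. cnj (w $ (p * d + s)) * \<psi> (X $$ (p, q)) $$ (s, t) * w $ (q * d + t)) =
      (\<Sum>q<m. \<Sum>s<d. \<Sum>t<d. cnj (w $ (p * d + s)) * \<psi> (X $$ (p, q)) $$ (s, t) * w $ (q * d + t))" for p
      by (rule sum.swap)
  qed
  finally show ?thesis .
qed

lemma star_mat_mult_index:
  assumes "Y \<in> carrier_mat m m" "p < m" "q < m"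
  shows "(star_mat Y * Y) $$ (p, q) = (\<Sum>k<m. star (Y $$ (k, p)) * Y $$ (k, q))"
  using assms by (simp add: star_mat_def scalar_prod_def lessThan_atLeast0)

text \<open>The matrix with entries \<open>star (a p) * a q\<close> is \<open>star_mat Y * Y\<close>
  for the \<open>Y\<close> whose first row is \<open>a\<close> and whose other rows vanish.\<close>

lemma completely_positive_form:
  fixes \<psi> :: "'a::unital_cstar_algebra \<Rightarrow> complex mat" and m :: nat
  assumes cp: "completely_positive d \<psi>"
  shows "0 \<le> (\<Sum>p<m. \<Sum>q<m. \<Sum>s<d. \<Sum>t<d. cnj (v p s) * \<psi> (star (a p) * a q) $$ (s, t) * v q t)"
proof (cases "m = 0")
  case False
  define Y where "Y = mat m m (\<lambda>(i, j). if i = 0 then a j else 0)"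
  define X where "X = star_mat Y * Y"
  have Yc: "Y \<in> carrier_mat m m" by (simp add: Y_def)
  have X: "X $$ (p, q) = star (a p) * a q" if "p < m" "q < m" for p q
  proof -
    have "X $$ (p, q) = (\<Sum>i<m. if i = 0 then star (a p) * a q else 0)"
      unfolding X_def star_mat_mult_index[OF Yc that]
      using that by (intro sum.cong) (auto simp: Y_def star_zero)
    then show ?thesis using False by simp
  qed
  have "positive_mat m X" using Yc unfolding positive_mat_def X_def by blast
  then have psd: "psd_mat (m * d) (ampliation m d \<psi> X)"
    using cp unfolding completely_positive_def by blast
  define w where "w = vec (m * d) (\<lambda>i. v (i div d) (i mod d))"
  have w: "w \<in> carrier_vec (m * d)" by (simp add: w_def)
  have less: "p * d + s < m * d" if "p < m" "s < d" for p s
  proof -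
    have "Suc p * d \<le> m * d" using that by (intro mult_le_mono1) simp
    then show ?thesis using that by simp
  qed
  have "(ampliation m d \<psi> X *\<^sub>v w) \<bullet>c w =
      (\<Sum>p<m. \<Sum>q<m. \<Sum>s<d. \<Sum>t<d. cnj (v p s) * \<psi> (star (a p) * a q) $$ (s, t) * v q t)"
    unfolding ampliation_form[OF w] by (intro sum.cong refl) (auto simp: w_def X less)
  then show ?thesis using psd w unfolding psd_mat_def by metis
qed simp

definition tuple_scale :: "complex \<Rightarrow> (nat \<Rightarrow> 'a::unital_cstar_algebra) \<Rightarrow> nat \<Rightarrow> 'a" where
  "tuple_scale c e = (\<lambda>p. scaleC c (e p))"

definition tuple_act :: "'a::unital_cstar_algebra \<Rightarrow> (nat \<Rightarrow> 'a) \<Rightarrow> nat \<Rightarrow> 'a" where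
  "tuple_act a e = (\<lambda>p. a * e p)"

text \<open>The Stinespring form on \<open>n\<close>-tuples over the algebra, with
  \<open>\<chi> a p q\<close> in the role of the entry \<open>(p, q)\<close> of a matrix-valued map.
  Tuples are functions on \<open>nat\<close>; what they do from index \<open>n\<close> on does not
  enter, so it amounts to a null vector.\<close>

definition tuple_form ::
    "nat \<Rightarrow> ('a::unital_cstar_algebra \<Rightarrow> nat \<Rightarrow> nat \<Rightarrow> complex) \<Rightarrow> (nat \<Rightarrow> 'a) \<Rightarrow> (nat \<Rightarrow> 'a) \<Rightarrow> complex" where
  "tuple_form n \<chi> e f = (\<Sum>p<n. \<Sum>q<n. \<chi> (star (f p) * e q) p q)"

lemma vector_space_tuple_scale: "vector_space tuple_scale"
  by unfold_locales (auto simp: tuple_scale_def fun_eq_iff scaleC_add_right scaleC_add_left scaleC_scaleC scaleC_one)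

locale positive_form =
  fixes n :: nat and \<chi> :: "'a::unital_cstar_algebra \<Rightarrow> nat \<Rightarrow> nat \<Rightarrow> complex"
  assumes form_add: "\<chi> (a + b) p q = \<chi> a p q + \<chi> b p q"
    and form_scaleC: "\<chi> (scaleC c a) p q = c * \<chi> a p q"
    and form_pos: "0 \<le> tuple_form n \<chi> e e"
begin

lemma tuple_form_left:
  "tuple_form n \<chi> (e + e') f = tuple_form n \<chi> e f + tuple_form n \<chi> e' f"
  "tuple_form n \<chi> (tuple_scale c e) f = c * tuple_form n \<chi> e f"
  by (simp_all add: tuple_form_def tuple_scale_def distrib_left form_add form_scaleC mult_scaleC_right
      sum.distrib sum_distrib_left)

lemma tuple_form_right:
  "tuple_form n \<chi> e (f + f') = tuple_form n \<chi> e f + tuple_form n \<chi> e f'"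
  "tuple_form n \<chi> e (tuple_scale c f) = cnj c * tuple_form n \<chi> e f"
  by (simp_all add: tuple_form_def tuple_scale_def distrib_right form_add form_scaleC mult_scaleC_left
      star_add star_scaleC sum.distrib sum_distrib_left)

text \<open>Hermitian symmetry follows by polarisation, because \<open>0 \<le> z\<close> for a
  complex \<open>z\<close> includes that \<open>z\<close> is real.\<close>

lemma tuple_form_cnj: "tuple_form n \<chi> f e = cnj (tuple_form n \<chi> e f)"
proof -
  have real: "Im (tuple_form n \<chi> e e) = 0" for e
    using form_pos[of e] by (simp add: less_eq_complex_def)
  have "Im (tuple_form n \<chi> e f) + Im (tuple_form n \<chi> f e) = 0"
    using real[of "e + f"] real[of e] real[of f] by (simp add: tuple_form_left tuple_form_right)
  moreover have "Re (tuple_form n \<chi> e f) = Re (tuple_form n \<chi> f e)"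
    using real[of "e + tuple_scale \<i> f"] real[of e] real[of f] by (simp add: tuple_form_left tuple_form_right)
  ultimately show ?thesis by (simp add: complex_eq_iff)
qed

sublocale semi_inner_type tuple_scale "tuple_form n \<chi>"
proof -
  show "semi_inner_type tuple_scale (tuple_form n \<chi>)"
  proof (intro semi_inner_type.intro semi_inner.intro vector_space_tuple_scale semi_inner_axioms.intro)
    show "0 \<le> Re (tuple_form n \<chi> e e)" for e using form_pos[of e] by (simp add: less_eq_complex_def)
  qed (auto simp: tuple_form_left intro: tuple_form_cnj)
qed

lemma tuple_form_act: "tuple_form n \<chi> (tuple_act (star a) e) f = tuple_form n \<chi> e (tuple_act a f)"
  by (simp add: tuple_form_def tuple_act_def star_mult mult.assoc)

lemma Re_of_real_mult: "Re (of_real r * z) = r * Re z"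
  by simp

text \<open>The functional \<open>h x = \<langle>x e, e\<rangle>\<close> is nonnegative on elements
  \<open>star b * b\<close>. Evaluating it at \<open>(norm a)^2 - star a * a\<close>, which is of
  this kind, bounds the squared norm of \<open>a e\<close>.\<close>

lemma nrm_tuple_act: "nrm (tuple_act a e) \<le> norm a * nrm e"
proof -
  obtain c where c: "star c * c = scaleC (of_real ((norm a)\<^sup>2)) 1 - star a * a"
    using norm_sq_minus_star_mult by blast
  define h where "h x = tuple_form n \<chi> (tuple_act x e) e" for x
  have h_self: "h (star b * b) = tuple_form n \<chi> (tuple_act b e) (tuple_act b e)" for b
  proof -
    have "tuple_act (star b) (tuple_act b e) = tuple_act (star b * b) e"
      by (simp add: tuple_act_def mult.assoc)
    then show ?thesis unfolding h_def using tuple_form_act[of b "tuple_act b e" e] by simp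
  qed
  have h_add: "h (x + y) = h x + h y" for x y
  proof -
    have "tuple_act (x + y) e = tuple_act x e + tuple_act y e"
      by (simp add: tuple_act_def fun_eq_iff distrib_right)
    then show ?thesis by (simp only: h_def tuple_form_left)
  qed
  have h_one: "h (scaleC k 1) = k * tuple_form n \<chi> e e" for k
  proof -
    have "tuple_act (scaleC k 1) e = tuple_scale k e"
      by (simp add: tuple_act_def tuple_scale_def fun_eq_iff mult_scaleC_left)
    then show ?thesis by (simp only: h_def tuple_form_left)
  qed
  have "h (star c * c) + h (star a * a) = of_real ((norm a)\<^sup>2) * tuple_form n \<chi> e e"
    unfolding c h_add[symmetric] h_one[symmetric] by simp
  then have *: "Re (h (star c * c)) + Re (h (star a * a)) = (norm a)\<^sup>2 * Re (tuple_form n \<chi> e e)"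
    unfolding Re_of_real_mult[symmetric] plus_complex.simps(1)[symmetric] by (rule arg_cong)
  then have "Re (tuple_form n \<chi> (tuple_act a e) (tuple_act a e)) \<le> (norm a)\<^sup>2 * Re (tuple_form n \<chi> e e)"
  proof -
    have "0 \<le> Re (h (star c * c))"
      unfolding h_self using form_pos[of "tuple_act c e"] by (simp only: less_eq_complex_def zero_complex.simps)
    then show ?thesis using * unfolding h_self[of a] by linarith
  qed
  then have "(nrm (tuple_act a e))\<^sup>2 \<le> (norm a * nrm e)\<^sup>2"
    unfolding power_mult_distrib nrm_sq[OF UNIV_I] .
  then show ?thesis by (rule power2_le_imp_le) (simp add: mult_nonneg_nonneg)
qed

lemma tuple_act_simps:
  "tuple_act a (x + y) = tuple_act a x + tuple_act a y"
  "tuple_act a (tuple_scale c x) = tuple_scale c (tuple_act a x)"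
  "tuple_act (a + b) x = tuple_act a x + tuple_act b x"
  "tuple_act (scaleC c a) x = tuple_scale c (tuple_act a x)"
  "tuple_act (a * b) x = tuple_act a (tuple_act b x)"
  "tuple_act 1 x = x"
  by (simp_all add: tuple_act_def tuple_scale_def fun_eq_iff distrib_left distrib_right
      mult_scaleC_left mult_scaleC_right mult.assoc)

lemmas tuple_star_rep = completion_star_rep[where \<alpha> = tuple_act and K = norm,
  OF tuple_act_simps(1,2) nrm_tuple_act tuple_form_act tuple_act_simps(3-6)]

end

text \<open>Entries outside the matrix are cut off to 0, because \<open>positive_form\<close>
  demands additivity for all indices, while out-of-range matrix entries are unspecified.\<close>

lemma UCP_form:
  assumes "\<phi> \<in> UCP n"
  shows "positive_form n (\<lambda>a p q. if p < n \<and> q < n then \<phi> a $$ (p, q) else 0)"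
proof
  have car: "\<phi> a \<in> carrier_mat n n" for a using assms by (simp add: UCP_def)
  have add: "\<phi> (a + b) = \<phi> a + \<phi> b" for a b using assms by (simp add: UCP_def)
  have sc: "\<phi> (scaleC c a) = c \<cdot>\<^sub>m \<phi> a" for c a using assms by (simp add: UCP_def)
  show "(if p < n \<and> q < n then \<phi> (a + b) $$ (p, q) else 0) =
    (if p < n \<and> q < n then \<phi> a $$ (p, q) else 0) + (if p < n \<and> q < n then \<phi> b $$ (p, q) else 0)" for a b p q
    using add[of a b] carrier_matD[OF car[of b]] by simp
  show "(if p < n \<and> q < n then \<phi> (scaleC c a) $$ (p, q) else 0) =
    c * (if p < n \<and> q < n then \<phi> a $$ (p, q) else 0)" for c a p q
    using sc[of c a] carrier_matD[OF car[of a]] by simp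
  fix e :: "nat \<Rightarrow> 'a"
  have "completely_positive n \<phi>" using assms by (simp add: UCP_def)
  \<comment> \<open>Standard basis vectors pick out the single entry \<open>(p, q)\<close>.\<close>
  from completely_positive_form[OF this, where m = n and v = "\<lambda>p s. if s = p then 1 else 0" and a = e]
  have "0 \<le> (\<Sum>p<n. \<Sum>q<n. \<Sum>s<n. if s = p then \<phi> (star (e p) * e q) $$ (s, q) else 0)"
    by (simp add: if_distrib[of cnj] if_distrib[of "\<lambda>x. x * _"] if_distrib[of "\<lambda>x. _ * x"] cong: if_cong)
  then show "0 \<le> tuple_form n (\<lambda>a p q. if p < n \<and> q < n then \<phi> a $$ (p, q) else 0) e e"
    by (simp add: tuple_form_def)
qed

lemma sum_fun_apply: "(\<Sum>i\<in>I. F i) x = (\<Sum>i\<in>I. F i x)"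
  by (induction I rule: infinite_finite_induct) simp_all

text \<open>The dilation space is the completion of tuples under \<open>tuple_form\<close>, and
  \<open>V i\<close> is the class of the tuple with 1 in place \<open>i\<close>. The last clause,
  minimality, holds because every tuple class is a sum of vectors \<open>\<pi> (e i) (V i)\<close>
  and these classes are dense.\<close>

lemma stinespring:
  fixes \<phi> :: "'a::unital_cstar_algebra \<Rightarrow> complex mat"
  assumes \<phi>: "\<phi> \<in> UCP n"
  obtains S ip \<pi> and V :: "nat \<Rightarrow> (nat \<Rightarrow> 'a) \<Rightarrow> complex"
  where "star_rep scaleF S ip (\<pi> :: 'a \<Rightarrow> _)" "\<And>i. V i \<in> S"
    "\<And>a i j. i < n \<Longrightarrow> j < n \<Longrightarrow> \<phi> a $$ (i, j) = ip (\<pi> a (V j)) (V i)"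
    "\<And>W. semi_inner.closed_subsp scaleF S ip W \<Longrightarrow> (\<And>a. \<pi> a ` W \<subseteq> W) \<Longrightarrow> (\<And>i. i < n \<Longrightarrow> V i \<in> W) \<Longrightarrow> W = S"
proof -
  define \<chi> where "\<chi> a p q = (if p < n \<and> q < n then \<phi> a $$ (p, q) else 0)" for a p q
  interpret positive_form n \<chi> unfolding \<chi>_def by (rule UCP_form[OF \<phi>])
  define \<delta> :: "nat \<Rightarrow> nat \<Rightarrow> 'a" where "\<delta> i p = (if p = i then 1 else 0)" for i p
  let ?\<pi> = "\<lambda>a f e. f (tuple_act (star a) e)"
  have zero: "\<chi> 0 p q = 0" for p q using form_scaleC[of 0 0 p q] by (simp add: scaleC_zero_left)
  have delta: "tuple_form n \<chi> (tuple_act a (\<delta> j)) f = (\<Sum>p<n. \<chi> (star (f p) * a) p j)" if "j < n" for a j f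
  proof -
    have "\<chi> (star (f p) * (a * \<delta> j q)) p q = (if q = j then \<chi> (star (f p) * a) p q else 0)" for p q
      by (simp add: \<delta>_def zero)
    then show ?thesis using that by (simp add: tuple_form_def tuple_act_def)
  qed
  show ?thesis
  proof (rule that[of completion ip_completion ?\<pi> "\<lambda>i. embed (\<delta> i)"])
    show "star_rep scaleF completion ip_completion ?\<pi>" by (rule tuple_star_rep)
    show "embed (\<delta> i) \<in> completion" for i by simp
    show "\<phi> a $$ (i, j) = ip_completion (?\<pi> a (embed (\<delta> j))) (embed (\<delta> i))" if "i < n" "j < n" for a i j
    proof -
      have "ip_completion (?\<pi> a (embed (\<delta> j))) (embed (\<delta> i)) = (\<Sum>p<n. \<chi> (star (\<delta> i p) * a) p j)"
        unfolding tuple_star_rep(2) ip_completion_embed delta[OF that(2)] ..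
      also have "\<dots> = (\<Sum>p<n. if p = i then \<chi> a p j else 0)"
        by (intro sum.cong refl) (simp add: \<delta>_def star_one star_zero zero)
      also have "\<dots> = \<phi> a $$ (i, j)" using that by (simp add: \<chi>_def)
      finally show ?thesis by simp
    qed
    fix W assume W: "completion.closed_subsp W" "\<And>a. ?\<pi> a ` W \<subseteq> W" "\<And>i. i < n \<Longrightarrow> embed (\<delta> i) \<in> W"
    have lin: "completion.linear_subspace W" using W(1) by (simp add: completion.closed_subsp_def)
    have emb: "embed e \<in> W" for e
    proof -
      have "embed (tuple_act (e i) (\<delta> i)) \<in> W" if "i < n" for i
        using subsetD[OF W(2) imageI[OF W(3)[OF that]], of "e i"] unfolding tuple_star_rep(2) .
      then have "(\<Sum>i<n. embed (tuple_act (e i) (\<delta> i))) \<in> W"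
        by (intro completion.linear_subspace_sum[OF lin]) auto
      also have "(\<Sum>i<n. embed (tuple_act (e i) (\<delta> i))) = embed e"
      proof
        fix f
        have "(\<Sum>i<n. embed (tuple_act (e i) (\<delta> i))) f = (\<Sum>i<n. embed (tuple_act (e i) (\<delta> i)) f)"
          by (rule sum_fun_apply)
        also have "\<dots> = (\<Sum>i<n. \<Sum>p<n. \<chi> (star (f p) * e i) p i)"
          by (intro sum.cong refl) (simp add: embed_def delta)
        also have "\<dots> = embed e f" unfolding embed_def tuple_form_def by (rule sum.swap)
        finally show "(\<Sum>i<n. embed (tuple_act (e i) (\<delta> i))) f = embed e f" .
      qed
      finally show ?thesis .
    qed
    have "f \<in> W" if f: "f \<in> completion" for f
    proof -
      obtain s where "completion.converges (\<lambda>n. embed (s n)) f" using completion_dense[OF f] by blast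
      then show ?thesis
        using W(1)[unfolded completion.closed_subsp_def, THEN conjunct2, rule_format, of "\<lambda>n. embed (s n)" f] f emb
        by simp
    qed
    then have "completion \<subseteq> W" by (intro subsetI)
    moreover have "W \<subseteq> completion" using completion.linear_subspaceD(1)[OF lin] by (intro subsetI)
    ultimately show "W = completion" by (rule equalityI[rotated])
  qed
qed

section \<open>Compressions and matrix extreme points\<close>

lemma mat_adjoint_eq: "mat_adjoint (A :: complex mat) = mat (dim_col A) (dim_row A) (\<lambda>(i, j). cnj (A $$ (j, i)))"
  unfolding mat_adjoint_def by (rule eq_matI) (auto simp: mat_of_rows_def)

lemma mat_adjoint_carrier [simp]: "A \<in> carrier_mat m n \<Longrightarrow> mat_adjoint (A :: complex mat) \<in> carrier_mat n m"
  by (simp add: mat_adjoint_eq)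

lemma mat_adjoint_adjoint: "mat_adjoint (mat_adjoint (A :: complex mat)) = A"
  by (rule eq_matI) (auto simp: mat_adjoint_eq)

lemma mat_adjoint_mult:
  fixes A B :: "complex mat"
  assumes "A \<in> carrier_mat k m" "B \<in> carrier_mat m n"
  shows "mat_adjoint (A * B) = mat_adjoint B * mat_adjoint A"
  using assms by (intro eq_matI) (auto simp: mat_adjoint_eq scalar_prod_def mult.commute)

lemma mat_adjoint_mult_index:
  fixes G M :: "complex mat"
  assumes "G \<in> carrier_mat r n" "M \<in> carrier_mat r r" "k < n" "l < n"
  shows "(mat_adjoint G * M * G) $$ (k, l) = (\<Sum>i<r. \<Sum>j<r. cnj (G $$ (i, k)) * M $$ (i, j) * G $$ (j, l))"
proof -
  have "(mat_adjoint G * M * G) $$ (k, l) = (\<Sum>j<r. (\<Sum>i<r. cnj (G $$ (i, k)) * M $$ (i, j)) * G $$ (j, l))"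
    using assms by (simp add: mat_adjoint_eq scalar_prod_def lessThan_atLeast0)
  also have "\<dots> = (\<Sum>i<r. \<Sum>j<r. cnj (G $$ (i, k)) * M $$ (i, j) * G $$ (j, l))"
    unfolding sum_distrib_right by (rule sum.swap)
  finally show ?thesis .
qed

lemma quadratic_form_sum:
  fixes A :: "complex mat"
  assumes "A \<in> carrier_mat n n" "v \<in> carrier_vec n"
  shows "(A *\<^sub>v v) \<bullet>c v = (\<Sum>k<n. \<Sum>l<n. cnj (v $ k) * A $$ (k, l) * v $ l)"
  using assms by (simp add: scalar_prod_def lessThan_atLeast0 sum_distrib_left sum_distrib_right mult_ac)

lemma mat_adjoint_inner:
  fixes B :: "complex mat"
  assumes "B \<in> carrier_mat m n" "x \<in> carrier_vec m" "y \<in> carrier_vec n"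
  shows "(mat_adjoint B *\<^sub>v x) \<bullet>c y = x \<bullet>c (B *\<^sub>v y)"
proof -
  have "(mat_adjoint B *\<^sub>v x) \<bullet>c y = (\<Sum>i<n. \<Sum>j<m. x $ j * cnj (B $$ (j, i)) * cnj (y $ i))"
    using assms by (simp add: mat_adjoint_eq scalar_prod_def lessThan_atLeast0 sum_distrib_right sum_distrib_left mult_ac)
  also have "\<dots> = (\<Sum>j<m. \<Sum>i<n. x $ j * cnj (B $$ (j, i)) * cnj (y $ i))"
    by (rule sum.swap)
  also have "\<dots> = x \<bullet>c (B *\<^sub>v y)"
    using assms by (simp add: scalar_prod_def lessThan_atLeast0 sum_distrib_left mult_ac)
  finally show ?thesis .
qed

lemma quadratic_form_adjoint:
  fixes B M :: "complex mat"
  assumes "B \<in> carrier_mat m n" "M \<in> carrier_mat m m" "v \<in> carrier_vec n"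
  shows "((mat_adjoint B * M * B) *\<^sub>v v) \<bullet>c v = (M *\<^sub>v (B *\<^sub>v v)) \<bullet>c (B *\<^sub>v v)"
proof -
  have "(mat_adjoint B * M * B) *\<^sub>v v = (mat_adjoint B * M) *\<^sub>v (B *\<^sub>v v)"
    by (rule assoc_mult_mat_vec[of _ n m _ n]) (use assms in \<open>auto intro!: mult_carrier_mat[of _ n m]\<close>)
  also have "\<dots> = mat_adjoint B *\<^sub>v (M *\<^sub>v (B *\<^sub>v v))"
    by (rule assoc_mult_mat_vec[of _ n m _ m]) (use assms in auto)
  finally have "((mat_adjoint B * M * B) *\<^sub>v v) \<bullet>c v = (mat_adjoint B *\<^sub>v (M *\<^sub>v (B *\<^sub>v v))) \<bullet>c v"
    by simp
  then show ?thesis using assms mat_adjoint_inner[of B m n "M *\<^sub>v (B *\<^sub>v v)" v] by simp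
qed

lemma surjective_mat_if_right_inverse:
  assumes "G \<in> carrier_mat r n" "C \<in> carrier_mat n r" "G * C = 1\<^sub>m r"
  shows "surjective_mat (G :: complex mat)"
proof -
  have "w \<in> (\<lambda>v. G *\<^sub>v v) ` carrier_vec n" if w: "w \<in> carrier_vec r" for w
  proof
    show "C *\<^sub>v w \<in> carrier_vec n" using assms w by simp
    show "w = G *\<^sub>v (C *\<^sub>v w)" using assms w by (simp flip: assoc_mult_mat_vec)
  qed
  then show ?thesis using assms unfolding surjective_mat_def by auto
qed

lemma matrix_extreme_pointD:
  assumes "matrix_extreme_point n \<phi>"
    "\<And>i. i < k \<Longrightarrow> 0 < d i" "\<And>i. i < k \<Longrightarrow> \<psi> i \<in> UCP (d i)" "\<And>i. i < k \<Longrightarrow> \<gamma> i \<in> carrier_mat (d i) n"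
    "\<And>i. i < k \<Longrightarrow> surjective_mat (\<gamma> i)"
    "mat_sum n k (\<lambda>i. mat_adjoint (\<gamma> i) * \<gamma> i) = 1\<^sub>m n"
    "\<And>a. \<phi> a = mat_sum n k (\<lambda>i. mat_adjoint (\<gamma> i) * \<psi> i a * \<gamma> i)" "i < k"
  shows "d i = n" "\<exists>u. unitary_mat n u \<and> (\<forall>a. \<phi> a = mat_adjoint u * \<psi> i a * u)"
  using assms unfolding matrix_extreme_point_def by blast+

lemma UCP_D:
  assumes "\<phi> \<in> UCP n"
  shows "\<phi> a \<in> carrier_mat n n" "\<phi> (a + b) = \<phi> a + \<phi> b" "\<phi> (scaleC c a) = c \<cdot>\<^sub>m \<phi> a" "\<phi> 1 = 1\<^sub>m n"
    "completely_positive n \<phi>"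
  using assms by (auto simp: UCP_def)

section \<open>Gram-Schmidt orthonormalisation\<close>

context hilbert
begin

definition orthonormal :: "(nat \<Rightarrow> 'v) \<Rightarrow> nat \<Rightarrow> bool" where
  "orthonormal w r \<longleftrightarrow> (\<forall>i<r. w i \<in> S) \<and> (\<forall>i<r. \<forall>j<r. ip (w i) (w j) = (if i = j then 1 else 0))"

text \<open>For orthonormal \<open>w\<close>, the orthogonal projection onto the span of the first
  \<open>r\<close> vectors; \<open>fourier w r x = x\<close> is how membership in that span is
  expressed.\<close>

definition fourier :: "(nat \<Rightarrow> 'v) \<Rightarrow> nat \<Rightarrow> 'v \<Rightarrow> 'v" where
  "fourier w r x = (\<Sum>i<r. sc (ip x (w i)) (w i))"

lemma fourier_S: "orthonormal w r \<Longrightarrow> fourier w r x \<in> S"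
  unfolding fourier_def orthonormal_def by (intro S_sum) auto

lemma ip_fourier:
  assumes w: "orthonormal w r" and i: "i < r"
  shows "ip (fourier w r x) (w i) = ip x (w i)"
proof -
  have "ip (fourier w r x) (w i) = (\<Sum>j<r. ip (sc (ip x (w j)) (w j)) (w i))"
    unfolding fourier_def using w i by (intro ip_sum_left) (auto simp: orthonormal_def)
  also have "\<dots> = (\<Sum>j<r. if j = i then ip x (w i) else 0)"
    using w i by (intro sum.cong refl) (auto simp: orthonormal_def ip_sc_left)
  finally show ?thesis using i by simp
qed

text \<open>One Gram-Schmidt step: the nonzero remainder \<open>q\<close> is orthogonal to the old
  vectors, so normalising it keeps the family orthonormal and the old span is retained.\<close>

lemma orthonormal_extend:
  assumes w: "orthonormal w r" and x: "x \<in> S" and q: "q = x - fourier w r x" "q \<noteq> 0"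
  shows "orthonormal (w(r := sc (of_real (1 / nrm q)) q)) (Suc r)" (is "orthonormal ?w _")
    and "fourier (w(r := sc (of_real (1 / nrm q)) q)) (Suc r) x = x"
    and "y \<in> S \<Longrightarrow> fourier w r y = y \<Longrightarrow> fourier (w(r := sc (of_real (1 / nrm q)) q)) (Suc r) y = y"
proof -
  have F: "fourier w r y \<in> S" for y by (rule fourier_S[OF w])
  have wS: "w i \<in> S" if "i < r" for i using w that by (auto simp: orthonormal_def)
  have qS: "q \<in> S" using x F q(1) by simp
  have n: "nrm q \<noteq> 0" using q(2) qS by simp
  have qw: "ip q (w i) = 0" if "i < r" for i
    using ip_fourier[OF w that, of x] that x F wS unfolding q(1) by (simp add: ip_diff_left)
  have wq: "ip (w i) q = 0" if "i < r" for i using qw[OF that] ip_cnj[OF qS wS[OF that]] by simp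
  have Fq: "ip (fourier w r y) q = 0" for y
    unfolding fourier_def using wS qS wq by (subst ip_sum_left) (auto simp: ip_sc_left)
  have "ip (sc c q) (sc c q) = c * cnj c * ip q q" for c
    using qS by (simp add: ip_sc_left ip_sc_right)
  then have "ip (sc (of_real (1 / nrm q)) q) (sc (of_real (1 / nrm q)) q) = 1"
    unfolding ip_self[OF qS] using n by (simp add: power2_eq_square)
  then show "orthonormal ?w (Suc r)"
    using w qS qw wq wS unfolding orthonormal_def less_Suc_eq
    by (auto simp: ip_sc_left ip_sc_right)
  have step: "fourier ?w (Suc r) y = fourier w r y + sc (ip y (sc (of_real (1 / nrm q)) q)) (sc (of_real (1 / nrm q)) q)" for y
    by (simp add: fourier_def)
  show "fourier ?w (Suc r) y = y" if "y \<in> S" "fourier w r y = y" for y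
  proof -
    have "ip y q = 0" using Fq[of y] that(2) by simp
    then show ?thesis unfolding step ip_sc_right[OF that(1) qS] using that by simp
  qed
  have "ip x q = ip q q"
    using Fq[of x] x qS F unfolding q(1) by (simp add: ip_diff_left)
  then have "sc (ip x (sc (of_real (1 / nrm q)) q)) (sc (of_real (1 / nrm q)) q) = q"
    unfolding ip_sc_right[OF x qS] ip_self[OF qS] using n by (simp add: scale_scale power2_eq_square)
  then show "fourier ?w (Suc r) x = x" unfolding step using q(1) by simp
qed

text \<open>Dependent vectors are skipped, so \<open>r\<close> may be smaller than \<open>k\<close>.
  The coefficients expressing \<open>w i\<close> through the \<open>p j\<close> are recorded because
  they later form a right inverse of the coordinate matrix.\<close>

lemma gram_schmidt:
  fixes k :: nat
  assumes "\<And>j. j < k \<Longrightarrow> p j \<in> S"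
  shows "\<exists>r w. orthonormal w r \<and> (\<forall>i<r. \<exists>c. w i = (\<Sum>j<k. sc (c j) (p j))) \<and> (\<forall>j<k. fourier w r (p j) = p j)"
  using assms
proof (induction k)
  case 0
  show ?case by (intro exI[of _ 0] exI[of _ "\<lambda>_. 0"]) (simp add: orthonormal_def)
next
  case (Suc k)
  then obtain r w where w: "orthonormal w r" and lc: "\<And>i. i < r \<Longrightarrow> \<exists>c. w i = (\<Sum>j<k. sc (c j) (p j))"
    and fo: "\<And>j. j < k \<Longrightarrow> fourier w r (p j) = p j"
    by (metis less_SucI)
  have pk: "p k \<in> S" using Suc.prems by simp
  have lc': "\<exists>c. w i = (\<Sum>j<Suc k. sc (c j) (p j))" if i: "i < r" for i
  proof -
    obtain c where c: "w i = (\<Sum>j<k. sc (c j) (p j))" using lc[OF i] by blast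
    have "(\<Sum>j<Suc k. sc ((c(k := 0)) j) (p j)) = (\<Sum>j<k. sc (c j) (p j))"
      by (simp add: sum.lessThan_Suc)
    then show ?thesis using c by metis
  qed
  define q where "q = p k - fourier w r (p k)"
  show ?case
  proof (cases "q = 0")
    case True
    then have "fourier w r (p k) = p k" by (simp add: q_def)
    then show ?thesis using w lc' fo by (intro exI[of _ r] exI[of _ w]) (auto simp: less_Suc_eq)
  next
    case False
    let ?w = "w(r := sc (of_real (1 / nrm q)) q)"
    note ext = orthonormal_extend[OF w pk q_def False]
    obtain c where c: "\<And>i. i < r \<Longrightarrow> w i = (\<Sum>j<k. sc (c i j) (p j))" using lc by metis
    define g :: complex where "g = of_real (1 / nrm q)"
    \<comment> \<open>Coefficients of the normalised remainder: the projection of \<open>p k\<close>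
      is rewritten through the \<open>p j\<close> with \<open>j < k\<close>, and \<open>p k\<close>
      itself gets \<open>g\<close>.\<close>
    define e where "e j = (if j = k then g else - g * (\<Sum>i<r. ip (p k) (w i) * c i j))" for j
    have "fourier w r (p k) = (\<Sum>i<r. \<Sum>j<k. sc (ip (p k) (w i) * c i j) (p j))"
      unfolding fourier_def using c by (intro sum.cong refl) (simp add: scale_sum_right)
    also have "\<dots> = (\<Sum>j<k. sc (\<Sum>i<r. ip (p k) (w i) * c i j) (p j))"
      unfolding scale_sum_left by (rule sum.swap)
    finally have F: "fourier w r (p k) = (\<Sum>j<k. sc (\<Sum>i<r. ip (p k) (w i) * c i j) (p j))" .
    have "sc g q = sc g (p k - (\<Sum>j<k. sc (\<Sum>i<r. ip (p k) (w i) * c i j) (p j)))"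
      unfolding F[symmetric] q_def ..
    also have "\<dots> = (\<Sum>j<Suc k. sc (e j) (p j))"
      by (simp add: e_def scale_right_diff_distrib scale_sum_right sum_negf)
    finally have "sc (of_real (1 / nrm q)) q = (\<Sum>j<Suc k. sc (e j) (p j))" unfolding g_def .
    then have "\<exists>c. ?w i = (\<Sum>j<Suc k. sc (c j) (p j))" if "i < Suc r" for i
      using that lc'[of i] by (cases "i = r") auto
    moreover have "fourier ?w (Suc r) (p j) = p j" if "j < Suc k" for j
      using that ext(2) ext(3)[of "p j"] fo[of j] Suc.prems[of j] by (cases "j = k") auto
    ultimately show ?thesis using ext(1) by blast
  qed
qed

text \<open>Extend as long as some vector lies outside the span. The strict \<open>r' < r\<close>
  turns the absence of \<open>N + 1\<close> orthonormal vectors into a spanning family of at most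
  \<open>N\<close>.\<close>

lemma orthonormal_or_spanning:
  "(\<exists>w. orthonormal w r) \<or> (\<exists>r'<r. \<exists>w. orthonormal w r' \<and> (\<forall>x\<in>S. fourier w r' x = x))"
proof (induction r)
  case 0 show ?case by (auto simp: orthonormal_def)
next
  case (Suc r)
  then consider w where "orthonormal w r" | "\<exists>r'<r. \<exists>w. orthonormal w r' \<and> (\<forall>x\<in>S. fourier w r' x = x)" by blast
  then show ?case
  proof cases
    case 1
    show ?thesis
    proof (cases "\<forall>x\<in>S. fourier w r x = x")
      case True then show ?thesis using 1 by blast
    next
      case False
      then obtain x where "x \<in> S" "x - fourier w r x \<noteq> 0" by auto
      then show ?thesis using orthonormal_extend(1)[OF 1 _ refl] by blast
    qed
  next
    case 2 then show ?thesis using less_SucI by blast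
  qed
qed

end

section \<open>Compressions of a representation to finitely many orthonormal vectors\<close>

context star_rep
begin

definition compression :: "(nat \<Rightarrow> 'v) \<Rightarrow> nat \<Rightarrow> 'a \<Rightarrow> complex mat" where
  "compression w r a = mat r r (\<lambda>(i, j). ip (\<pi> a (w j)) (w i))"

lemma ip_rep_sum:
  assumes "\<And>i. i < m \<Longrightarrow> x i \<in> S" "\<And>j. j < n \<Longrightarrow> y j \<in> S"
  shows "ip (\<pi> a (\<Sum>j<n. sc (c j) (y j))) (\<Sum>i<m. sc (b i) (x i)) =
    (\<Sum>i<m. \<Sum>j<n. cnj (b i) * ip (\<pi> a (y j)) (x i) * c j)"
proof -
  have 1: "\<pi> a (\<Sum>j<n. sc (c j) (y j)) = (\<Sum>j<n. sc (c j) (\<pi> a (y j)))"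
    using assms by (subst rep_sum) (auto simp: rep_lin)
  have "ip (\<pi> a (\<Sum>j<n. sc (c j) (y j))) (\<Sum>i<m. sc (b i) (x i)) =
     (\<Sum>i<m. ip (\<Sum>j<n. sc (c j) (\<pi> a (y j))) (sc (b i) (x i)))"
    unfolding 1 using assms by (intro ip_sum_right S_sum) auto
  also have "\<dots> = (\<Sum>i<m. \<Sum>j<n. ip (sc (c j) (\<pi> a (y j))) (sc (b i) (x i)))"
    using assms by (intro sum.cong refl ip_sum_left) auto
  also have "\<dots> = (\<Sum>i<m. \<Sum>j<n. cnj (b i) * ip (\<pi> a (y j)) (x i) * c j)"
    using assms by (intro sum.cong refl) (auto simp: ip_simps mult_ac)
  finally show ?thesis .
qed

text \<open>For \<open>X = star_mat Y * Y\<close> the quadratic form is the sum of the squared norms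
  of the \<open>z k\<close>, where \<open>z k\<close> is row \<open>k\<close> of the operator matrix
  of \<open>Y\<close> applied to the vectors \<open>x q\<close>.\<close>

lemma compression_UCP:
  assumes w: "orthonormal w r"
  shows "compression w r \<in> UCP r"
proof -
  have wS: "w i \<in> S" if "i < r" for i using w that by (simp add: orthonormal_def)
  have "0 \<le> (ampliation m r (compression w r) X *\<^sub>v v) \<bullet>c v"
    if X: "positive_mat m X" and v: "v \<in> carrier_vec (m * r)" for m X v
  proof -
    obtain Y where Y: "Y \<in> carrier_mat m m" "X = star_mat Y * Y" using X unfolding positive_mat_def by blast
    define x where "x p = (\<Sum>s<r. sc (v $ (p * r + s)) (w s))" for p
    have xS: "x p \<in> S" for p unfolding x_def using wS by (intro S_sum) auto
    define z where "z k = (\<Sum>q<m. \<pi> (Y $$ (k, q)) (x q))" for k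
    have zS: "z k \<in> S" for k unfolding z_def using xS by (intro S_sum) auto
    have rep_sum_alg: "\<pi> (\<Sum>k<m. f k) y = (\<Sum>k<m. \<pi> (f k) y)" if "y \<in> S" for f y and m :: nat
    proof (induction m)
      case 0 show ?case using rep_scaleC[OF that, of 0 0] by (simp add: scaleC_zero_left)
    qed (use that in \<open>simp add: rep_add\<close>)
    have "(ampliation m r (compression w r) X *\<^sub>v v) \<bullet>c v =
      (\<Sum>p<m. \<Sum>q<m. \<Sum>s<r. \<Sum>t<r. cnj (v $ (p * r + s)) * ip (\<pi> (X $$ (p, q)) (w t)) (w s) * v $ (q * r + t))"
      unfolding ampliation_form[OF v] by (intro sum.cong refl) (auto simp: compression_def)
    also have "\<dots> = (\<Sum>p<m. \<Sum>q<m. ip (\<pi> (X $$ (p, q)) (x q)) (x p))"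
      unfolding x_def by (intro sum.cong refl) (simp add: ip_rep_sum wS)
    also have "\<dots> = (\<Sum>p<m. \<Sum>q<m. \<Sum>k<m. ip (\<pi> (Y $$ (k, q)) (x q)) (\<pi> (Y $$ (k, p)) (x p)))"
    proof (intro sum.cong refl)
      fix p q assume "p \<in> {..<m}" "q \<in> {..<m}"
      then have "X $$ (p, q) = (\<Sum>k<m. star (Y $$ (k, p)) * Y $$ (k, q))"
        using star_mat_mult_index[OF Y(1)] Y(2) by simp
      then have "\<pi> (X $$ (p, q)) (x q) = (\<Sum>k<m. \<pi> (star (Y $$ (k, p)) * Y $$ (k, q)) (x q))"
        using rep_sum_alg[OF xS] by simp
      then have "ip (\<pi> (X $$ (p, q)) (x q)) (x p) = (\<Sum>k<m. ip (\<pi> (star (Y $$ (k, p)) * Y $$ (k, q)) (x q)) (x p))"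
        using xS by (simp add: ip_sum_left)
      then show "ip (\<pi> (X $$ (p, q)) (x q)) (x p) = (\<Sum>k<m. ip (\<pi> (Y $$ (k, q)) (x q)) (\<pi> (Y $$ (k, p)) (x p)))"
        using xS by (simp add: rep_mult rep_star)
    qed
    also have "\<dots> = (\<Sum>p<m. \<Sum>k<m. \<Sum>q<m. ip (\<pi> (Y $$ (k, q)) (x q)) (\<pi> (Y $$ (k, p)) (x p)))"
      by (intro sum.cong refl sum.swap)
    also have "\<dots> = (\<Sum>k<m. \<Sum>p<m. \<Sum>q<m. ip (\<pi> (Y $$ (k, q)) (x q)) (\<pi> (Y $$ (k, p)) (x p)))"
      by (rule sum.swap)
    also have "\<dots> = (\<Sum>k<m. ip (z k) (z k))"
    proof (intro sum.cong refl)
      fix k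
      have "ip (z k) (z k) = (\<Sum>p<m. ip (z k) (\<pi> (Y $$ (k, p)) (x p)))"
        by (subst (2) z_def) (use zS xS in \<open>simp add: ip_sum_right\<close>)
      also have "\<dots> = (\<Sum>p<m. \<Sum>q<m. ip (\<pi> (Y $$ (k, q)) (x q)) (\<pi> (Y $$ (k, p)) (x p)))"
        unfolding z_def using xS by (intro sum.cong refl) (simp add: ip_sum_left)
      finally show "(\<Sum>p<m. \<Sum>q<m. ip (\<pi> (Y $$ (k, q)) (x q)) (\<pi> (Y $$ (k, p)) (x p))) = ip (z k) (z k)" by simp
    qed
    also have "0 \<le> \<dots>"
      using zS by (intro sum_nonneg) (simp add: ip_self less_eq_complex_def)
    finally show ?thesis .
  qed
  then have "completely_positive r (compression w r)"
    unfolding completely_positive_def psd_mat_def by (auto simp: ampliation_def)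
  moreover have "compression w r 1 = 1\<^sub>m r"
    using w by (intro eq_matI) (auto simp: compression_def orthonormal_def rep_one)
  moreover have "compression w r (a + b) = compression w r a + compression w r b" for a b
    using wS by (intro eq_matI) (auto simp: compression_def rep_add ip_add_left)
  moreover have "compression w r (scaleC c a) = c \<cdot>\<^sub>m compression w r a" for c a
    using wS by (intro eq_matI) (auto simp: compression_def rep_scaleC ip_sc_left)
  ultimately show ?thesis unfolding UCP_def by (simp add: compression_def)
qed

text \<open>\<open>G\<close> holds the coordinates of the \<open>p j\<close> in an orthonormal basis
  of their span, and \<open>C\<close> witnesses its surjectivity. The clause for
  \<open>r = 0\<close> is there because levels must be positive; the last one transfers injectivity
  of \<open>G\<close> to the map with columns \<open>p j\<close>.\<close>

lemma factor_through_compression: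
  assumes p: "\<And>j. j < n \<Longrightarrow> p j \<in> S"
  shows "\<exists>r \<psi> G C. \<psi> \<in> UCP r \<and> G \<in> carrier_mat r n \<and> C \<in> carrier_mat n r \<and> G * C = 1\<^sub>m r \<and>
    (\<forall>a. \<forall>k<n. \<forall>l<n. (mat_adjoint G * \<psi> a * G) $$ (k, l) = ip (\<pi> a (p l)) (p k)) \<and>
    (r = 0 \<longrightarrow> (\<forall>j<n. p j = 0)) \<and>
    (\<forall>v\<in>carrier_vec n. (\<Sum>j<n. sc (v $ j) (p j)) = 0 \<longrightarrow> G *\<^sub>v v = 0\<^sub>v r)"
proof -
  obtain r w where w: "orthonormal w r" and "\<forall>i<r. \<exists>c. w i = (\<Sum>j<n. sc (c j) (p j))"
    and fo: "\<And>j. j < n \<Longrightarrow> fourier w r (p j) = p j"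
    using gram_schmidt[of n p] p by metis
  then obtain c where c: "\<And>i. i < r \<Longrightarrow> w i = (\<Sum>j<n. sc (c i j) (p j))" by metis
  have wS: "w i \<in> S" if "i < r" for i using w that by (simp add: orthonormal_def)
  define G where "G = mat r n (\<lambda>(i, j). ip (p j) (w i))"
  define C where "C = mat n r (\<lambda>(j, i). c i j)"
  have lin: "ip (\<Sum>j<n. sc (b j) (p j)) (w i) = (\<Sum>j<n. ip (p j) (w i) * b j)" if "i < r" for b i
    using p wS[OF that] by (subst ip_sum_left) (auto simp: ip_sc_left mult.commute)
  show ?thesis
  proof (rule exI[of _ r], rule exI[of _ "compression w r"], rule exI[of _ G], rule exI[of _ C],
      intro conjI allI impI ballI)
    show "compression w r \<in> UCP r" by (rule compression_UCP[OF w])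
    show "G \<in> carrier_mat r n" "C \<in> carrier_mat n r" by (simp_all add: G_def C_def)
    show "G * C = 1\<^sub>m r"
    proof (rule eq_matI)
      fix i l assume "i < dim_row (1\<^sub>m r :: complex mat)" "l < dim_col (1\<^sub>m r :: complex mat)"
      then have il: "i < r" "l < r" by auto
      have "(G * C) $$ (i, l) = (\<Sum>j<n. ip (p j) (w i) * c l j)"
        using il by (simp add: G_def C_def scalar_prod_def lessThan_atLeast0)
      also have "\<dots> = ip (w l) (w i)" using lin[OF il(1), of "c l"] c[OF il(2)] by simp
      finally show "(G * C) $$ (i, l) = 1\<^sub>m r $$ (i, l)" using w il by (simp add: orthonormal_def)
    qed (simp_all add: G_def C_def)
    show "(mat_adjoint G * compression w r a * G) $$ (k, l) = ip (\<pi> a (p l)) (p k)" if kl: "k < n" "l < n" for a k l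
    proof -
      have "(mat_adjoint G * compression w r a * G) $$ (k, l) =
        (\<Sum>i<r. \<Sum>j<r. cnj (ip (p k) (w i)) * ip (\<pi> a (w j)) (w i) * ip (p l) (w j))"
        using kl by (subst mat_adjoint_mult_index[of _ r n]) (auto simp: G_def compression_def)
      also have "\<dots> = ip (\<pi> a (fourier w r (p l))) (fourier w r (p k))"
        unfolding fourier_def by (simp add: ip_rep_sum wS)
      finally show ?thesis using fo kl by simp
    qed
    show "p j = 0" if "r = 0" "j < n" for j using fo[OF that(2)] that(1) by (simp add: fourier_def)
    show "G *\<^sub>v v = 0\<^sub>v r" if "v \<in> carrier_vec n" "(\<Sum>j<n. sc (v $ j) (p j)) = 0" for v
    proof (rule eq_vecI)
      fix i assume "i < dim_vec (0\<^sub>v r :: complex vec)"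
      then have i: "i < r" by simp
      have "(G *\<^sub>v v) $ i = (\<Sum>j<n. ip (p j) (w i) * v $ j)"
        using i that(1) by (simp add: G_def scalar_prod_def lessThan_atLeast0)
      also have "\<dots> = 0" using lin[OF i, of "\<lambda>j. v $ j"] that(2) wS[OF i] by simp
      finally show "(G *\<^sub>v v) $ i = 0\<^sub>v r $ i" using i by simp
    qed (simp add: G_def)
  qed
qed

end

section \<open>From a matrix extreme point to an irreducible dilation\<close>

lemma mult_conj_cancel:
  fixes H u U M G :: "complex mat"
  assumes "H \<in> carrier_mat n n" "u \<in> carrier_mat n n" "U \<in> carrier_mat n n" "M \<in> carrier_mat n n"
    "G \<in> carrier_mat n n" and uU: "u * U = 1\<^sub>m n"
  shows "(H * u) * (U * M * u) * (U * G) = H * M * G"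
proof -
  have c: "X * Y \<in> carrier_mat n n" if "X \<in> carrier_mat n n" "Y \<in> carrier_mat n n" for X Y :: "complex mat"
    using that by (rule mult_carrier_mat)
  have a: "X * Y * Z = X * (Y * Z)"
    if "X \<in> carrier_mat n n" "Y \<in> carrier_mat n n" "Z \<in> carrier_mat n n" for X Y Z :: "complex mat"
    using that by (rule assoc_mult_mat)
  have "u * (U * Z) = Z" if "Z \<in> carrier_mat n n" for Z
    using a[OF assms(2,3) that] that uU by simp
  then show ?thesis using assms(1-5) by (simp add: a c)
qed

text \<open>The setting that \<open>stinespring\<close> produces for an extreme
  \<open>\<phi>\<close>; \<open>generates\<close> is minimality of the dilation.\<close>

locale dilation = star_rep sc S ip \<pi>
  for sc :: "complex \<Rightarrow> 'v::ab_group_add \<Rightarrow> 'v" and S ip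
    and \<pi> :: "'a::unital_cstar_algebra \<Rightarrow> 'v \<Rightarrow> 'v" +
  fixes n :: nat and \<phi> :: "'a \<Rightarrow> complex mat" and V :: "nat \<Rightarrow> 'v"
  assumes ext: "matrix_extreme_point n \<phi>"
    and V_S: "V i \<in> S"
    and \<phi>_eq: "i < n \<Longrightarrow> j < n \<Longrightarrow> \<phi> a $$ (i, j) = ip (\<pi> a (V j)) (V i)"
    and generates: "closed_subsp W \<Longrightarrow> (\<And>a. \<pi> a ` W \<subseteq> W) \<Longrightarrow> (\<And>i. i < n \<Longrightarrow> V i \<in> W) \<Longrightarrow> W = S"
begin

lemma n_pos: "0 < n" and \<phi>_UCP: "\<phi> \<in> UCP n"
  using ext by (auto simp: matrix_extreme_point_def)

lemma orthonormal_V: "orthonormal V n"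
proof -
  have "ip (V j) (V i) = (if i = j then 1 else 0)" if "i < n" "j < n" for i j
    using \<phi>_eq[OF that, of 1] UCP_D(4)[OF \<phi>_UCP] that V_S by (simp add: rep_one)
  then show ?thesis using V_S unfolding orthonormal_def by auto
qed

lemma comb_V_eq_0:
  assumes v: "v \<in> carrier_vec n" and 0: "(\<Sum>j<n. sc (v $ j) (V j)) = 0"
  shows "v = 0\<^sub>v n"
proof (rule eq_vecI)
  fix i assume "i < dim_vec (0\<^sub>v n :: complex vec)"
  then have i: "i < n" by simp
  have "ip (\<Sum>j<n. sc (v $ j) (V j)) (V i) = (\<Sum>j<n. if j = i then v $ i else 0)"
  proof -
    have "ip (\<Sum>j<n. sc (v $ j) (V j)) (V i) = (\<Sum>j<n. ip (sc (v $ j) (V j)) (V i))"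
      using V_S by (intro ip_sum_left) auto
    also have "\<dots> = (\<Sum>j<n. if j = i then v $ i else 0)"
      using V_S orthonormal_V i unfolding orthonormal_def
      by (intro sum.cong refl) (auto simp: ip_sc_left)
    finally show ?thesis .
  qed
  then show "v $ i = 0\<^sub>v n $ i" using 0 i V_S by simp
qed (use v in simp)

text \<open>If \<open>P\<close> is a projection commuting with the representation, both parts \<open>V\<^sup>* P \<pi> V\<close> and
  \<open>V\<^sup>* (1 - P) \<pi> V\<close> factor through compressions, so \<open>\<phi>\<close> is a matrix convex combination of
  two points; extremality forces \<open>P V\<close> and \<open>(1 - P) V\<close> to be injective.\<close>

lemma invariant_subspace_splitting:
  assumes W: "closed_subsp W" "\<And>a. \<pi> a ` W \<subseteq> W" "W \<noteq> {0}" "W \<noteq> S"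
    and p: "\<And>j. p j \<in> W" "\<forall>j. \<forall>d\<in>W. ip d (V j - p j) = 0"
  shows "\<exists>\<delta>. \<delta> \<in> carrier_mat n n \<and>
    (\<forall>a. \<forall>k<n. \<forall>l<n. (mat_adjoint \<delta> * \<phi> a * \<delta>) $$ (k, l) = ip (\<pi> a (p l)) (p k)) \<and>
    (\<forall>v\<in>carrier_vec n. (\<Sum>j<n. sc (v $ j) (p j)) = 0 \<longrightarrow> v = 0\<^sub>v n) \<and>
    (\<forall>v\<in>carrier_vec n. (\<Sum>j<n. sc (v $ j) (V j - p j)) = 0 \<longrightarrow> v = 0\<^sub>v n)"
proof -
  have lin: "linear_subspace W" using W(1) by (simp add: closed_subsp_def)
  note WD = linear_subspaceD[OF lin]
  define q where "q j = V j - p j" for j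
  have pS: "p j \<in> S" for j using p(1) WD(1) by blast
  have qS: "q j \<in> S" for j using pS V_S by (simp add: q_def)
  have qW: "ip d (q j) = 0" "ip (q j) d = 0" if "d \<in> W" for d j
    using p(2)[rule_format, OF that] ip_cnj[OF WD(1)[OF that] qS, of j] by (auto simp: q_def)
  have piW: "\<pi> a d \<in> W" if "d \<in> W" for a d using W(2) that by blast
  \<comment> \<open>Otherwise every \<open>V j\<close> is orthogonal to \<open>W\<close>, and
    minimality makes the complement of \<open>W\<close> everything. Nonzero parts give the positive
    levels that extremality asks for.\<close>
  have p_nz: "\<exists>j<n. p j \<noteq> 0"
  proof (rule ccontr)
    assume "\<not> (\<exists>j<n. p j \<noteq> 0)"
    then have VP: "V j \<in> perp W" if "j < n" for j
    proof -
      have "V j = q j" using \<open>\<not> (\<exists>j<n. p j \<noteq> 0)\<close> that by (simp add: q_def)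
      then show ?thesis using qW(2) qS by (simp add: perp_def)
    qed
    have WS: "W \<subseteq> S" using WD(1) by (rule subsetI)
    have pS: "perp W = S"
      by (rule generates[OF closed_perp[OF WS] invariant_perp[OF WS W(2)] VP])
    have "d = 0" if "d \<in> W" for d
    proof -
      have "d \<in> perp W" using pS WD(1)[OF that] by simp
      then have "ip d d = 0" using that by (simp add: perp_def)
      then show ?thesis using ip_self_eq_0[OF WD(1)[OF that]] by simp
    qed
    then have "W = {0}" using WD(2) by (intro equalityI subsetI) auto
    then show False using W(3) by simp
  qed
  have q_nz: "\<exists>j<n. q j \<noteq> 0"
  proof (rule ccontr)
    assume "\<not> (\<exists>j<n. q j \<noteq> 0)"
    then have "V j = p j" if "j < n" for j using that by (simp add: q_def)
    then have "V j \<in> W" if "j < n" for j using that p(1)[of j] by simp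
    from generates[OF W(1,2) this] show False using W(4) by simp
  qed
  obtain r \<psi> G C where 1: "\<psi> \<in> UCP r" "G \<in> carrier_mat r n" "C \<in> carrier_mat n r" "G * C = 1\<^sub>m r"
    "\<forall>a. \<forall>k<n. \<forall>l<n. (mat_adjoint G * \<psi> a * G) $$ (k, l) = ip (\<pi> a (p l)) (p k)"
    "r = 0 \<longrightarrow> (\<forall>j<n. p j = 0)"
    "\<forall>v\<in>carrier_vec n. (\<Sum>j<n. sc (v $ j) (p j)) = 0 \<longrightarrow> G *\<^sub>v v = 0\<^sub>v r"
    using factor_through_compression[of n p, OF pS] by (elim exE conjE) (rule that)
  obtain r' \<psi>' G' C' where 2: "\<psi>' \<in> UCP r'" "G' \<in> carrier_mat r' n" "C' \<in> carrier_mat n r'" "G' * C' = 1\<^sub>m r'"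
    "\<forall>a. \<forall>k<n. \<forall>l<n. (mat_adjoint G' * \<psi>' a * G') $$ (k, l) = ip (\<pi> a (q l)) (q k)"
    "r' = 0 \<longrightarrow> (\<forall>j<n. q j = 0)"
    "\<forall>v\<in>carrier_vec n. (\<Sum>j<n. sc (v $ j) (q j)) = 0 \<longrightarrow> G' *\<^sub>v v = 0\<^sub>v r'"
    using factor_through_compression[of n q, OF qS] by (elim exE conjE) (rule that)
  have r: "0 < r" "0 < r'" using 1(6) p_nz 2(6) q_nz by (metis gr0I)+
  \<comment> \<open>The cross terms vanish because \<open>W\<close> is invariant under
    \<open>\<pi> a\<close> and under its adjoint \<open>\<pi> (star a)\<close>.\<close>
  have split: "ip (\<pi> a (p l)) (p k) + ip (\<pi> a (q l)) (q k) = \<phi> a $$ (k, l)" if "k < n" "l < n" for a k l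
  proof -
    have V: "V j = p j + q j" for j by (simp add: q_def)
    have "ip (\<pi> a (q l)) (p k) = ip (q l) (\<pi> (star a) (p k))"
      using qS pS by (simp add: rep_star')
    then have "ip (\<pi> a (q l)) (p k) = 0" using qW(2)[OF piW[OF p(1)]] by simp
    moreover have "ip (\<pi> a (p l)) (q k) = 0" using qW(1)[OF piW[OF p(1)]] by simp
    ultimately show ?thesis
      unfolding \<phi>_eq[OF that] V using pS qS by (simp add: rep_lin ip_simps)
  qed
  define d where "d i = (if i = 0 then r else r')" for i :: nat
  define \<Psi> where "\<Psi> i = (if i = 0 then \<psi> else \<psi>')" for i :: nat
  define \<Gamma> where "\<Gamma> i = (if i = 0 then G else G')" for i :: nat
  have two: "(\<Sum>l<2. f l) = f 0 + f 1" for f :: "nat \<Rightarrow> complex" by (simp add: numeral_2_eq_2)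
  have \<phi>_sum: "\<phi> a = mat_sum n 2 (\<lambda>i. mat_adjoint (\<Gamma> i) * \<Psi> i a * \<Gamma> i)" for a
    using UCP_D(1)[OF \<phi>_UCP, of a]
    by (intro eq_matI) (auto simp: mat_sum_def two \<Gamma>_def \<Psi>_def 1(5) 2(5) split)
  have "mat_sum n 2 (\<lambda>i. mat_adjoint (\<Gamma> i) * \<Gamma> i) = mat_sum n 2 (\<lambda>i. mat_adjoint (\<Gamma> i) * \<Psi> i 1 * \<Gamma> i)"
  proof -
    have "mat_adjoint G * \<psi> 1 = mat_adjoint G" "mat_adjoint G' * \<psi>' 1 = mat_adjoint G'"
      using UCP_D(4)[OF 1(1)] UCP_D(4)[OF 2(1)] mat_adjoint_carrier[OF 1(2)] mat_adjoint_carrier[OF 2(2)] by simp_all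
    then show ?thesis unfolding mat_sum_def two \<Gamma>_def \<Psi>_def by simp
  qed
  then have one_sum: "mat_sum n 2 (\<lambda>i. mat_adjoint (\<Gamma> i) * \<Gamma> i) = 1\<^sub>m n"
    using \<phi>_sum[of 1] UCP_D(4)[OF \<phi>_UCP] by simp
  have surj: "surjective_mat G" "surjective_mat G'"
    by (rule surjective_mat_if_right_inverse[OF 1(2-4)], rule surjective_mat_if_right_inverse[OF 2(2-4)])
  have \<Gamma>: "0 < d i" "\<Psi> i \<in> UCP (d i)" "\<Gamma> i \<in> carrier_mat (d i) n" "surjective_mat (\<Gamma> i)" for i
    using r 1(1,2) 2(1,2) surj by (simp_all add: d_def \<Psi>_def \<Gamma>_def)
  note D = matrix_extreme_pointD[OF ext \<Gamma> one_sum \<phi>_sum]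
  \<comment> \<open>Extremality makes \<open>G\<close> and \<open>G'\<close> square; having right
    inverses, they are invertible, which is the injectivity claimed for both parts.\<close>
  have rn: "r = n" "r' = n" using D(1)[of 0] D(1)[of 1] by (simp_all add: d_def)
  obtain u where u: "unitary_mat n u" "\<And>a. \<phi> a = mat_adjoint u * \<psi> a * u"
    using D(2)[of 0] by (auto simp: \<Psi>_def)
  have uc: "u \<in> carrier_mat n n" "u * mat_adjoint u = 1\<^sub>m n" using u(1) by (auto simp: unitary_mat_def)
  note c1 = 1(2,3)[unfolded rn] and c2 = 2(2,3)[unfolded rn]
  \<comment> \<open>Unitarity of \<open>u\<close> lets
    \<open>\<phi> a = mat_adjoint u * \<psi> a * u\<close> be solved for \<open>\<psi> a\<close>, so
    that conjugating \<open>\<phi> a\<close> by \<open>\<delta>\<close> gives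
    \<open>mat_adjoint G * \<psi> a * G\<close>.\<close>
  define \<delta> where "\<delta> = mat_adjoint u * G"
  have \<delta>c: "\<delta> \<in> carrier_mat n n" using uc c1 unfolding \<delta>_def by (intro mult_carrier_mat[of _ n n]) auto
  have conj: "mat_adjoint \<delta> * \<phi> a * \<delta> = mat_adjoint G * \<psi> a * G" for a
  proof -
    have \<psi>c: "\<psi> a \<in> carrier_mat n n" using UCP_D(1)[OF 1(1)] rn by simp
    define U where "U = mat_adjoint u"
    define H where "H = mat_adjoint G"
    have Uc: "U \<in> carrier_mat n n" and Hc: "H \<in> carrier_mat n n" using uc c1 by (simp_all add: U_def H_def)
    have uU: "u * U = 1\<^sub>m n" using uc by (simp add: U_def)
    have "mat_adjoint \<delta> = H * u"
      unfolding \<delta>_def using mat_adjoint_mult[of "mat_adjoint u" n n G n] uc c1 by (simp add: mat_adjoint_adjoint H_def)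
    moreover have "\<phi> a = U * \<psi> a * u" using u(2) by (simp add: U_def)
    moreover have "(H * u) * (U * \<psi> a * u) * (U * G) = H * \<psi> a * G"
      by (rule mult_conj_cancel[OF Hc uc(1) Uc \<psi>c c1(1) uU])
    ultimately show ?thesis unfolding \<delta>_def U_def[symmetric] H_def[symmetric] by simp
  qed
  have inj: "v = 0\<^sub>v n" if "G0 * C0 = 1\<^sub>m n" "G0 \<in> carrier_mat n n" "C0 \<in> carrier_mat n n"
    "v \<in> carrier_vec n" "G0 *\<^sub>v v = 0\<^sub>v n" for G0 C0 :: "complex mat" and v
  proof -
    have "C0 * G0 = 1\<^sub>m n" using mat_mult_left_right_inverse[OF that(2,3,1)] .
    then have "v = (C0 * G0) *\<^sub>v v" using that by simp
    also have "\<dots> = C0 *\<^sub>v (G0 *\<^sub>v v)" using that by (intro assoc_mult_mat_vec[of _ n n _ n]) auto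
    also have "\<dots> = 0\<^sub>v n" using that by auto
    finally show ?thesis .
  qed
  show ?thesis
  proof (rule exI[of _ \<delta>], intro conjI allI impI ballI, rule \<delta>c)
    show "(mat_adjoint \<delta> * \<phi> a * \<delta>) $$ (k, l) = ip (\<pi> a (p l)) (p k)" if "k < n" "l < n" for a k l
      unfolding conj using 1(5) that by simp
    show "v = 0\<^sub>v n" if "v \<in> carrier_vec n" "(\<Sum>j<n. sc (v $ j) (p j)) = 0" for v
      using inj[OF 1(4)[unfolded rn] c1 that(1)] 1(7)[rule_format, OF that] rn by simp
    show "v = 0\<^sub>v n" if "v \<in> carrier_vec n" "(\<Sum>j<n. sc (v $ j) (V j - p j)) = 0" for v
      using inj[OF 2(4)[unfolded rn] c2 that(1)] 2(7)[rule_format, OF that(1)] that(2) rn by (simp add: q_def)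
  qed
qed

text \<open>An eigenvector \<open>v\<close> of \<open>\<delta>\<close> gives a vector \<open>\<xi> = V v\<close> with
  \<open>\<langle>\<pi>(a) \<xi>, P \<xi>\<rangle> = \<bar>\<mu>\<bar>\<^sup>2 \<langle>\<pi>(a) \<xi>, \<xi>\<rangle>\<close>, while \<open>\<xi>\<close> is cyclic by the splitting lemma applied to its
  cyclic subspace.\<close>

lemma irreducible_if_extreme: irreducible
  unfolding irreducible_def
proof (intro conjI allI impI)
  have "ip (V 0) (V 0) = 1" using orthonormal_V n_pos by (auto simp: orthonormal_def)
  then show "S \<noteq> {0}" using V_S[of 0] by auto
next
  fix W assume "closed_subsp W \<and> (\<forall>a. \<pi> a ` W \<subseteq> W)"
  then have W: "closed_subsp W" "\<And>a. \<pi> a ` W \<subseteq> W" by auto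
  show "W = {0} \<or> W = S"
  proof (rule ccontr)
    assume "\<not> (W = {0} \<or> W = S)"
    then have Wn: "W \<noteq> {0}" "W \<noteq> S" by auto
    have proj: "\<exists>p. \<forall>j. p j \<in> W \<and> (\<forall>d\<in>W. ip d (V j - p j) = 0)" if "closed_subsp W" for W
    proof -
      have "\<exists>y. y \<in> W \<and> (\<forall>d\<in>W. ip d (V j - y) = 0)" for j
        using projection[OF that V_S] by metis
      then show ?thesis by metis
    qed
    obtain p where p: "\<And>j. p j \<in> W" "\<forall>j. \<forall>d\<in>W. ip d (V j - p j) = 0"
      using proj[OF W(1)] by blast
    obtain \<delta> where \<delta>: "\<delta> \<in> carrier_mat n n"
      "\<forall>a. \<forall>k<n. \<forall>l<n. (mat_adjoint \<delta> * \<phi> a * \<delta>) $$ (k, l) = ip (\<pi> a (p l)) (p k)"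
      "\<forall>v\<in>carrier_vec n. (\<Sum>j<n. sc (v $ j) (p j)) = 0 \<longrightarrow> v = 0\<^sub>v n"
      "\<forall>v\<in>carrier_vec n. (\<Sum>j<n. sc (v $ j) (V j - p j)) = 0 \<longrightarrow> v = 0\<^sub>v n"
      using invariant_subspace_splitting[OF W Wn p] by (elim exE conjE) (rule that)
    obtain \<mu> where "\<mu> \<in> spectrum \<delta>" using spectrum_non_empty[OF \<delta>(1) n_pos] by blast
    then obtain v where v: "v \<in> carrier_vec n" "v \<noteq> 0\<^sub>v n" "\<delta> *\<^sub>v v = \<mu> \<cdot>\<^sub>v v"
      using \<delta>(1) unfolding spectrum_def eigenvalue_def eigenvector_def by auto
    have lin: "linear_subspace W" using W(1) by (simp add: closed_subsp_def)
    note WD = linear_subspaceD[OF lin]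
    have pS: "p j \<in> S" for j using p(1) WD(1) by blast
    define \<xi> where "\<xi> = (\<Sum>j<n. sc (v $ j) (V j))"
    define \<eta> where "\<eta> = (\<Sum>j<n. sc (v $ j) (p j))"
    have \<xi>S: "\<xi> \<in> S" unfolding \<xi>_def using V_S by (intro S_sum) auto
    have \<eta>W: "\<eta> \<in> W" unfolding \<eta>_def using p(1) WD by (intro linear_subspace_sum[OF lin]) auto
    have \<eta>S: "\<eta> \<in> S" using \<eta>W WD(1) by blast
    have \<xi>\<eta>: "\<xi> - \<eta> = (\<Sum>j<n. sc (v $ j) (V j - p j))"
      unfolding \<xi>_def \<eta>_def by (simp add: scale_right_diff_distrib sum_subtractf)
    have perp: "ip d (\<xi> - \<eta>) = 0" if "d \<in> W" for d
      unfolding \<xi>\<eta> using p(2)[rule_format, OF that] WD(1)[OF that] pS V_S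
      by (subst ip_sum_right) (auto simp: ip_sc_right)
    have perp': "ip (\<xi> - \<eta>) d = 0" if "d \<in> W" for d
      using perp[OF that] ip_cnj[OF WD(1)[OF that], of "\<xi> - \<eta>"] \<xi>S \<eta>S by simp
    define t where "t = (cmod \<mu>)\<^sup>2"
    \<comment> \<open>On an eigenvector, conjugation by \<open>\<delta>\<close> only multiplies the
      quadratic form by \<open>cnj \<mu> * \<mu>\<close>.\<close>
    have form: "ip (\<pi> a \<eta>) \<eta> = of_real t * ip (\<pi> a \<xi>) \<xi>" for a
    proof -
      have \<phi>c: "\<phi> a \<in> carrier_mat n n" by (rule UCP_D(1)[OF \<phi>_UCP])
      have conjc: "mat_adjoint \<delta> * \<phi> a * \<delta> \<in> carrier_mat n n"
        using \<delta>(1) \<phi>c by (auto intro!: mult_carrier_mat[of _ n n])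
      have "ip (\<pi> a \<eta>) \<eta> = ((mat_adjoint \<delta> * \<phi> a * \<delta>) *\<^sub>v v) \<bullet>c v"
        unfolding \<eta>_def quadratic_form_sum[OF conjc v(1)] using pS \<delta>(2) by (simp add: ip_rep_sum)
      also have "\<dots> = (\<phi> a *\<^sub>v (\<mu> \<cdot>\<^sub>v v)) \<bullet>c (\<mu> \<cdot>\<^sub>v v)"
        using quadratic_form_adjoint[OF \<delta>(1) \<phi>c v(1)] v(3) by simp
      also have "\<dots> = (\<Sum>k<n. \<Sum>l<n. cnj ((\<mu> \<cdot>\<^sub>v v) $ k) * \<phi> a $$ (k, l) * (\<mu> \<cdot>\<^sub>v v) $ l)"
        using v(1) by (intro quadratic_form_sum[OF \<phi>c]) simp
      also have "\<dots> = (\<Sum>k<n. \<Sum>l<n. (cnj \<mu> * \<mu>) * (cnj (v $ k) * ip (\<pi> a (V l)) (V k) * v $ l))"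
        using v(1) by (intro sum.cong refl) (auto simp: \<phi>_eq)
      also have "\<dots> = (cnj \<mu> * \<mu>) * ip (\<pi> a \<xi>) \<xi>"
        unfolding \<xi>_def using V_S by (simp add: ip_rep_sum sum_distrib_left)
      also have "cnj \<mu> * \<mu> = of_real t" unfolding t_def by (metis complex_norm_square mult.commute)
      finally show ?thesis .
    qed
    define y where "y = \<eta> - sc (of_real t) \<xi>"
    have yS: "y \<in> S" using \<eta>S \<xi>S by (simp add: y_def)
    have y_perp: "ip y (\<pi> a \<xi>) = 0" for a
    proof -
      have "ip (\<pi> a (\<xi> - \<eta>)) \<eta> = ip (\<xi> - \<eta>) (\<pi> (star a) \<eta>)"
        using \<xi>S \<eta>S by (simp add: rep_star')
      also have "\<dots> = 0" using perp' W(2) \<eta>W by blast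
      finally have "ip (\<pi> a \<xi>) \<eta> = ip (\<pi> a \<eta>) \<eta>" using \<xi>S \<eta>S by (simp add: rep_lin ip_simps)
      then have "ip (\<pi> a \<xi>) y = 0" using form[of a] \<xi>S \<eta>S by (simp add: y_def ip_simps)
      then show ?thesis using ip_cnj[of "\<pi> a \<xi>" y] \<xi>S yS by simp
    qed
    \<comment> \<open>If this space were proper, \<open>invariant_subspace_splitting\<close> would
      apply to it. But \<open>\<xi>\<close> lies in it, so the combination \<open>?z\<close> is both
      inside and orthogonal to it, hence 0, against the injectivity of the second part.\<close>
    have "cyclic_space \<xi> = S"
    proof (rule ccontr)
      assume ne: "cyclic_space \<xi> \<noteq> S"
      note cs = cyclic_space[OF \<xi>S]
      have "\<xi> \<noteq> 0" using comb_V_eq_0[OF v(1)] v(2) by (auto simp: \<xi>_def)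
      then have ne0: "cyclic_space \<xi> \<noteq> {0}" using cs(3) by auto
      obtain p' where p': "\<And>j. p' j \<in> cyclic_space \<xi>" "\<forall>j. \<forall>d\<in>cyclic_space \<xi>. ip d (V j - p' j) = 0"
        using proj[OF cs(1)] by blast
      have lin': "linear_subspace (cyclic_space \<xi>)" using cs(1) by (simp add: closed_subsp_def)
      note CD = linear_subspaceD[OF lin']
      let ?z = "\<Sum>j<n. sc (v $ j) (V j - p' j)"
      have p'S: "p' j \<in> S" for j using p'(1) CD(1) by blast
      have zS: "?z \<in> S" using V_S p'S by (intro S_sum) auto
      have "?z = \<xi> - (\<Sum>j<n. sc (v $ j) (p' j))"
        unfolding \<xi>_def by (simp add: scale_right_diff_distrib sum_subtractf)
      moreover have "(\<Sum>j<n. sc (v $ j) (p' j)) \<in> cyclic_space \<xi>"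
        using p'(1) CD by (intro linear_subspace_sum[OF lin']) auto
      ultimately have zC: "?z \<in> cyclic_space \<xi>" using cs(3) CD(6) by simp
      have "ip ?z ?z = 0"
        using p'(2)[rule_format, OF zC] V_S p'S zS by (subst (2) refl, subst ip_sum_right) (auto simp: ip_sc_right)
      then have z0: "?z = 0" using zS ip_self_eq_0 by blast
      have "v = 0\<^sub>v n"
        using invariant_subspace_splitting[OF cs(1,2) ne0 ne p'] v(1) z0 by (elim exE conjE) simp
      then show False using v(2) by simp
    qed
    then have "ip y y = 0"
      using yS y_perp unfolding cyclic_space_def perp_def by blast
    then have "y = 0" using yS ip_self_eq_0 by simp
    then have eq: "\<eta> = sc (of_real t) \<xi>" by (simp add: y_def)
    \<comment> \<open>\<open>\<eta>\<close> is the projection of \<open>\<xi>\<close> and so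
      orthogonal to the remainder; for a multiple of a nonzero \<open>\<xi>\<close> this leaves only
      the factors 0 and 1.\<close>
    have "ip \<eta> (\<xi> - \<eta>) = of_real (t * (1 - t)) * ip \<xi> \<xi>"
      unfolding eq using \<xi>S by (simp add: ip_simps algebra_simps)
    then have "of_real (t * (1 - t)) * ip \<xi> \<xi> = 0" using perp[OF \<eta>W] by simp
    moreover have "ip \<xi> \<xi> \<noteq> 0" using comb_V_eq_0[OF v(1)] v(2) ip_self_eq_0[OF \<xi>S] by (auto simp: \<xi>_def)
    ultimately have "t = 0 \<or> t = 1" by auto
    then have "\<eta> = 0 \<or> \<xi> - \<eta> = 0" unfolding eq by auto
    then show False using \<delta>(3,4)[rule_format, OF v(1)] v(2) unfolding \<xi>\<eta> unfolding \<eta>_def by blast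
  qed
qed

end

section \<open>From an irreducible representation to matrix extreme points\<close>

lemma conjugate_UCP_form:
  fixes \<psi> :: "'a::unital_cstar_algebra \<Rightarrow> complex mat"
  assumes \<psi>: "\<psi> \<in> UCP d" and G: "G \<in> carrier_mat d n"
  shows "positive_form n (\<lambda>a p q. \<Sum>s<d. \<Sum>t<d. cnj (G $$ (s, p)) * \<psi> a $$ (s, t) * G $$ (t, q))"
proof
  have car: "dim_row (\<psi> a) = d" "dim_col (\<psi> a) = d" for a using carrier_matD[OF UCP_D(1)[OF \<psi>]] by auto
  have add: "\<psi> (a + b) = \<psi> a + \<psi> b" and scl: "\<psi> (scaleC c a) = c \<cdot>\<^sub>m \<psi> a" for a b c
    using UCP_D[OF \<psi>] by auto
  fix a b :: 'a and c p q
  show "(\<Sum>s<d. \<Sum>t<d. cnj (G $$ (s, p)) * \<psi> (a + b) $$ (s, t) * G $$ (t, q)) =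
    (\<Sum>s<d. \<Sum>t<d. cnj (G $$ (s, p)) * \<psi> a $$ (s, t) * G $$ (t, q)) +
    (\<Sum>s<d. \<Sum>t<d. cnj (G $$ (s, p)) * \<psi> b $$ (s, t) * G $$ (t, q))"
    unfolding sum.distrib[symmetric] by (intro sum.cong refl) (simp add: add car algebra_simps)
  show "(\<Sum>s<d. \<Sum>t<d. cnj (G $$ (s, p)) * \<psi> (scaleC c a) $$ (s, t) * G $$ (t, q)) =
    c * (\<Sum>s<d. \<Sum>t<d. cnj (G $$ (s, p)) * \<psi> a $$ (s, t) * G $$ (t, q))"
    unfolding sum_distrib_left by (intro sum.cong refl) (simp add: scl car)
next
  fix e :: "nat \<Rightarrow> 'a"
  \<comment> \<open>Complete positivity of \<open>\<psi>\<close>, tested on the columns of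
    \<open>G\<close>.\<close>
  show "0 \<le> tuple_form n (\<lambda>a p q. \<Sum>s<d. \<Sum>t<d. cnj (G $$ (s, p)) * \<psi> a $$ (s, t) * G $$ (t, q)) e e"
    unfolding tuple_form_def
    using completely_positive_form[OF UCP_D(5)[OF \<psi>], where m = n and a = e and v = "\<lambda>p s. G $$ (s, p)"] .
qed

lemma smult_mat_vec:
  fixes A :: "'b::comm_ring mat"
  assumes "A \<in> carrier_mat m n" "v \<in> carrier_vec n"
  shows "(k \<cdot>\<^sub>m A) *\<^sub>v v = k \<cdot>\<^sub>v (A *\<^sub>v v)"
  using assms by (intro eq_vecI) (auto simp: scalar_prod_def sum_distrib_left mult.assoc)

lemma smult_smult_mat: "a \<cdot>\<^sub>m (b \<cdot>\<^sub>m A) = (a * b :: 'b::comm_ring) \<cdot>\<^sub>m A"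
  by (rule eq_matI) (auto simp: mult.assoc)

text \<open>\<open>G\<close> is onto a nonzero space, so \<open>t\<close> cannot be 0. Then
  \<open>L\<close>, the adjoint divided by \<open>t\<close>, is a left inverse, and surjectivity
  makes it a right inverse too; comparing the traces of \<open>G * L\<close> and
  \<open>L * G\<close> gives \<open>d = n\<close>.\<close>

lemma scalar_gram_square:
  fixes G :: "complex mat"
  assumes G: "G \<in> carrier_mat d n" "surjective_mat G" and d: "0 < d" and n: "0 < n"
    and GG: "mat_adjoint G * G = complex_of_real t \<cdot>\<^sub>m 1\<^sub>m n"
  shows "0 < t \<and> d = n"
proof -
  have Gc: "mat_adjoint G \<in> carrier_mat n d" using G by simp
  have onto: "\<exists>v\<in>carrier_vec n. G *\<^sub>v v = y" if "y \<in> carrier_vec d" for y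
    using G that unfolding surjective_mat_def by (metis (no_types, lifting) carrier_matD imageE)
  have adj: "mat_adjoint G *\<^sub>v (G *\<^sub>v v) = complex_of_real t \<cdot>\<^sub>v v" if "v \<in> carrier_vec n" for v
  proof -
    have "mat_adjoint G *\<^sub>v (G *\<^sub>v v) = (mat_adjoint G * G) *\<^sub>v v"
      by (rule assoc_mult_mat_vec[symmetric, OF Gc G(1) that])
    also have "\<dots> = complex_of_real t \<cdot>\<^sub>v v" unfolding GG using that by auto
    finally show ?thesis .
  qed
  have "(mat_adjoint G * G) $$ (0, 0) = (\<Sum>i<d. cnj (G $$ (i, 0)) * G $$ (i, 0))"
    using G n by (simp add: mat_adjoint_eq scalar_prod_def lessThan_atLeast0)
  also have "\<dots> = complex_of_real (\<Sum>i<d. (cmod (G $$ (i, 0)))\<^sup>2)"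
    by (simp add: complex_norm_square mult.commute del: of_real_power)
  finally have "t = (\<Sum>i<d. (cmod (G $$ (i, 0)))\<^sup>2)"
    unfolding GG using n by (simp del: of_real_power of_real_sum)
  then have t0: "0 \<le> t" by (simp add: sum_nonneg)
  have t: "t \<noteq> 0"
  proof
    assume "t = 0"
    obtain v where v: "v \<in> carrier_vec n" "G *\<^sub>v v = unit_vec d 0" using onto[of "unit_vec d 0"] by auto
    have "(G *\<^sub>v v) \<bullet>c (G *\<^sub>v v) = (mat_adjoint G *\<^sub>v (G *\<^sub>v v)) \<bullet>c v"
      using mat_adjoint_inner[OF G(1) _ v(1), of "G *\<^sub>v v"] G v by simp
    also have "\<dots> = 0" unfolding adj[OF v(1)] \<open>t = 0\<close> using v(1) by simp
    finally have "G *\<^sub>v v = 0\<^sub>v d" using G v(1) conjugate_square_eq_0_vec[of "G *\<^sub>v v" d] by auto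
    then have "(unit_vec d 0 :: complex vec) $ 0 = 0" using v(2) d by simp
    then show False using d by simp
  qed
  define L where "L = complex_of_real (1 / t) \<cdot>\<^sub>m mat_adjoint G"
  have Lc: "L \<in> carrier_mat n d" using Gc by (simp add: L_def)
  have LG: "(L * G) $$ (j, j) = 1" if "j < n" for j
  proof -
    have "L * G = complex_of_real (1 / t) \<cdot>\<^sub>m (mat_adjoint G * G)"
      unfolding L_def by (rule mult_smult_assoc_mat[OF Gc G(1)])
    then show ?thesis unfolding GG using that t by simp
  qed
  have GL: "(G * L) $$ (i, i) = 1" if i: "i < d" for i
  proof -
    obtain v where v: "v \<in> carrier_vec n" "G *\<^sub>v v = unit_vec d i" using onto[of "unit_vec d i"] by auto
    have "(G * L) *\<^sub>v unit_vec d i = G *\<^sub>v (L *\<^sub>v (G *\<^sub>v v))"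
      unfolding v(2) by (rule assoc_mult_mat_vec[OF G(1) Lc]) simp
    also have "L *\<^sub>v (G *\<^sub>v v) = complex_of_real (1 / t) \<cdot>\<^sub>v (mat_adjoint G *\<^sub>v (G *\<^sub>v v))"
      unfolding L_def by (rule smult_mat_vec[OF Gc]) (use G v in simp)
    also have "\<dots> = v" unfolding adj[OF v(1)] using t v(1) by (auto simp: smult_smult_assoc)
    finally have "(G * L) *\<^sub>v unit_vec d i = unit_vec d i" using v(2) by simp
    then have "((G * L) *\<^sub>v unit_vec d i) $ i = 1" using i by simp
    moreover have "(X *\<^sub>v unit_vec d i) $ i = X $$ (i, i)" if "X \<in> carrier_mat d d" for X :: "complex mat"
      using that i by simp
    note this[OF mult_carrier_mat[OF G(1) Lc]]
    ultimately show ?thesis by simp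
  qed
  have "complex_of_nat d = (\<Sum>i<d. (G * L) $$ (i, i))" using GL by simp
  also have "\<dots> = (\<Sum>i<d. \<Sum>j<n. G $$ (i, j) * L $$ (j, i))"
    using G Lc by (intro sum.cong refl) (simp add: scalar_prod_def lessThan_atLeast0)
  also have "\<dots> = (\<Sum>j<n. \<Sum>i<d. L $$ (j, i) * G $$ (i, j))"
    by (subst sum.swap) (simp add: mult.commute)
  also have "\<dots> = (\<Sum>j<n. (L * G) $$ (j, j))"
    using G Lc by (intro sum.cong refl) (simp add: scalar_prod_def lessThan_atLeast0)
  also have "\<dots> = complex_of_nat n" using LG by simp
  finally show ?thesis using t t0 by (simp only: of_nat_eq_iff) simp
qed

context star_rep
begin

lemma rep_zero_left: "x \<in> S \<Longrightarrow> \<pi> 0 x = 0"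
  using rep_scaleC[of x 0 0] by (simp add: scaleC_zero_left)

text \<open>An instance of \<open>bounded_form_is_scalar\<close>: \<open>\<iota> e\<close> is the
  sum of the vectors \<open>\<pi> (e p) (w p)\<close>, and the inner product pulls back along
  \<open>\<iota>\<close> to the form of the compression, so \<open>le\<close> is the required
  domination.\<close>

lemma irreducible_summand_scalar:
  assumes irr: irreducible and w: "orthonormal w n" and n: "0 < n" and \<chi>: "positive_form n \<chi>"
    and le: "\<And>e. Re (tuple_form n \<chi> e e) \<le> Re (tuple_form n (\<lambda>a p q. ip (\<pi> a (w q)) (w p)) e e)"
  shows "\<exists>t::real. \<forall>a. \<forall>k<n. \<forall>l<n. \<chi> a k l = of_real t * ip (\<pi> a (w l)) (w k)"
proof -
  interpret P: positive_form n \<chi> by (rule \<chi>)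
  have wS: "w i \<in> S" if "i < n" for i using w that by (simp add: orthonormal_def)
  define \<iota> where "\<iota> e = (\<Sum>p<n. \<pi> (e p) (w p))" for e :: "nat \<Rightarrow> 'a"
  define \<delta> :: "'a \<Rightarrow> nat \<Rightarrow> nat \<Rightarrow> 'a" where "\<delta> a l p = (if p = l then a else 0)" for a l p
  have \<iota>_delta: "\<iota> (\<delta> a l) = \<pi> a (w l)" if "l < n" for a l
  proof -
    have "\<iota> (\<delta> a l) = (\<Sum>p<n. if p = l then \<pi> a (w l) else 0)"
      unfolding \<iota>_def \<delta>_def using wS by (intro sum.cong refl) (auto simp: rep_zero_left)
    then show ?thesis using that by simp
  qed
  have zero: "\<chi> 0 p q = 0" for p q using P.form_scaleC[of 0 0 p q] by (simp add: scaleC_zero_left)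
  have \<iota>S: "\<iota> e \<in> S" for e unfolding \<iota>_def using wS by (intro S_sum) auto
  obtain t :: real where t: "\<And>e f. tuple_form n \<chi> e f = of_real t * ip (\<iota> e) (\<iota> f)"
  proof (rule bounded_form_is_scalar[OF irr, where sE = tuple_scale and B = "tuple_form n \<chi>" and \<iota> = \<iota> and \<alpha> = tuple_act])
    show "semi_inner tuple_scale UNIV (tuple_form n \<chi>)" by (rule P.semi_inner_axioms)
    show "\<iota> e \<in> S" for e by (rule \<iota>S)
    show "\<iota> (e + f) = \<iota> e + \<iota> f" for e f
      unfolding \<iota>_def sum.distrib[symmetric] using wS by (intro sum.cong refl) (simp add: rep_add)
    show "\<iota> (tuple_scale c e) = sc c (\<iota> e)" for c e
      unfolding \<iota>_def scale_sum_right tuple_scale_def using wS by (intro sum.cong refl) (simp add: rep_scaleC)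
    show "\<iota> (tuple_act a e) = \<pi> a (\<iota> e)" for a e
      unfolding \<iota>_def tuple_act_def using wS by (subst rep_sum) (auto simp: rep_mult)
    show "tuple_form n \<chi> (tuple_act (star a) e) f = tuple_form n \<chi> e (tuple_act a f)" for a e f
      by (rule P.tuple_form_act)
    show "Re (tuple_form n \<chi> e e) \<le> (nrm (\<iota> e))\<^sup>2" for e
    proof -
      have "tuple_form n (\<lambda>a p q. ip (\<pi> a (w q)) (w p)) e e = (\<Sum>p<n. \<Sum>q<n. ip (\<pi> (e q) (w q)) (\<pi> (e p) (w p)))"
        unfolding tuple_form_def using wS by (intro sum.cong refl) (simp add: rep_mult rep_star)
      also have "\<dots> = (\<Sum>p<n. ip (\<iota> e) (\<pi> (e p) (w p)))"
        unfolding \<iota>_def using wS by (intro sum.cong refl ip_sum_left[symmetric]) auto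
      also have "\<dots> = ip (\<iota> e) (\<Sum>p<n. \<pi> (e p) (w p))"
        using wS by (intro ip_sum_right[symmetric] \<iota>S) auto
      also have "(\<Sum>p<n. \<pi> (e p) (w p)) = \<iota> e" by (simp only: \<iota>_def)
      finally show ?thesis using le[of e] by (simp add: nrm_sq \<iota>S)
    qed
    have "\<iota> (\<delta> 1 0) = w 0" using \<iota>_delta[OF n] wS[OF n] by (simp add: rep_one)
    moreover have "ip (w 0) (w 0) = 1" using w n by (simp add: orthonormal_def)
    then have "w 0 \<noteq> 0" using wS[OF n] by auto
    ultimately show "\<exists>e. \<iota> e \<noteq> 0" by metis
  qed blast
  have "\<chi> a k l = of_real t * ip (\<pi> a (w l)) (w k)" if kl: "k < n" "l < n" for a k l
  proof -
    \<comment> \<open>Tuples supported at one index recover \<open>\<chi> a k l\<close> from the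
      form.\<close>
    have "tuple_form n \<chi> (\<delta> a l) (\<delta> 1 k) = (\<Sum>p<n. \<Sum>q<n. if q = l then (if p = k then \<chi> a k l else 0) else 0)"
      unfolding tuple_form_def \<delta>_def by (intro sum.cong refl) (auto simp: zero star_one star_zero)
    also have "\<dots> = \<chi> a k l" using kl by simp
    finally show ?thesis using t[of "\<delta> a l" "\<delta> 1 k"] kl wS by (simp add: \<iota>_delta rep_one)
  qed
  then show ?thesis by blast
qed

text \<open>Each summand is a positive form dominated by the sum of all, which is the form of the
  compression; hence it is a multiple \<open>t\<close> of it. At the unit this says that
  \<open>mat_adjoint (\<gamma> i) * \<gamma> i\<close> is \<open>t\<close> times the identity, so
  \<open>\<gamma> i\<close> is \<open>sqrt t\<close> times a unitary.\<close>

lemma extreme_if_irreducible: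
  assumes irr: irreducible and w: "orthonormal w n" and n: "0 < n"
  shows "matrix_extreme_point n (compression w n)"
  unfolding matrix_extreme_point_def
proof (intro conjI allI impI)
  show "0 < n" by (rule n)
  show "compression w n \<in> UCP n" by (rule compression_UCP[OF w])
  fix k d \<psi> \<gamma> i
  assume asm: "(\<forall>i<k. 0 < d i \<and> \<psi> i \<in> UCP (d i) \<and> \<gamma> i \<in> carrier_mat (d i) n \<and> surjective_mat (\<gamma> i)) \<and>
    mat_sum n k (\<lambda>i. mat_adjoint (\<gamma> i) * \<gamma> i) = 1\<^sub>m n \<and>
    (\<forall>a. compression w n a = mat_sum n k (\<lambda>i. mat_adjoint (\<gamma> i) * \<psi> i a * \<gamma> i))"
    and i: "i < k"
  have d: "\<And>l. l < k \<Longrightarrow> 0 < d l" and \<psi>: "\<And>l. l < k \<Longrightarrow> \<psi> l \<in> UCP (d l)"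
    and \<gamma>: "\<And>l. l < k \<Longrightarrow> \<gamma> l \<in> carrier_mat (d l) n" and surj: "\<And>l. l < k \<Longrightarrow> surjective_mat (\<gamma> l)"
    and sum: "\<And>a. compression w n a = mat_sum n k (\<lambda>i. mat_adjoint (\<gamma> i) * \<psi> i a * \<gamma> i)"
    using asm by auto
  define \<chi> where "\<chi> l a p q = (\<Sum>s<d l. \<Sum>t<d l. cnj (\<gamma> l $$ (s, p)) * \<psi> l a $$ (s, t) * \<gamma> l $$ (t, q))"
    for l a p q
  have \<chi>: "(mat_adjoint (\<gamma> l) * \<psi> l a * \<gamma> l) $$ (p, q) = \<chi> l a p q" if "l < k" "p < n" "q < n" for l a p q
    unfolding \<chi>_def by (rule mat_adjoint_mult_index[OF \<gamma>[OF that(1)] UCP_D(1)[OF \<psi>[OF that(1)]] that(2,3)])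
  have pos: "positive_form n (\<chi> l)" if "l < k" for l
    unfolding \<chi>_def by (rule conjugate_UCP_form[OF \<psi>[OF that] \<gamma>[OF that]])
  have total: "ip (\<pi> a (w q)) (w p) = (\<Sum>l<k. \<chi> l a p q)" if "p < n" "q < n" for a p q
  proof -
    have "ip (\<pi> a (w q)) (w p) = compression w n a $$ (p, q)" using that by (simp add: compression_def)
    also have "\<dots> = (\<Sum>l<k. \<chi> l a p q)" unfolding sum mat_sum_def using that by (simp add: \<chi>)
    finally show ?thesis .
  qed
  have "\<exists>t::real. \<forall>a. \<forall>p<n. \<forall>q<n. \<chi> i a p q = of_real t * ip (\<pi> a (w q)) (w p)"
  proof (rule irreducible_summand_scalar[OF irr w n pos[OF i]])
    fix e
    have "tuple_form n (\<lambda>a p q. ip (\<pi> a (w q)) (w p)) e e = (\<Sum>p<n. \<Sum>q<n. \<Sum>l<k. \<chi> l (star (e p) * e q) p q)"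
      unfolding tuple_form_def by (intro sum.cong refl) (simp add: total)
    also have "\<dots> = (\<Sum>p<n. \<Sum>l<k. \<Sum>q<n. \<chi> l (star (e p) * e q) p q)"
      by (intro sum.cong refl sum.swap)
    also have "\<dots> = (\<Sum>l<k. tuple_form n (\<chi> l) e e)"
      unfolding tuple_form_def by (rule sum.swap)
    finally have "Re (tuple_form n (\<lambda>a p q. ip (\<pi> a (w q)) (w p)) e e) = (\<Sum>l<k. Re (tuple_form n (\<chi> l) e e))"
      by simp
    moreover have "Re (tuple_form n (\<chi> i) e e) \<le> (\<Sum>l<k. Re (tuple_form n (\<chi> l) e e))"
      using i positive_form.form_pos[OF pos, of _ e]
      by (intro member_le_sum) (auto simp: less_eq_complex_def)
    ultimately show "Re (tuple_form n (\<chi> i) e e) \<le> Re (tuple_form n (\<lambda>a p q. ip (\<pi> a (w q)) (w p)) e e)" by simp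
  qed
  then obtain t :: real where t: "\<And>a p q. p < n \<Longrightarrow> q < n \<Longrightarrow> \<chi> i a p q = of_real t * ip (\<pi> a (w q)) (w p)"
    by auto
  note G = \<gamma>[OF i] and P = UCP_D[OF \<psi>[OF i]]
  have scalar: "mat_adjoint (\<gamma> i) * \<psi> i a * \<gamma> i = of_real t \<cdot>\<^sub>m compression w n a" for a
  proof (rule eq_matI)
    fix p q assume "p < dim_row (of_real t \<cdot>\<^sub>m compression w n a)" "q < dim_col (of_real t \<cdot>\<^sub>m compression w n a)"
    then have "p < n" "q < n" by (simp_all add: compression_def)
    then show "(mat_adjoint (\<gamma> i) * \<psi> i a * \<gamma> i) $$ (p, q) = (of_real t \<cdot>\<^sub>m compression w n a) $$ (p, q)"
      unfolding \<chi>[OF i \<open>p < n\<close> \<open>q < n\<close>] using t by (simp add: compression_def)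
  qed (use G in \<open>simp_all add: compression_def mat_adjoint_eq\<close>)
  have "mat_adjoint (\<gamma> i) * \<gamma> i = mat_adjoint (\<gamma> i) * \<psi> i 1 * \<gamma> i"
    unfolding P(4) using mat_adjoint_carrier[OF G] by simp
  also have "\<dots> = of_real t \<cdot>\<^sub>m 1\<^sub>m n"
    unfolding scalar UCP_D(4)[OF compression_UCP[OF w]] ..
  finally have GG: "mat_adjoint (\<gamma> i) * \<gamma> i = of_real t \<cdot>\<^sub>m 1\<^sub>m n" .
  have tn: "0 < t" "d i = n" using scalar_gram_square[OF G surj[OF i] d[OF i] n GG] by auto
  show "d i = n" by (rule tn)
  have Gn: "\<gamma> i \<in> carrier_mat n n" using G tn by simp
  have P1: "\<psi> i a \<in> carrier_mat n n" for a using P(1) tn by simp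
  \<comment> \<open>Normalises \<open>\<gamma> i\<close> to a unitary; legitimate because
    \<open>0 < t\<close>.\<close>
  define c where "c = complex_of_real (1 / sqrt t)"
  define u where "u = c \<cdot>\<^sub>m \<gamma> i"
  have cc: "c * c = of_real (1 / t)" "cnj c = c"
    using tn by (simp_all add: c_def flip: of_real_mult)
  have uc: "u \<in> carrier_mat n n" using Gn by (simp add: u_def)
  have ua: "mat_adjoint u = c \<cdot>\<^sub>m mat_adjoint (\<gamma> i)"
    unfolding u_def using cc(2) by (intro eq_matI) (auto simp: mat_adjoint_eq)
  have conj: "mat_adjoint u * M * u = of_real (1 / t) \<cdot>\<^sub>m (mat_adjoint (\<gamma> i) * M * \<gamma> i)"
    if M: "M \<in> carrier_mat n n" for M
  proof -
    have A: "mat_adjoint (\<gamma> i) * M \<in> carrier_mat n n" using M Gn by (intro mult_carrier_mat[of _ n n]) auto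
    have "mat_adjoint u * M = c \<cdot>\<^sub>m (mat_adjoint (\<gamma> i) * M)"
      unfolding ua by (rule mult_smult_assoc_mat[OF mat_adjoint_carrier[OF Gn] M])
    then have "mat_adjoint u * M * u = c \<cdot>\<^sub>m (mat_adjoint (\<gamma> i) * M) * u" by simp
    also have "\<dots> = c \<cdot>\<^sub>m (mat_adjoint (\<gamma> i) * M * u)" by (rule mult_smult_assoc_mat[OF A uc])
    also have "mat_adjoint (\<gamma> i) * M * u = c \<cdot>\<^sub>m (mat_adjoint (\<gamma> i) * M * \<gamma> i)"
      unfolding u_def by (rule mult_smult_distrib[OF A Gn])
    finally show ?thesis unfolding smult_smult_mat cc(1) .
  qed
  have "mat_adjoint u * u = mat_adjoint u * 1\<^sub>m n * u"
    using mat_adjoint_carrier[OF uc] by simp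
  also have "\<dots> = 1 \<cdot>\<^sub>m 1\<^sub>m n"
    unfolding conj[OF one_carrier_mat] using GG mat_adjoint_carrier[OF Gn] tn
    by (simp add: smult_smult_mat)
  also have "\<dots> = 1\<^sub>m n" by (rule eq_matI) auto
  finally have uu: "mat_adjoint u * u = 1\<^sub>m n" .
  have "unitary_mat n u"
    unfolding unitary_mat_def using uc uu mat_mult_left_right_inverse[OF mat_adjoint_carrier[OF uc] uc uu] by blast
  moreover have "compression w n a = mat_adjoint u * \<psi> i a * u" for a
    unfolding conj[OF P1] scalar using tn by (intro eq_matI) (auto simp: compression_def)
  ultimately show "\<exists>u. unitary_mat n u \<and> (\<forall>a. compression w n a = mat_adjoint u * \<psi> i a * u)" by blast
qed

end

section \<open>Transport between the two notions of Hilbert space\<close>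

context star_rep
begin

text \<open>An injection \<open>J\<close> carries the whole structure over, so the target type can
  be chosen freely. The dimension is bounded from below because the image of an orthonormal family
  is linearly independent.\<close>

lemma transport_to_record:
  fixes J :: "'v \<Rightarrow> 'k"
  assumes inj: "inj_on J S" and irr: irreducible
  shows "\<exists>(H :: 'k inner_space) \<rho>. irreducible_representation H (\<rho> :: 'a \<Rightarrow> _) \<and>
    (\<forall>n w. orthonormal w n \<longrightarrow> vectorspace.fin_dim (class_ring :: complex ring) H \<longrightarrow>
      n \<le> vectorspace.dim (class_ring :: complex ring) H)"
proof -
  define K where "K = inv_into S J"
  have KJ [simp]: "K (J x) = x" if "x \<in> S" for x using inj that by (simp add: K_def)
  define H :: "'k inner_space" where "H = \<lparr>carrier = J ` S, monoid.mult = undefined, one = undefined,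
    zero = J 0, add = \<lambda>x y. J (K x + K y), module.smult = \<lambda>c x. J (sc c (K x)), cinner = \<lambda>x y. ip (K x) (K y)\<rparr>"
  have H [simp]: "carrier H = J ` S" "\<zero>\<^bsub>H\<^esub> = J 0" "x \<oplus>\<^bsub>H\<^esub> y = J (K x + K y)"
    "c \<odot>\<^bsub>H\<^esub> x = J (sc c (K x))" "cinner H x y = ip (K x) (K y)" for x y c
    by (simp_all add: H_def)
  have vs: "vectorspace (class_ring :: complex ring) H"
  proof (rule vs_criteria)
    show "\<forall>v\<in>carrier H. \<exists>neg_v\<in>carrier H. v \<oplus>\<^bsub>H\<^esub> neg_v = \<zero>\<^bsub>H\<^esub>"
    proof
      fix v assume "v \<in> carrier H"
      then obtain x where x: "x \<in> S" "v = J x" by auto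
      then show "\<exists>neg_v\<in>carrier H. v \<oplus>\<^bsub>H\<^esub> neg_v = \<zero>\<^bsub>H\<^esub>" by (intro bexI[of _ "J (- x)"]) auto
    qed
  qed (auto simp: class_field ac_simps scale_right_distrib scale_left_distrib)
  interpret V: vectorspace "class_ring :: complex ring" H by (rule vs)
  have minus: "J x \<ominus>\<^bsub>H\<^esub> J y = J (x - y)" if "x \<in> S" "y \<in> S" for x y
  proof -
    have "\<ominus>\<^bsub>H\<^esub> (J y) = J (- y)"
      using that by (intro V.minus_equality) auto
    then show ?thesis using that by (simp add: a_minus_def)
  qed
  have hn: "hnorm H (J x) = nrm x" if "x \<in> S" for x using that by (simp add: hnorm_def nrm_def)
  have hlim: "hlim H (\<lambda>n. J (s n)) (J l) \<longleftrightarrow> converges s l" if "\<And>n. s n \<in> S" "l \<in> S" for s l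
    using that by (simp add: hlim_def converges_def minus hn)
  have HS: "hilbert_space H"
  proof (intro hilbert_space.intro vs hilbert_space_axioms.intro)
    fix s :: "nat \<Rightarrow> 'k"
    assume s: "\<And>n. s n \<in> carrier H" and c: "\<And>e. 0 < e \<Longrightarrow> \<exists>M. \<forall>m\<ge>M. \<forall>n\<ge>M. hnorm H (s m \<ominus>\<^bsub>H\<^esub> s n) < e"
    define s' where "s' n = K (s n)" for n
    have s': "s' n \<in> S" "s n = J (s' n)" for n
    proof -
      obtain x where "x \<in> S" "s n = J x" using s[of n] by auto
      then show "s' n \<in> S" "s n = J (s' n)" by (simp_all add: s'_def)
    qed
    have "cauchy s'" using c unfolding cauchy_def s'(2) by (simp add: minus s'(1) hn)
    then obtain l where l: "l \<in> S" "converges s' l" using complete s'(1) by blast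
    have "s = (\<lambda>n. J (s' n))" using s'(2) by blast
    then show "\<exists>l\<in>carrier H. hlim H s l" using l hlim[of s' l] s'(1) by auto
  next
    fix x y assume "x \<in> carrier H" "y \<in> carrier H"
    then obtain x' y' where xy: "x' \<in> S" "x = J x'" "y' \<in> S" "y = J y'" by auto
    show "cinner H y x = cnj (cinner H x y)" using ip_cnj[OF xy(1,3)] xy by simp
  next
    fix x assume "x \<in> carrier H" "x \<noteq> \<zero>\<^bsub>H\<^esub>"
    then obtain x' where x: "x' \<in> S" "x = J x'" "x' \<noteq> 0" by auto
    show "0 < Re (cinner H x x)" using ip_pos[OF x(1,3)] x by simp
  qed (auto simp: ip_simps)
  define \<rho> where "\<rho> a x = J (\<pi> a (K x))" for a x
  have "Defs.representation H \<rho>"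
  proof (intro representation.intro HS representation_axioms.intro)
    fix a
    obtain B where "bounded_op (\<pi> a) B" using rep_bounded by blast
    then have "\<forall>x\<in>carrier H. hnorm H (\<rho> a x) \<le> B * hnorm H x"
      using bounded_opD by (auto simp: \<rho>_def hn)
    moreover have "\<rho> a \<in> LinearCombinations.module_hom (class_ring :: complex ring) H H"
      unfolding LinearCombinations.module_hom_def \<rho>_def by (auto simp: rep_lin)
    ultimately show "\<rho> a \<in> bounded_operators H" unfolding bounded_operators_def by blast
  qed (auto simp: \<rho>_def rep_add rep_scaleC rep_mult rep_one rep_star)
  moreover have "carrier H \<noteq> {\<zero>\<^bsub>H\<^esub>}"
  proof
    assume "carrier H = {\<zero>\<^bsub>H\<^esub>}"
    then have "J x = J 0" if "x \<in> S" for x using that by auto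
    then have "x = 0" if "x \<in> S" for x using inj_onD[OF inj _ that S_zero] that by blast
    then show False using irr S_zero unfolding irreducible_def by blast
  qed
  moreover have "W = {\<zero>\<^bsub>H\<^esub>} \<or> W = carrier H" if W: "closed_subspace H W" "\<And>a. \<rho> a ` W \<subseteq> W" for W
  proof -
    have sub: "submodule (class_ring :: complex ring) W H"
      using W(1) unfolding closed_subspace_def VectorSpace.subspace_def by blast
    note sm = submodule.subset[OF sub] submodule.m_closed[OF sub] submodule.zero_closed[OF sub]
      submodule.smult_closed[OF sub]
    define W' where "W' = {x \<in> S. J x \<in> W}"
    have WW: "W = J ` W'" using sm(1) by (auto simp: W'_def)
    have "linear_subspace W'"
      unfolding linear_subspace_def W'_def
    proof (intro conjI ballI allI)
      show "x + y \<in> {x \<in> S. J x \<in> W}" if "x \<in> {x \<in> S. J x \<in> W}" "y \<in> {x \<in> S. J x \<in> W}" for x y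
        using that sm(2)[of "J x" "J y"] by simp
      show "sc c x \<in> {x \<in> S. J x \<in> W}" if "x \<in> {x \<in> S. J x \<in> W}" for c x
        using that sm(4)[of c "J x"] by simp
    qed (use sm(3) in auto)
    moreover have "l \<in> W'" if s: "\<And>n. s n \<in> W'" and l: "l \<in> S" "converges s l" for s l
    proof -
      have "hlim H (\<lambda>n. J (s n)) (J l)" using hlim[of s l] s l by (simp add: W'_def)
      moreover have "\<And>n. J (s n) \<in> W" using s by (simp add: W'_def)
      ultimately have "J l \<in> W"
        using W(1)[unfolded closed_subspace_def, THEN conjunct2, rule_format, of "\<lambda>n. J (s n)" "J l"] l by simp
      then show ?thesis using l by (simp add: W'_def)
    qed
    ultimately have "closed_subsp W'" unfolding closed_subsp_def by blast
    moreover have "\<pi> a ` W' \<subseteq> W'" for a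
    proof safe
      fix x assume "x \<in> W'"
      then have x: "x \<in> S" "J x \<in> W" by (auto simp: W'_def)
      then have "\<rho> a (J x) \<in> W" using W(2) by blast
      then show "\<pi> a x \<in> W'" using x by (simp add: \<rho>_def W'_def)
    qed
    ultimately have "W' = {0} \<or> W' = S" using irr unfolding irreducible_def by blast
    then show ?thesis unfolding WW by auto
  qed
  ultimately have irrH: "irreducible_representation H \<rho>"
    unfolding irreducible_representation_def by blast
  have "n \<le> V.dim" if w: "orthonormal w n" and fd: V.fin_dim for n w
  proof -
    have wS: "w i \<in> S" if "i < n" for i using w that by (simp add: orthonormal_def)
    have winj: "inj_on (\<lambda>i. J (w i)) {..<n}"
    proof (rule inj_onI)
      fix i j assume ij: "i \<in> {..<n}" "j \<in> {..<n}" "J (w i) = J (w j)"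
      then have "w i = w j" using inj wS by (auto simp: inj_on_def)
      then show "i = j" using w ij unfolding orthonormal_def by (metis lessThan_iff zero_neq_one)
    qed
    have fs: "finsum H (\<lambda>v. a v \<odot>\<^bsub>H\<^esub> v) ((\<lambda>i. J (w i)) ` I) = J (\<Sum>i\<in>I. sc (a (J (w i))) (w i))"
      if "finite I" "I \<subseteq> {..<n}" for I a
      using that
    proof (induction I)
      case empty
      show ?case by (simp del: H(3,4))
    next
      case (insert i I)
      have i: "i < n" and I: "\<And>j. j \<in> I \<Longrightarrow> j < n" using insert by auto
      have "J (w i) \<notin> (\<lambda>i. J (w i)) ` I" using winj insert by (auto simp: inj_on_def)
      then have "finsum H (\<lambda>v. a v \<odot>\<^bsub>H\<^esub> v) ((\<lambda>i. J (w i)) ` insert i I) =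
        a (J (w i)) \<odot>\<^bsub>H\<^esub> J (w i) \<oplus>\<^bsub>H\<^esub> finsum H (\<lambda>v. a v \<odot>\<^bsub>H\<^esub> v) ((\<lambda>i. J (w i)) ` I)"
        unfolding image_insert using insert.hyps(1) wS i I by (intro V.finsum_insert) auto
      also have "\<dots> = J (\<Sum>i\<in>insert i I. sc (a (J (w i))) (w i))"
        using insert wS i I by (simp add: S_sum)
      finally show ?case .
    qed
    let ?A = "(\<lambda>i. J (w i)) ` {..<n}"
    have "\<not> V.lin_dep ?A"
    proof (rule V.finite_lin_indpt2)
      fix a assume 0: "V.lincomb a ?A = \<zero>\<^bsub>H\<^esub>"
      have "J (\<Sum>i<n. sc (a (J (w i))) (w i)) = J 0"
        using 0 fs[of "{..<n}" a] unfolding V.lincomb_def by simp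
      then have z: "(\<Sum>i<n. sc (a (J (w i))) (w i)) = 0"
        using inj wS S_zero S_sum[of "{..<n}" "\<lambda>i. sc (a (J (w i))) (w i)"] by (auto simp: inj_on_def)
      have "a (J (w j)) = 0" if j: "j < n" for j
      proof -
        have "0 = ip (\<Sum>i<n. sc (a (J (w i))) (w i)) (w j)" using z wS[OF j] by simp
        also have "\<dots> = (\<Sum>i<n. ip (sc (a (J (w i))) (w i)) (w j))"
          using wS j by (intro ip_sum_left) auto
        also have "\<dots> = (\<Sum>i<n. if i = j then a (J (w j)) else 0)"
          using w j wS unfolding orthonormal_def by (intro sum.cong refl) (auto simp: ip_sc_left)
        finally show ?thesis using j by simp
      qed
      then show "\<forall>v\<in>?A. a v = \<zero>\<^bsub>class_ring\<^esub>" by simp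
    qed (use wS in auto)
    then have "card ?A \<le> V.dim" using V.li_le_dim(2)[OF fd, of ?A] wS by auto
    then show ?thesis using winj by (simp add: card_image)
  qed
  then show ?thesis using irrH by blast
qed

text \<open>Cyclicity as injectivity: this places the dilation space, whose type is tied to tuples,
  inside \<open>'a \<Rightarrow> complex\<close>, the left summand over which
  \<open>subhomogeneous\<close> quantifies.\<close>

lemma cyclic_embedding_inj:
  assumes irr: irreducible and x: "x \<in> S" "x \<noteq> 0"
  shows "inj_on (\<lambda>y a. ip y (\<pi> a x)) S"
proof (rule inj_onI)
  fix y z assume yz: "y \<in> S" "z \<in> S" and eq: "(\<lambda>a. ip y (\<pi> a x)) = (\<lambda>a. ip z (\<pi> a x))"
  have "ip (y - z) (\<pi> a x) = 0" for a
    using fun_cong[OF eq, of a] yz x by (simp add: ip_diff_left)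
  then have "y - z = 0" by (rule cyclic_dense[OF irr x S_diff[OF yz]])
  then show "y = z" by simp
qed

end

lemma extreme_level_le:
  fixes \<phi> :: "'a::unital_cstar_algebra \<Rightarrow> complex mat"
  assumes sub: "subhomogeneous TYPE('a) TYPE('h) N" and ext: "matrix_extreme_point n \<phi>"
  shows "n \<le> N"
proof (rule stinespring)
  show "\<phi> \<in> UCP n" using ext by (simp add: matrix_extreme_point_def)
  fix S ip and \<pi> :: "'a \<Rightarrow> _" and V :: "nat \<Rightarrow> (nat \<Rightarrow> 'a) \<Rightarrow> complex"
  assume rep: "star_rep scaleF S ip \<pi>" and V: "\<And>i. V i \<in> S"
    "\<And>a i j. i < n \<Longrightarrow> j < n \<Longrightarrow> \<phi> a $$ (i, j) = ip (\<pi> a (V j)) (V i)"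
    "\<And>W. semi_inner.closed_subsp scaleF S ip W \<Longrightarrow> (\<And>a. \<pi> a ` W \<subseteq> W) \<Longrightarrow> (\<And>i. i < n \<Longrightarrow> V i \<in> W) \<Longrightarrow> W = S"
  interpret dilation scaleF S ip \<pi> n \<phi> V
    by (intro dilation.intro rep dilation_axioms.intro ext V)
  \<comment> \<open>\<open>V 0\<close> is available since \<open>0 < n\<close>; being a unit vector
    of an irreducible representation, it is cyclic.\<close>
  define J :: "_ \<Rightarrow> ('a \<Rightarrow> complex) + 'h" where "J y = Inl (\<lambda>a. ip y (\<pi> a (V 0)))" for y
  have "ip (V 0) (V 0) = 1" using orthonormal_V n_pos by (simp add: orthonormal_def)
  then have "V 0 \<noteq> 0" using V(1)[of 0] by auto
  then have "inj_on J S"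
    using cyclic_embedding_inj[OF irreducible_if_extreme V(1)] by (auto simp: J_def inj_on_def)
  from transport_to_record[OF this irreducible_if_extreme]
  obtain H :: "(('a \<Rightarrow> complex) + 'h) inner_space" and \<rho> :: "'a \<Rightarrow> _" where
    H: "irreducible_representation H \<rho>"
    "\<And>n w. orthonormal w n \<Longrightarrow> vectorspace.fin_dim (class_ring :: complex ring) H \<Longrightarrow>
      n \<le> vectorspace.dim (class_ring :: complex ring) H"
    by blast
  have "vectorspace.fin_dim (class_ring :: complex ring) H"
    "vectorspace.dim (class_ring :: complex ring) H \<le> N"
    using sub H(1) unfolding subhomogeneous_def by blast+
  then show "n \<le> N" using H(2)[OF orthonormal_V] by simp
qed

text \<open>The type underlying a record has no addition of its own, so vectors are mapped to the
  functions \<open>y \<mapsto> \<langle>x, y\<rangle>\<close>, cut off to 0 outside the carrier;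
  there sums and multiples are pointwise. The dimension bound is the spanning alternative of
  \<open>orthonormal_or_spanning\<close>.\<close>

lemma transport_from_record:
  fixes H :: "'k inner_space" and \<rho> :: "'a::unital_cstar_algebra \<Rightarrow> 'k \<Rightarrow> 'k"
  assumes irr: "irreducible_representation H \<rho>"
  shows "\<exists>S ip (\<pi> :: 'a \<Rightarrow> ('k \<Rightarrow> complex) \<Rightarrow> 'k \<Rightarrow> complex). star_rep scaleF S ip \<pi> \<and>
    star_rep.irreducible scaleF S ip \<pi> \<and>
    (\<forall>N. (\<nexists>w. hilbert.orthonormal S ip w (Suc N)) \<longrightarrow>
      vectorspace.fin_dim (class_ring :: complex ring) H \<and> vectorspace.dim (class_ring :: complex ring) H \<le> N)"
proof -
  interpret representation H \<rho> using irr by (simp add: irreducible_representation_def)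
  define \<Phi> :: "'k \<Rightarrow> 'k \<Rightarrow> complex" where "\<Phi> x y = (if y \<in> carrier H then cinner H x y else 0)" for x y
  have \<Phi>_add: "\<Phi> (x \<oplus>\<^bsub>H\<^esub> y) = \<Phi> x + \<Phi> y" if "x \<in> carrier H" "y \<in> carrier H" for x y
    using that by (auto simp: \<Phi>_def fun_eq_iff cinner_add_left)
  have \<Phi>_sc: "\<Phi> (c \<odot>\<^bsub>H\<^esub> x) = scaleF c (\<Phi> x)" if "x \<in> carrier H" for c x
    using that by (auto simp: \<Phi>_def scaleF_def fun_eq_iff cinner_smult_left)
  have cancel: "(x \<ominus>\<^bsub>H\<^esub> y) \<oplus>\<^bsub>H\<^esub> y = x" if "x \<in> carrier H" "y \<in> carrier H" for x y
    using that by (simp add: a_minus_def M.a_assoc M.l_neg)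
  have mc: "x \<ominus>\<^bsub>H\<^esub> y \<in> carrier H" if "x \<in> carrier H" "y \<in> carrier H" for x y
    using that by simp
  have \<Phi>_minus: "\<Phi> (x \<ominus>\<^bsub>H\<^esub> y) = \<Phi> x - \<Phi> y" if "x \<in> carrier H" "y \<in> carrier H" for x y
    using \<Phi>_add[OF mc[OF that] that(2)] cancel[OF that] by simp
  have \<Phi>_0: "x = \<zero>\<^bsub>H\<^esub>" if "x \<in> carrier H" "\<Phi> x = 0" for x
  proof (rule ccontr)
    assume "x \<noteq> \<zero>\<^bsub>H\<^esub>"
    moreover have "cinner H x x = 0" using fun_cong[OF that(2), of x] that(1) by (simp add: \<Phi>_def)
    ultimately show False using cinner_pos[OF that(1)] by simp
  qed
  have \<Phi>_zero: "\<Phi> \<zero>\<^bsub>H\<^esub> = 0" using \<Phi>_add[of "\<zero>\<^bsub>H\<^esub>" "\<zero>\<^bsub>H\<^esub>"] by simp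
  have inj: "inj_on \<Phi> (carrier H)"
  proof (rule inj_onI)
    fix x y assume xy: "x \<in> carrier H" "y \<in> carrier H" "\<Phi> x = \<Phi> y"
    then have "x \<ominus>\<^bsub>H\<^esub> y = \<zero>\<^bsub>H\<^esub>" using \<Phi>_minus[of x y] mc by (intro \<Phi>_0) auto
    then show "x = y" using cancel[OF xy(1,2)] xy by simp
  qed
  define S where "S = \<Phi> ` carrier H"
  define J where "J = inv_into (carrier H) \<Phi>"
  have J\<Phi> [simp]: "J (\<Phi> x) = x" if "x \<in> carrier H" for x using inj that by (simp add: J_def)
  define ip where "ip f g = cinner H (J f) (J g)" for f g
  define \<pi> where "\<pi> a f = \<Phi> (\<rho> a (J f))" for a f
  have \<rho>c: "\<rho> a x \<in> carrier H" if "x \<in> carrier H" for a x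
    using bounded[of a] that unfolding bounded_operators_def LinearCombinations.module_hom_def by auto
  have SE: "\<exists>x\<in>carrier H. f = \<Phi> x" if "f \<in> S" for f using that by (auto simp: S_def)
  have \<Phi>S: "\<Phi> x \<in> S" if "x \<in> carrier H" for x using that by (simp add: S_def)
  have ip\<Phi>: "ip (\<Phi> x) (\<Phi> y) = cinner H x y" if "x \<in> carrier H" "y \<in> carrier H" for x y
    using that by (simp add: ip_def)
  have \<pi>\<Phi>: "\<pi> a (\<Phi> x) = \<Phi> (\<rho> a x)" if "x \<in> carrier H" for a x
    using that by (simp add: \<pi>_def)
  have semi: "semi_inner scaleF S ip"
  proof (intro semi_inner.intro vector_space_scaleF semi_inner_axioms.intro)
    show "0 \<in> S" using \<Phi>_zero \<Phi>S by (metis M.zero_closed)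
    show "x + y \<in> S" if "x \<in> S" "y \<in> S" for x y
      using SE[OF that(1)] SE[OF that(2)] \<Phi>S by (auto simp flip: \<Phi>_add)
    show "scaleF c x \<in> S" if "x \<in> S" for c x
      using SE[OF that] \<Phi>S by (auto simp flip: \<Phi>_sc)
    show "ip (x + y) z = ip x z + ip y z" if "x \<in> S" "y \<in> S" "z \<in> S" for x y z
      using SE[OF that(1)] SE[OF that(2)] SE[OF that(3)] by (auto simp: ip\<Phi> cinner_add_left simp flip: \<Phi>_add)
    show "ip (scaleF c x) y = c * ip x y" if "x \<in> S" "y \<in> S" for c x y
      using SE[OF that(1)] SE[OF that(2)] by (auto simp: ip\<Phi> cinner_smult_left simp flip: \<Phi>_sc)
    show "ip y x = cnj (ip x y)" if S: "x \<in> S" "y \<in> S" for x y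
    proof -
      obtain x' y' where xy: "x' \<in> carrier H" "x = \<Phi> x'" "y' \<in> carrier H" "y = \<Phi> y'"
        using SE[OF S(1)] SE[OF S(2)] by blast
      show ?thesis using cinner_commute[OF xy(1,3)] xy by (simp add: ip\<Phi>)
    qed
    show "0 \<le> Re (ip x x)" if S: "x \<in> S" for x
    proof -
      obtain y where y: "y \<in> carrier H" "x = \<Phi> y" using SE[OF S] by blast
      show ?thesis
      proof (cases "y = \<zero>\<^bsub>H\<^esub>")
        case True
        have "cinner H (0 \<odot>\<^bsub>H\<^esub> y) y = 0" using cinner_smult_left[OF y(1) y(1), of 0] by simp
        moreover have "0 \<odot>\<^bsub>H\<^esub> y = y"
          using True \<Phi>_sc[OF y(1), of 0] y(1) \<Phi>_zero by (intro inj_onD[OF inj]) (auto simp: scaleF_def fun_eq_iff)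
        ultimately show ?thesis using y by (simp add: ip\<Phi>)
      next
        case False
        then show ?thesis using cinner_pos[OF y(1)] y by (simp add: ip\<Phi>)
      qed
    qed
  qed
  interpret S: semi_inner scaleF S ip by (rule semi)
  have hn: "hnorm H x = S.nrm (\<Phi> x)" if "x \<in> carrier H" for x
    using that by (simp add: hnorm_def S.nrm_def ip\<Phi>)
  have hlim: "hlim H s l \<longleftrightarrow> S.converges (\<lambda>n. \<Phi> (s n)) (\<Phi> l)" if "\<And>n. s n \<in> carrier H" "l \<in> carrier H" for s l
    using that mc by (simp add: hlim_def S.converges_def hn \<Phi>_minus)
  have hilb: "hilbert scaleF S ip"
  proof (intro hilbert.intro semi hilbert_axioms.intro)
    show "0 < Re (ip x x)" if x: "x \<in> S" "x \<noteq> 0" for x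
    proof -
      obtain y where y: "y \<in> carrier H" "x = \<Phi> y" using SE[OF x(1)] by blast
      then show ?thesis using cinner_pos[OF y(1)] x(2) \<Phi>_zero by (auto simp: ip\<Phi>)
    qed
    fix f assume f: "\<And>n. f n \<in> S" and c: "S.cauchy f"
    define s where "s n = J (f n)" for n
    have s: "s n \<in> carrier H" "f n = \<Phi> (s n)" for n using SE[OF f[of n]] by (auto simp: s_def)
    have "\<exists>M. \<forall>m\<ge>M. \<forall>n\<ge>M. hnorm H (s m \<ominus>\<^bsub>H\<^esub> s n) < e" if "0 < e" for e
      using c[unfolded S.cauchy_def, rule_format, OF that] s mc by (simp add: hn \<Phi>_minus)
    from complete[OF s(1) this] obtain l where l: "l \<in> carrier H" "hlim H s l" by blast
    have "f = (\<lambda>n. \<Phi> (s n))" using s(2) by blast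
    then show "\<exists>l\<in>S. S.converges f l" using hlim[OF s(1) l(1)] l \<Phi>S by auto
  qed
  interpret S: hilbert scaleF S ip by (rule hilb)
  have srep: "star_rep scaleF S ip \<pi>"
  proof (intro star_rep.intro hilb star_rep_axioms.intro)
    fix a
    have hom: "\<rho> a \<in> LinearCombinations.module_hom (class_ring :: complex ring) H H"
      and "\<exists>B. \<forall>x\<in>carrier H. hnorm H (\<rho> a x) \<le> B * hnorm H x"
      using bounded[of a] unfolding bounded_operators_def by auto
    then obtain B where B: "\<And>x. x \<in> carrier H \<Longrightarrow> hnorm H (\<rho> a x) \<le> B * hnorm H x" by blast
    have "S.bounded_op (\<pi> a) \<bar>B\<bar>"
      unfolding S.bounded_op_def
    proof (intro conjI ballI allI)
      fix f g c assume "f \<in> S" "g \<in> S"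
      then obtain x y where x: "x \<in> carrier H" "f = \<Phi> x" and y: "y \<in> carrier H" "g = \<Phi> y" using SE by blast
      show "\<pi> a (f + g) = \<pi> a f + \<pi> a g"
        using x y \<rho>c LinearCombinations.module_hom_add[OF hom, of x y] M.a_closed[OF x(1) y(1)]
        by (simp add: \<pi>\<Phi> flip: \<Phi>_add)
    next
      fix f c assume "f \<in> S"
      then obtain x where x: "x \<in> carrier H" "f = \<Phi> x" using SE by blast
      show "\<pi> a f \<in> S" using x \<rho>c \<Phi>S by (simp add: \<pi>\<Phi>)
      show "\<pi> a (scaleF c f) = scaleF c (\<pi> a f)"
        using x \<rho>c LinearCombinations.module_hom_smult[OF hom, of c x] smult_closed[of c x]
        by (simp add: \<pi>\<Phi> flip: \<Phi>_sc)
      have "S.nrm (\<pi> a f) \<le> B * S.nrm f" using B[OF x(1)] x \<rho>c by (simp add: \<pi>\<Phi> hn)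
      also have "\<dots> \<le> \<bar>B\<bar> * S.nrm f" using x \<Phi>S by (intro mult_right_mono) auto
      finally show "S.nrm (\<pi> a f) \<le> \<bar>B\<bar> * S.nrm f" .
    qed simp
    then show "\<exists>K. S.bounded_op (\<pi> a) K" by blast
  next
    fix f g a b c assume "f \<in> S"
    then obtain x where x: "x \<in> carrier H" "f = \<Phi> x" using SE by blast
    show "\<pi> (a + b) f = \<pi> a f + \<pi> b f" using x \<rho>c by (simp add: \<pi>\<Phi> rep_add \<Phi>_add)
    show "\<pi> (scaleC c a) f = scaleF c (\<pi> a f)" using x \<rho>c by (simp add: \<pi>\<Phi> rep_scaleC \<Phi>_sc)
    show "\<pi> (a * b) f = \<pi> a (\<pi> b f)" using x \<rho>c by (simp add: \<pi>\<Phi> rep_mult)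
    show "\<pi> 1 f = f" using x by (simp add: \<pi>\<Phi> rep_one)
    assume "g \<in> S"
    then obtain y where y: "y \<in> carrier H" "g = \<Phi> y" using SE by blast
    show "ip (\<pi> (star a) f) g = ip f (\<pi> a g)" using x y \<rho>c by (simp add: \<pi>\<Phi> ip\<Phi> rep_star)
  qed
  interpret S: star_rep scaleF S ip \<pi> by (rule srep)
  have "S.irreducible"
    unfolding S.irreducible_def
  proof (intro conjI allI impI)
    show "S \<noteq> {0}"
    proof
      assume "S = {0}"
      then have "carrier H \<subseteq> {\<zero>\<^bsub>H\<^esub>}" using \<Phi>_0 \<Phi>S by blast
      then show False using irr M.zero_closed unfolding irreducible_representation_def by blast
    qed
    fix W assume "S.closed_subsp W \<and> (\<forall>a. \<pi> a ` W \<subseteq> W)"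
    then have W: "S.closed_subsp W" "\<And>a. \<pi> a ` W \<subseteq> W" by auto
    have lin: "S.linear_subspace W" using W(1) by (simp add: S.closed_subsp_def)
    note WD = S.linear_subspaceD[OF lin]
    define W' where "W' = {x \<in> carrier H. \<Phi> x \<in> W}"
    have WW: "W = \<Phi> ` W'" using WD(1) SE by (fastforce simp: W'_def)
    have "VectorSpace.subspace (class_ring :: complex ring) W' H"
    proof (intro VectorSpace.subspace.intro submodule.intro)
      show "vectorspace (class_ring :: complex ring) H" "Module.module (class_ring :: complex ring) H"
        by unfold_locales
    qed (use WD in \<open>auto simp: W'_def \<Phi>_add \<Phi>_sc \<Phi>_zero\<close>)
    moreover have "l \<in> W'" if "\<And>n. s n \<in> W'" "l \<in> carrier H" "hlim H s l" for s l
    proof -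
      have "S.converges (\<lambda>n. \<Phi> (s n)) (\<Phi> l)" using hlim[of s l] that by (simp add: W'_def)
      then have "\<Phi> l \<in> W"
        using W(1)[unfolded S.closed_subsp_def, THEN conjunct2, rule_format, of "\<lambda>n. \<Phi> (s n)" "\<Phi> l"]
          that \<Phi>S by (simp add: W'_def)
      then show ?thesis using that by (simp add: W'_def)
    qed
    ultimately have "closed_subspace H W'" unfolding closed_subspace_def by blast
    moreover have "\<rho> a ` W' \<subseteq> W'" for a
    proof safe
      fix x assume "x \<in> W'"
      then have x: "x \<in> carrier H" "\<Phi> x \<in> W" by (auto simp: W'_def)
      then have "\<pi> a (\<Phi> x) \<in> W" using W(2) by blast
      then show "\<rho> a x \<in> W'" using x \<rho>c by (simp add: \<pi>\<Phi> W'_def)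
    qed
    ultimately have "W' = {\<zero>\<^bsub>H\<^esub>} \<or> W' = carrier H"
      using irr unfolding irreducible_representation_def by blast
    then show "W = {0} \<or> W = S" unfolding WW S_def using \<Phi>_zero by auto
  qed
  moreover have "fin_dim \<and> dim \<le> N" if none: "\<nexists>w. S.orthonormal w (Suc N)" for N
  proof -
    obtain r w where r: "r < Suc N" and w: "S.orthonormal w r" and span: "\<And>f. f \<in> S \<Longrightarrow> S.fourier w r f = f"
      using S.orthonormal_or_spanning[of "Suc N"] none by blast
    define A where "A = (\<lambda>i. J (w i)) ` {..<r}"
    have Jw: "J (w i) \<in> carrier H" "w i = \<Phi> (J (w i))" if "i < r" for i
      using SE[of "w i"] w that by (auto simp: S.orthonormal_def)
    have AH: "A \<subseteq> carrier H" unfolding A_def using Jw(1) by (intro image_subsetI) simp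
    interpret sp: submodule "class_ring :: complex ring" "span A" H by (rule span_is_submodule[OF AH])
    \<comment> \<open>Linear combinations are pulled back to the record one term at a time, since
      \<open>\<Phi>\<close> respects binary sums and multiples.\<close>
    have "\<exists>x\<in>span A. \<Phi> x = (\<Sum>i<m. scaleF (c i) (w i))" if "m \<le> r" for m c
      using that
    proof (induction m)
      case 0
      show ?case by (rule bexI[OF _ sp.zero_closed]) (simp only: lessThan_0 sum.empty \<Phi>_zero)
    next
      case (Suc m)
      have m: "m < r" using Suc.prems by simp
      from Suc.IH[OF less_imp_le[OF m]] obtain x
        where x: "x \<in> span A" "\<Phi> x = (\<Sum>i<m. scaleF (c i) (w i))" by blast
      have "J (w m) \<in> A" using m by (simp add: A_def)
      then have "J (w m) \<in> span A" using in_own_span[OF AH] by blast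
      then have s: "c m \<odot>\<^bsub>H\<^esub> J (w m) \<in> span A" by simp
      have "\<Phi> (x \<oplus>\<^bsub>H\<^esub> c m \<odot>\<^bsub>H\<^esub> J (w m)) = \<Phi> x + \<Phi> (c m \<odot>\<^bsub>H\<^esub> J (w m))"
        by (rule \<Phi>_add[OF subsetD[OF sp.subset x(1)] subsetD[OF sp.subset s]])
      also have "\<dots> = (\<Sum>i<Suc m. scaleF (c i) (w i))"
        unfolding x(2) \<Phi>_sc[OF Jw(1)[OF m]] Jw(2)[OF m, symmetric] by simp
      finally show ?case by (rule bexI[OF _ sp.m_closed[OF x(1) s]])
    qed
    note comb = this[OF order_refl]
    have "x \<in> span A" if x: "x \<in> carrier H" for x
    proof -
      obtain y where y: "y \<in> span A" "\<Phi> y = (\<Sum>i<r. scaleF (ip (\<Phi> x) (w i)) (w i))"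
        using comb[of "\<lambda>i. ip (\<Phi> x) (w i)"] by blast
      have "\<Phi> y = \<Phi> x" using y(2) span[OF \<Phi>S[OF x]] by (simp add: S.fourier_def)
      then have "y = x" by (rule inj_onD[OF inj _ subsetD[OF sp.subset y(1)] x])
      then show ?thesis using y(1) by simp
    qed
    then have gen: "span A = carrier H" using sp.subset by blast
    have fin: "finite A" by (simp add: A_def)
    have "dim \<le> card A" by (rule gen_ge_dim[OF fin AH gen])
    also have "\<dots> \<le> r" unfolding A_def using card_image_le[of "{..<r}"] by simp
    finally show ?thesis using r fin AH gen unfolding fin_dim_def by auto
  qed
  ultimately show ?thesis using srep by blast
qed

theorem proposition3p1:
  fixes N :: nat
  assumes "1 \<le> N"
  shows "subhomogeneous TYPE('a::unital_cstar_algebra) TYPE('h) N \<longleftrightarrow>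
    (matrix_extreme_points :: ('a \<Rightarrow> complex mat) set) \<subseteq> (\<Union>n\<in>{1..N}. UCP n)"
proof
  assume sub: "subhomogeneous TYPE('a) TYPE('h) N"
  show "(matrix_extreme_points :: ('a \<Rightarrow> complex mat) set) \<subseteq> (\<Union>n\<in>{1..N}. UCP n)"
  proof
    fix \<phi> :: "'a \<Rightarrow> complex mat" assume "\<phi> \<in> matrix_extreme_points"
    then obtain n where ext: "matrix_extreme_point n \<phi>" by (auto simp: matrix_extreme_points_def)
    then have "0 < n" "\<phi> \<in> UCP n" by (auto simp: matrix_extreme_point_def)
    then show "\<phi> \<in> (\<Union>n\<in>{1..N}. UCP n)" using extreme_level_le[OF sub ext] by (auto intro!: bexI[of _ n])
  qed
next
  assume levels: "(matrix_extreme_points :: ('a \<Rightarrow> complex mat) set) \<subseteq> (\<Union>n\<in>{1..N}. UCP n)"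
  show "subhomogeneous TYPE('a) TYPE('h) N"
    unfolding subhomogeneous_def
  proof (intro allI impI)
    fix H :: "(('a \<Rightarrow> complex) + 'h) inner_space" and \<rho> :: "'a \<Rightarrow> _"
    assume "irreducible_representation H \<rho>"
    from transport_from_record[OF this] obtain S ip
      and \<pi> :: "'a \<Rightarrow> ((('a \<Rightarrow> complex) + 'h) \<Rightarrow> complex) \<Rightarrow> (('a \<Rightarrow> complex) + 'h) \<Rightarrow> complex"
      where rep: "star_rep scaleF S ip \<pi>" and irr: "star_rep.irreducible scaleF S ip \<pi>"
        and dim: "(\<nexists>w. hilbert.orthonormal S ip w (Suc N)) \<Longrightarrow>
          vectorspace.fin_dim (class_ring :: complex ring) H \<and> vectorspace.dim (class_ring :: complex ring) H \<le> N"
      by blast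
    interpret star_rep scaleF S ip \<pi> by (rule rep)
    \<comment> \<open>The compression would be extreme at level \<open>N + 1\<close>, yet its values
      are matrices of size \<open>N + 1\<close>, so it belongs to no \<open>UCP n\<close> with
      \<open>n \<le> N\<close>.\<close>
    have "\<not> orthonormal w (Suc N)" for w
    proof
      assume w: "orthonormal w (Suc N)"
      have "compression w (Suc N) \<in> matrix_extreme_points"
        using extreme_if_irreducible[OF irr w] by (auto simp: matrix_extreme_points_def)
      with levels have "compression w (Suc N) \<in> (\<Union>n\<in>{1..N}. UCP n)" by (rule subsetD)
      then obtain n where "n \<le> N" "compression w (Suc N) \<in> UCP n" by auto
      then show False using UCP_D(1)[of "compression w (Suc N)" n 0] by (auto simp: compression_def)
    qed
    then show "vectorspace.fin_dim (class_ring :: complex ring) H \<and>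
      vectorspace.dim (class_ring :: complex ring) H \<le> N" using dim by blast
  qed
qed

end
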